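(* Let $\Lambda$ be a ring, let $F$ be a right-exact covariant functor from (left or right) $\Lambda$-modules to abelian groups, and let $0 \to B' \to B \to B'' \to 0$ be a short exact sequence of such modules. Then the following sequence, infinite in both directions, with the maps described in the context, is exact: $$\cdots \to L_iF(B') \to L_iF(B) \to L_iF(B'') \to \cdots \to L_1F(B') \to L_1F(B) \to L_1F(B'') \to$$ $$\to \overline{F}(B') \to \overline{F}(B) \to \overline{F}(B'') \to \overline{F}(\Sigma B') \to \overline{F}(\Sigma B) \to \overline{F}(\Sigma B'') \to \cdots$$ $$\cdots \to \overline{F}(\Sigma^j B') \to \overline{F}(\Sigma^j B) \to \overline{F}(\Sigma^j B'') \to \cdots$$
   Context: $L_iF$ denotes the $i$-th left-derived functor of $F$ (projective resolutions). Injective stabilization: for a module $M$ choose an exact sequence $0 \to M \overset{\iota}{\to} I^0 \overset{\partial}{\to} I^1$ with $I^0, I^1$ injective. Then $R^0F(M) = \ker F(\partial)$, the map $F(\iota)$ induces a natural transformation $\rho_F : F \to R^0F$, and $\overline{F} := \ker \rho_F \subseteq F$. One has $\overline{F}(M) = \ker F(\iota)$ for any embedding $\iota$ of $M$ into an injective module. Cosyzygies: choose injective resolutions of $B'$ and $B''$ and use the horseshoe lemma to build an injective resolution of $B$ fitting in a (degreewise split) short exact sequence of resolutions; $\Sigma^j$ denotes the $j$-th cosyzygy modules in these resolutions ($\Sigma^0$ being the identity), so for every $j \ge 0$ there is a short exact sequence $0 \to \Sigma^jB' \to \Sigma^jB \to \Sigma^jB'' \to 0$. Maps: the maps $L_iF(B')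 \to L_iF(B) \to L_iF(B'')$ and $\overline{F}(\Sigma^jB') \to \overline{F}(\Sigma^jB) \to \overline{F}(\Sigma^jB'')$ are induced by functoriality. The maps $L_{i+1}F(B'') \to L_iF(B')$, $i \ge 1$, are the usual connecting homomorphisms. The map $L_1F(B'') \to \overline{F}(B')$ is the usual connecting homomorphism $L_1F(B'') \to F(B')$, whose image lies in $\overline{F}(B')$. The map $\overline{F}(\Sigma^jB'') \to \overline{F}(\Sigma^{j+1}B')$ is the snake-lemma connecting homomorphism $\overline{F}(\Sigma^jB'') \to F(\Sigma^{j+1}B')$ obtained by applying $F$ to the $3\times 3$ diagram with rows $0 \to \Sigma^jB' \to \Sigma^jB \to \Sigma^jB'' \to 0$, $0 \to I'^j \to I^j \to I''^j \to 0$ (the terms of the resolutions), and $0 \to \Sigma^{j+1}B' \to \Sigma^{j+1}B \to \Sigma^{j+1}B'' \to 0$; its image lies in $\overline{F}(\Sigma^{j+1}B')$. *)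

theory Defs
  imports "HOL-Algebra.Algebra"
begin

(* The locale "module" of HOL-Algebra requires a commutative ring; the record type is reused here
   for modules over arbitrary rings (its multiplication and unit fields play no role).
   All modules under consideration have their carrier in one type 'm, which acts as the universe.
   If 'm is infinite and at least as large as the ring, it contains enough projectives (free modules),
   and projectivity and injectivity tested against modules in 'm are the usual notions (a free cover
   inside 'm splits; Baer's criterion). If moreover ('r => 'm) embeds into 'm, there are enough
   injectives. *)

locale left_module = R?: ring R + M?: abelian_group M
  for R :: "'r ring" and M :: "('r, 'm) module" (structure) +
  assumes smult_closed: "\<lbrakk>a \<in> carrier R; x \<in> carrier M\<rbrakk> \<Longrightarrow> a \<odot> x \<in> carrier M"
    and smult_l_distr: "\<lbrakk>a \<in> carrier R; b \<in> carrier R; x \<in> carrier M\<rbrakk>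
          \<Longrightarrow> (a \<oplus>\<^bsub>R\<^esub> b) \<odot> x = (a \<odot> x) \<oplus> (b \<odot> x)"
    and smult_r_distr: "\<lbrakk>a \<in> carrier R; x \<in> carrier M; y \<in> carrier M\<rbrakk>
          \<Longrightarrow> a \<odot> (x \<oplus> y) = (a \<odot> x) \<oplus> (a \<odot> y)"
    and smult_assoc: "\<lbrakk>a \<in> carrier R; b \<in> carrier R; x \<in> carrier M\<rbrakk>
          \<Longrightarrow> (a \<otimes>\<^bsub>R\<^esub> b) \<odot> x = a \<odot> (b \<odot> x)"
    and smult_one: "x \<in> carrier M \<Longrightarrow> \<one>\<^bsub>R\<^esub> \<odot> x = x"

(* Right modules over a ring are the left modules over its opposite ring. *)
definition opposite_ring :: "'r ring \<Rightarrow> 'r ring" where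
  "opposite_ring R = R\<lparr>mult := \<lambda>a b. b \<otimes>\<^bsub>R\<^esub> a\<rparr>"

definition lin_hom :: "'r ring \<Rightarrow> ('r, 'm) module \<Rightarrow> ('r, 'm) module \<Rightarrow> ('m \<Rightarrow> 'm) set" where
  "lin_hom R M N = {f. f \<in> carrier M \<rightarrow> carrier N \<and>
     (\<forall>x\<in>carrier M. \<forall>y\<in>carrier M. f (x \<oplus>\<^bsub>M\<^esub> y) = f x \<oplus>\<^bsub>N\<^esub> f y) \<and>
     (\<forall>a\<in>carrier R. \<forall>x\<in>carrier M. f (a \<odot>\<^bsub>M\<^esub> x) = a \<odot>\<^bsub>N\<^esub> f x)}"

definition short_exact ::
  "'r ring \<Rightarrow> ('r, 'm) module \<Rightarrow> ('m \<Rightarrow> 'm) \<Rightarrow> ('r, 'm) module \<Rightarrow> ('m \<Rightarrow> 'm) \<Rightarrow> ('r, 'm) module \<Rightarrow> bool"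
  where "short_exact R A f B g C \<longleftrightarrow>
     left_module R A \<and> left_module R B \<and> left_module R C \<and>
     f \<in> lin_hom R A B \<and> g \<in> lin_hom R B C \<and>
     inj_on f (carrier A) \<and> f ` carrier A = a_kernel B C g \<and> g ` carrier B = carrier C"

definition projective_module :: "'r ring \<Rightarrow> ('r, 'm) module \<Rightarrow> bool" where
  "projective_module R P \<longleftrightarrow> left_module R P \<and>
     (\<forall>(M :: ('r, 'm) module) (N :: ('r, 'm) module) p h.
        left_module R M \<longrightarrow> left_module R N \<longrightarrow>
        p \<in> lin_hom R M N \<longrightarrow> p ` carrier M = carrier N \<longrightarrow> h \<in> lin_hom R P N \<longrightarrow>
        (\<exists>k \<in> lin_hom R P M. \<forall>x\<in>carrier P. p (k x) = h x))"

definition injective_module :: "'r ring \<Rightarrow> ('r, 'm) module \<Rightarrow> bool" where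
  "injective_module R J \<longleftrightarrow> left_module R J \<and>
     (\<forall>(M :: ('r, 'm) module) (N :: ('r, 'm) module) i h.
        left_module R M \<longrightarrow> left_module R N \<longrightarrow>
        i \<in> lin_hom R M N \<longrightarrow> inj_on i (carrier M) \<longrightarrow> h \<in> lin_hom R M J \<longrightarrow>
        (\<exists>k \<in> lin_hom R N J. \<forall>x\<in>carrier M. k (i x) = h x))"


(* Functors to abelian groups (written multiplicatively, as elements of comm_group).
   A morphism M \<rightarrow> N is a function up to equality on the carrier of M; hence the last clause. *)

record ('r, 'm, 'g) mod_functor =
  fobj :: "('r, 'm) module \<Rightarrow> 'g monoid"
  fmap :: "('r, 'm) module \<Rightarrow> ('r, 'm) module \<Rightarrow> ('m \<Rightarrow> 'm) \<Rightarrow> 'g \<Rightarrow> 'g"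

definition covariant_functor :: "'r ring \<Rightarrow> ('r, 'm, 'g) mod_functor \<Rightarrow> bool" where
  "covariant_functor R F \<longleftrightarrow>
     (\<forall>M. left_module R M \<longrightarrow> comm_group (fobj F M)) \<and>
     (\<forall>M N f. left_module R M \<longrightarrow> left_module R N \<longrightarrow> f \<in> lin_hom R M N \<longrightarrow>
        fmap F M N f \<in> hom (fobj F M) (fobj F N)) \<and>
     (\<forall>M. left_module R M \<longrightarrow> (\<forall>x\<in>carrier (fobj F M). fmap F M M id x = x)) \<and>
     (\<forall>L M N f g. left_module R L \<longrightarrow> left_module R M \<longrightarrow> left_module R N \<longrightarrow>
        f \<in> lin_hom R L M \<longrightarrow> g \<in> lin_hom R M N \<longrightarrow>
        (\<forall>x\<in>carrier (fobj F L). fmap F L N (g \<circ> f) x = fmap F M N g (fmap F L M f x))) \<and>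
     (\<forall>M N f g. left_module R M \<longrightarrow> left_module R N \<longrightarrow>
        f \<in> lin_hom R M N \<longrightarrow> g \<in> lin_hom R M N \<longrightarrow> (\<forall>x\<in>carrier M. f x = g x) \<longrightarrow>
        (\<forall>x\<in>carrier (fobj F M). fmap F M N f x = fmap F M N g x))"

(* Exactness of A \<rightarrow> B \<rightarrow> C \<rightarrow> 0 is preserved. Additivity follows from this: split short exact
   sequences are sent to split short exact sequences. *)
definition right_exact :: "'r ring \<Rightarrow> ('r, 'm, 'g) mod_functor \<Rightarrow> bool" where
  "right_exact R F \<longleftrightarrow>
     (\<forall>A B C f g. left_module R A \<longrightarrow> left_module R B \<longrightarrow> left_module R C \<longrightarrow>
        f \<in> lin_hom R A B \<longrightarrow> g \<in> lin_hom R B C \<longrightarrow>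
        f ` carrier A = a_kernel B C g \<longrightarrow> g ` carrier B = carrier C \<longrightarrow>
        fmap F A B f ` carrier (fobj F A) = kernel (fobj F B) (fobj F C) (fmap F B C g) \<and>
        fmap F B C g ` carrier (fobj F B) = carrier (fobj F C))"

definition exact_at :: "'a monoid \<Rightarrow> ('a \<Rightarrow> 'b) \<Rightarrow> 'b monoid \<Rightarrow> ('b \<Rightarrow> 'c) \<Rightarrow> 'c monoid \<Rightarrow> bool" where
  "exact_at A f B g C \<longleftrightarrow>
     comm_group A \<and> comm_group B \<and> comm_group C \<and> f \<in> hom A B \<and> g \<in> hom B C \<and>
     f ` carrier A = kernel B C g"


(* One record for both kinds of resolution of M:
   projective: dif i : trm (Suc i) \<rightarrow> trm i and aug : trm 0 \<rightarrow> M;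
   injective:  dif i : trm i \<rightarrow> trm (Suc i) and aug : M \<rightarrow> trm 0. *)
record ('r, 'm) resolution =
  trm :: "nat \<Rightarrow> ('r, 'm) module"
  dif :: "nat \<Rightarrow> 'm \<Rightarrow> 'm"
  aug :: "'m \<Rightarrow> 'm"

definition projective_resolution :: "'r ring \<Rightarrow> ('r, 'm) module \<Rightarrow> ('r, 'm) resolution \<Rightarrow> bool" where
  "projective_resolution R M P \<longleftrightarrow> left_module R M \<and>
     (\<forall>i. projective_module R (trm P i)) \<and>
     (\<forall>i. dif P i \<in> lin_hom R (trm P (Suc i)) (trm P i)) \<and>
     aug P \<in> lin_hom R (trm P 0) M \<and>
     aug P ` carrier (trm P 0) = carrier M \<and>
     dif P 0 ` carrier (trm P 1) = a_kernel (trm P 0) M (aug P) \<and>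
     (\<forall>i. dif P (Suc i) ` carrier (trm P (Suc (Suc i)))
            = a_kernel (trm P (Suc i)) (trm P i) (dif P i))"

definition injective_resolution :: "'r ring \<Rightarrow> ('r, 'm) module \<Rightarrow> ('r, 'm) resolution \<Rightarrow> bool" where
  "injective_resolution R M J \<longleftrightarrow> left_module R M \<and>
     (\<forall>i. injective_module R (trm J i)) \<and>
     (\<forall>i. dif J i \<in> lin_hom R (trm J i) (trm J (Suc i))) \<and>
     aug J \<in> lin_hom R M (trm J 0) \<and>
     inj_on (aug J) (carrier M) \<and>
     aug J ` carrier M = a_kernel (trm J 0) (trm J 1) (dif J 0) \<and>
     (\<forall>i. dif J i ` carrier (trm J i)
            = a_kernel (trm J (Suc i)) (trm J (Suc (Suc i))) (dif J (Suc i)))"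

definition projective_lift ::
  "'r ring \<Rightarrow> ('m \<Rightarrow> 'm) \<Rightarrow> ('r, 'm) module \<Rightarrow> ('r, 'm) resolution \<Rightarrow> ('r, 'm) resolution \<Rightarrow> (nat \<Rightarrow> 'm \<Rightarrow> 'm) \<Rightarrow> bool"
  where "projective_lift R f M P Q \<phi> \<longleftrightarrow>
     (\<forall>i. \<phi> i \<in> lin_hom R (trm P i) (trm Q i)) \<and>
     (\<forall>i. \<forall>x\<in>carrier (trm P (Suc i)). \<phi> i (dif P i x) = dif Q i (\<phi> (Suc i) x)) \<and>
     (\<forall>x\<in>carrier (trm P 0). aug Q (\<phi> 0 x) = f (aug P x))"

definition injective_extension ::
  "'r ring \<Rightarrow> ('m \<Rightarrow> 'm) \<Rightarrow> ('r, 'm) module \<Rightarrow> ('r, 'm) resolution \<Rightarrow> ('r, 'm) resolution \<Rightarrow> (nat \<Rightarrow> 'm \<Rightarrow> 'm) \<Rightarrow> bool"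
  where "injective_extension R f M J K \<phi> \<longleftrightarrow>
     (\<forall>i. \<phi> i \<in> lin_hom R (trm J i) (trm K i)) \<and>
     (\<forall>i. \<forall>x\<in>carrier (trm J i). \<phi> (Suc i) (dif J i x) = dif K i (\<phi> i x)) \<and>
     (\<forall>x\<in>carrier M. \<phi> 0 (aug J x) = aug K (f x))"

(* Short exact sequences of resolutions over a short exact sequence B' \<rightarrow> B \<rightarrow> B'', as produced by
   the horseshoe lemma. They are automatically split in each degree, by projectivity of the terms
   of P'' and injectivity of the terms of J' respectively. *)

definition projective_horseshoe ::
  "'r ring \<Rightarrow> ('r, 'm) module \<Rightarrow> ('m \<Rightarrow> 'm) \<Rightarrow> ('r, 'm) module \<Rightarrow> ('m \<Rightarrow> 'm) \<Rightarrow> ('r, 'm) module \<Rightarrow>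
   ('r, 'm) resolution \<Rightarrow> (nat \<Rightarrow> 'm \<Rightarrow> 'm) \<Rightarrow> ('r, 'm) resolution \<Rightarrow> (nat \<Rightarrow> 'm \<Rightarrow> 'm) \<Rightarrow> ('r, 'm) resolution \<Rightarrow> bool"
  where "projective_horseshoe R B' f B g B'' P' u P v P'' \<longleftrightarrow>
     projective_resolution R B' P' \<and> projective_resolution R B P \<and> projective_resolution R B'' P'' \<and>
     projective_lift R f B' P' P u \<and> projective_lift R g B P P'' v \<and>
     (\<forall>i. short_exact R (trm P' i) (u i) (trm P i) (v i) (trm P'' i))"

definition injective_horseshoe ::
  "'r ring \<Rightarrow> ('r, 'm) module \<Rightarrow> ('m \<Rightarrow> 'm) \<Rightarrow> ('r, 'm) module \<Rightarrow> ('m \<Rightarrow> 'm) \<Rightarrow> ('r, 'm) module \<Rightarrow>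
   ('r, 'm) resolution \<Rightarrow> (nat \<Rightarrow> 'm \<Rightarrow> 'm) \<Rightarrow> ('r, 'm) resolution \<Rightarrow> (nat \<Rightarrow> 'm \<Rightarrow> 'm) \<Rightarrow> ('r, 'm) resolution \<Rightarrow> bool"
  where "injective_horseshoe R B' f B g B'' J' u J v J'' \<longleftrightarrow>
     injective_resolution R B' J' \<and> injective_resolution R B J \<and> injective_resolution R B'' J'' \<and>
     injective_extension R f B' J' J u \<and> injective_extension R g B J J'' v \<and>
     (\<forall>i. short_exact R (trm J' i) (u i) (trm J i) (v i) (trm J'' i))"


(* Left derived functors: homology of F applied to a chosen projective resolution. *)

definition chosen_resolution :: "'r ring \<Rightarrow> ('r, 'm) module \<Rightarrow> ('r, 'm) resolution" where
  "chosen_resolution R M = (SOME P. projective_resolution R M P)"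

definition cycles :: "('r, 'm, 'g) mod_functor \<Rightarrow> ('r, 'm) resolution \<Rightarrow> nat \<Rightarrow> 'g set" where
  "cycles F P i = (case i of
       0 \<Rightarrow> carrier (fobj F (trm P 0))
     | Suc k \<Rightarrow> kernel (fobj F (trm P (Suc k))) (fobj F (trm P k))
                 (fmap F (trm P (Suc k)) (trm P k) (dif P k)))"

definition boundaries :: "('r, 'm, 'g) mod_functor \<Rightarrow> ('r, 'm) resolution \<Rightarrow> nat \<Rightarrow> 'g set" where
  "boundaries F P i =
     fmap F (trm P (Suc i)) (trm P i) (dif P i) ` carrier (fobj F (trm P (Suc i)))"

definition homology :: "('r, 'm, 'g) mod_functor \<Rightarrow> ('r, 'm) resolution \<Rightarrow> nat \<Rightarrow> 'g set monoid" where
  "homology F P i = (fobj F (trm P i)\<lparr>carrier := cycles F P i\<rparr>) Mod (boundaries F P i)"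

definition homology_class :: "('r, 'm, 'g) mod_functor \<Rightarrow> ('r, 'm) resolution \<Rightarrow> nat \<Rightarrow> 'g \<Rightarrow> 'g set" where
  "homology_class F P i z = boundaries F P i #>\<^bsub>fobj F (trm P i)\<^esub> z"

definition Lder :: "'r ring \<Rightarrow> ('r, 'm, 'g) mod_functor \<Rightarrow> nat \<Rightarrow> ('r, 'm) module \<Rightarrow> 'g set monoid" where
  "Lder R F i M = homology F (chosen_resolution R M) i"

definition Lder_map ::
  "'r ring \<Rightarrow> ('r, 'm, 'g) mod_functor \<Rightarrow> nat \<Rightarrow> ('r, 'm) module \<Rightarrow> ('r, 'm) module \<Rightarrow> ('m \<Rightarrow> 'm) \<Rightarrow> 'g set \<Rightarrow> 'g set"
  where "Lder_map R F i M N f =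
     (let P = chosen_resolution R M; Q = chosen_resolution R N;
          \<phi> = (SOME \<phi>. projective_lift R f M P Q \<phi>)
      in (\<lambda>c. THE Y. \<exists>z\<in>c. Y = homology_class F Q i (fmap F (trm P i) (trm Q i) (\<phi> i) z)))"

(* The connecting homomorphism L_(i+1) F(B'') \<rightarrow> L_i F(B'): complete the chosen resolutions of B' and
   B'' to a short exact sequence of resolutions, and chase classes through F applied to it. *)
definition Lder_connecting ::
  "'r ring \<Rightarrow> ('r, 'm, 'g) mod_functor \<Rightarrow> nat \<Rightarrow> ('r, 'm) module \<Rightarrow> ('m \<Rightarrow> 'm) \<Rightarrow> ('r, 'm) module \<Rightarrow>
   ('m \<Rightarrow> 'm) \<Rightarrow> ('r, 'm) module \<Rightarrow> 'g set \<Rightarrow> 'g set"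
  where "Lder_connecting R F i B' f B g B'' =
     (let P' = chosen_resolution R B'; P'' = chosen_resolution R B'';
          (P, u, v) = (SOME (P, u, v). projective_horseshoe R B' f B g B'' P' u P v P'')
      in (\<lambda>c. THE Y. \<exists>b \<in> carrier (fobj F (trm P (Suc i))). \<exists>a \<in> cycles F P' i.
           fmap F (trm P (Suc i)) (trm P'' (Suc i)) (v (Suc i)) b \<in> c \<and>
           fmap F (trm P' i) (trm P i) (u i) a = fmap F (trm P (Suc i)) (trm P i) (dif P i) b \<and>
           Y = homology_class F P' i a))"

definition Lder0_to_F ::
  "'r ring \<Rightarrow> ('r, 'm, 'g) mod_functor \<Rightarrow> ('r, 'm) module \<Rightarrow> 'g set \<Rightarrow> 'g" where
  "Lder0_to_F R F M =
     (let P = chosen_resolution R M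
      in (\<lambda>c. THE y. \<exists>z\<in>c. y = fmap F (trm P 0) M (aug P) z))"

(* L_1 F(B'') \<rightarrow> L_0 F(B') \<rightarrow> F(B'), the second map being the isomorphism given by the augmentation. *)
definition L1_connecting ::
  "'r ring \<Rightarrow> ('r, 'm, 'g) mod_functor \<Rightarrow> ('r, 'm) module \<Rightarrow> ('m \<Rightarrow> 'm) \<Rightarrow> ('r, 'm) module \<Rightarrow>
   ('m \<Rightarrow> 'm) \<Rightarrow> ('r, 'm) module \<Rightarrow> 'g set \<Rightarrow> 'g"
  where "L1_connecting R F B' f B g B'' =
     Lder0_to_F R F B' \<circ> Lder_connecting R F 0 B' f B g B''"


(* Injective stabilization: the kernel of F(M) \<rightarrow> R^0 F(M) = ker (F(I0) \<rightarrow> F(I1)). *)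

definition injective_copresentation ::
  "'r ring \<Rightarrow> ('r, 'm) module \<Rightarrow> ('m \<Rightarrow> 'm) \<Rightarrow> ('r, 'm) module \<Rightarrow> ('m \<Rightarrow> 'm) \<Rightarrow> ('r, 'm) module \<Rightarrow> bool"
  where "injective_copresentation R M \<iota> I0 \<delta> I1 \<longleftrightarrow>
     left_module R M \<and> injective_module R I0 \<and> injective_module R I1 \<and>
     \<iota> \<in> lin_hom R M I0 \<and> \<delta> \<in> lin_hom R I0 I1 \<and>
     inj_on \<iota> (carrier M) \<and> \<iota> ` carrier M = a_kernel I0 I1 \<delta>"

definition chosen_copresentation ::
  "'r ring \<Rightarrow> ('r, 'm) module \<Rightarrow> ('m \<Rightarrow> 'm) \<times> ('r, 'm) module \<times> ('m \<Rightarrow> 'm) \<times> ('r, 'm) module" where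
  "chosen_copresentation R M = (SOME (\<iota>, I0, \<delta>, I1). injective_copresentation R M \<iota> I0 \<delta> I1)"

definition R0 :: "'r ring \<Rightarrow> ('r, 'm, 'g) mod_functor \<Rightarrow> ('r, 'm) module \<Rightarrow> 'g monoid" where
  "R0 R F M = (let (\<iota>, I0, \<delta>, I1) = chosen_copresentation R M
     in (fobj F I0)\<lparr>carrier := kernel (fobj F I0) (fobj F I1) (fmap F I0 I1 \<delta>)\<rparr>)"

definition rho :: "'r ring \<Rightarrow> ('r, 'm, 'g) mod_functor \<Rightarrow> ('r, 'm) module \<Rightarrow> 'g \<Rightarrow> 'g" where
  "rho R F M = (let (\<iota>, I0, \<delta>, I1) = chosen_copresentation R M in fmap F M I0 \<iota>)"

definition inj_stab :: "'r ring \<Rightarrow> ('r, 'm, 'g) mod_functor \<Rightarrow> ('r, 'm) module \<Rightarrow> 'g monoid" where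
  "inj_stab R F M = (fobj F M)\<lparr>carrier := kernel (fobj F M) (R0 R F M) (rho R F M)\<rparr>"

(* inj_stab R F is a subfunctor of F, so it acts on morphisms by restriction of fmap F. *)


(* The cosyzygy of degree j + 1 is the image of dif J j, as a submodule of trm J (j + 1). *)
definition cosyzygy :: "('r, 'm) module \<Rightarrow> ('r, 'm) resolution \<Rightarrow> nat \<Rightarrow> ('r, 'm) module" where
  "cosyzygy M J j = (case j of
       0 \<Rightarrow> M
     | Suc k \<Rightarrow> (trm J (Suc k))\<lparr>carrier := dif J k ` carrier (trm J k)\<rparr>)"

definition cosyzygy_emb :: "('r, 'm) resolution \<Rightarrow> nat \<Rightarrow> 'm \<Rightarrow> 'm" where
  "cosyzygy_emb J j = (case j of 0 \<Rightarrow> aug J | Suc k \<Rightarrow> id)"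

definition cosyzygy_map :: "('m \<Rightarrow> 'm) \<Rightarrow> (nat \<Rightarrow> 'm \<Rightarrow> 'm) \<Rightarrow> nat \<Rightarrow> 'm \<Rightarrow> 'm" where
  "cosyzygy_map f u j = (case j of 0 \<Rightarrow> f | Suc k \<Rightarrow> u (Suc k))"

(* The snake x \<leftarrow> y \<rightarrow> F(I^j) \<leftarrow> z \<rightarrow> w from F(cosyzygy B'' J'' j) to F(cosyzygy B' J' (j + 1)). *)
definition stab_connecting ::
  "('r, 'm, 'g) mod_functor \<Rightarrow> ('r, 'm) module \<Rightarrow> ('r, 'm) module \<Rightarrow> ('m \<Rightarrow> 'm) \<Rightarrow> ('r, 'm) module \<Rightarrow>
   ('r, 'm) resolution \<Rightarrow> (nat \<Rightarrow> 'm \<Rightarrow> 'm) \<Rightarrow> ('r, 'm) resolution \<Rightarrow> (nat \<Rightarrow> 'm \<Rightarrow> 'm) \<Rightarrow> ('r, 'm) resolution \<Rightarrow>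
   nat \<Rightarrow> 'g \<Rightarrow> 'g"
  where "stab_connecting F B' B g B'' J' u J v J'' j =
     (let S' = cosyzygy B' J' (Suc j); S = cosyzygy B J j; S'' = cosyzygy B'' J'' j
      in (\<lambda>x. THE w. \<exists>y \<in> carrier (fobj F S). \<exists>z \<in> carrier (fobj F (trm J' j)).
           fmap F S S'' (cosyzygy_map g v j) y = x \<and>
           fmap F (trm J' j) (trm J j) (u j) z = fmap F S (trm J j) (cosyzygy_emb J j) y \<and>
           w = fmap F (trm J' j) S' (dif J' j) z))"

end

theory Submission
  imports Defs
begin

text \<open>
  The sequence has two halves of different origin, homology of complexes on the left and snakes of
  cosyzygies on the right; they meet at \<open>F(B') \<rightarrow> F(B)\<close>.

  The left half is the long exact homology sequence. For the exact sequence of resolutions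
  \<open>P' \<rightarrow> P \<rightarrow> P''\<close> given by the horseshoe lemma, each row splits because \<open>P''\<close> is projective, so
  \<open>F P' \<rightarrow> F P \<rightarrow> F P''\<close> is again a short exact sequence of complexes, and chasing elements
  gives exactness (\<open>homology_exact_middle\<close>, \<open>homology_exact_right\<close>, \<open>homology_exact_left\<close>). The derived
  functors, however, use one chosen resolution of \<open>B\<close> and arbitrary lifts of the given maps. Any two
  lifts are chain homotopic, and a right exact functor is additive (\<open>F_add\<close>), so it respects the
  homotopies (\<open>homology_map_homotopic\<close>). Hence \<open>P\<close> and the chosen resolution have the same homology
  and exactness carries over (\<open>Lder_exact_middle\<close> and its companions). As \<open>L\<^sub>0F\<close> is \<open>F\<close>, the tail
  of that sequence is exact at \<open>F(B')\<close>, with the image of \<open>L\<^sub>1F(B'')\<close> being the kernel of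
  \<open>F(B') \<rightarrow> F(B)\<close>.

  The right half is a sequence of snakes, one for each \<open>j\<close>. The columns
  \<open>\<Sigma>\<^sup>jM \<rightarrow> I\<^sup>j \<rightarrow> \<Sigma>\<^sup>j\<^sup>+\<^sup>1M \<rightarrow> 0\<close> remain exact under \<open>F\<close>, and the row of the injective modules splits, so
  after applying \<open>F\<close> the snake lemma applies to the map from the row of the \<open>j\<close>-th cosyzygies to the
  row of the injectives. Its kernels are the injective stabilizations and its first cokernel is
  \<open>F(\<Sigma>\<^sup>j\<^sup>+\<^sup>1B')\<close>.

  The passage from \<open>F\<close> to its stabilization, at the joint of the two halves and between consecutive
  snakes, costs nothing: an element of \<open>F(M)\<close> killed by \<open>F\<close> of an embedding of \<open>M\<close> is killed by \<open>F\<close> of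
  every map from \<open>M\<close> into an injective module, because that map extends along the embedding
  (\<open>F_embedding_kernel_mono\<close>). So the kernel of \<open>F(B') \<rightarrow> F(B)\<close> already lies in the
  stabilization of \<open>B'\<close>, and likewise for the cosyzygies.

  All modules have to be found inside one type. Pairs of elements of an infinite type can be coded by
  single elements, and so can finitely supported functions into a ring that embeds into it; this gives
  direct sums and a free module, hence projective resolutions.
\<close>

section \<open>Modules and linear maps\<close>

lemma (in left_module) smult_zero [simp]:
  assumes "a \<in> carrier R" shows "a \<odot> \<zero> = \<zero>"
proof -
  have "a \<odot> \<zero> \<oplus> a \<odot> \<zero> = a \<odot> \<zero>"
    using smult_r_distr[OF assms M.zero_closed M.zero_closed] by simp
  then show ?thesis
    using M.add.l_cancel_one smult_closed[OF assms M.zero_closed] by blast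
qed

lemma (in left_module) zero_smult [simp]:
  assumes "x \<in> carrier M" shows "\<zero>\<^bsub>R\<^esub> \<odot> x = \<zero>"
proof -
  have "\<zero>\<^bsub>R\<^esub> \<odot> x \<oplus> \<zero>\<^bsub>R\<^esub> \<odot> x = \<zero>\<^bsub>R\<^esub> \<odot> x"
    using smult_l_distr[OF R.zero_closed R.zero_closed assms] by simp
  then show ?thesis
    using M.add.l_cancel_one smult_closed[OF R.zero_closed assms] by blast
qed

lemma (in left_module) smult_minus_one:
  assumes "x \<in> carrier M" shows "(\<ominus>\<^bsub>R\<^esub> \<one>\<^bsub>R\<^esub>) \<odot> x = \<ominus> x"
proof -
  have "(\<ominus>\<^bsub>R\<^esub> \<one>\<^bsub>R\<^esub>) \<odot> x \<oplus> x = \<zero>"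
    using smult_l_distr[of "\<ominus>\<^bsub>R\<^esub> \<one>\<^bsub>R\<^esub>" "\<one>\<^bsub>R\<^esub>" x] assms by (simp add: smult_one R.l_neg)
  then show ?thesis
    using M.minus_equality assms smult_closed by simp
qed

lemma (in left_module) smult_minus:
  assumes "a \<in> carrier R" "x \<in> carrier M" shows "a \<odot> (\<ominus> x) = \<ominus> (a \<odot> x)"
proof -
  have "a \<odot> (\<ominus> x) \<oplus> a \<odot> x = \<zero>"
    using smult_r_distr[of a "\<ominus> x" x] assms by (simp add: M.l_neg)
  then show ?thesis
    using M.minus_equality assms smult_closed by simp
qed

text \<open>The additive inverse of \<open>x\<close> is \<open>(- 1) x\<close>, so the law \<open>0 x = 0\<close> takes the place of an axiom
  on inverses.\<close>

lemma left_moduleI: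
  fixes M :: "('r, 'm) module"
  assumes "ring R" "\<zero>\<^bsub>M\<^esub> \<in> carrier M"
    and "\<And>x y. \<lbrakk>x \<in> carrier M; y \<in> carrier M\<rbrakk> \<Longrightarrow> x \<oplus>\<^bsub>M\<^esub> y \<in> carrier M"
    and "\<And>a x. \<lbrakk>a \<in> carrier R; x \<in> carrier M\<rbrakk> \<Longrightarrow> a \<odot>\<^bsub>M\<^esub> x \<in> carrier M"
    and "\<And>x y z. \<lbrakk>x \<in> carrier M; y \<in> carrier M; z \<in> carrier M\<rbrakk>
          \<Longrightarrow> (x \<oplus>\<^bsub>M\<^esub> y) \<oplus>\<^bsub>M\<^esub> z = x \<oplus>\<^bsub>M\<^esub> (y \<oplus>\<^bsub>M\<^esub> z)"
    and "\<And>x y. \<lbrakk>x \<in> carrier M; y \<in> carrier M\<rbrakk> \<Longrightarrow> x \<oplus>\<^bsub>M\<^esub> y = y \<oplus>\<^bsub>M\<^esub> x"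
    and zero: "\<And>x. x \<in> carrier M \<Longrightarrow> \<zero>\<^bsub>M\<^esub> \<oplus>\<^bsub>M\<^esub> x = x"
    and null: "\<And>x. x \<in> carrier M \<Longrightarrow> \<zero>\<^bsub>R\<^esub> \<odot>\<^bsub>M\<^esub> x = \<zero>\<^bsub>M\<^esub>"
    and l_distr: "\<And>a b x. \<lbrakk>a \<in> carrier R; b \<in> carrier R; x \<in> carrier M\<rbrakk>
          \<Longrightarrow> (a \<oplus>\<^bsub>R\<^esub> b) \<odot>\<^bsub>M\<^esub> x = (a \<odot>\<^bsub>M\<^esub> x) \<oplus>\<^bsub>M\<^esub> (b \<odot>\<^bsub>M\<^esub> x)"
    and "\<And>a x y. \<lbrakk>a \<in> carrier R; x \<in> carrier M; y \<in> carrier M\<rbrakk>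
          \<Longrightarrow> a \<odot>\<^bsub>M\<^esub> (x \<oplus>\<^bsub>M\<^esub> y) = (a \<odot>\<^bsub>M\<^esub> x) \<oplus>\<^bsub>M\<^esub> (a \<odot>\<^bsub>M\<^esub> y)"
    and "\<And>a b x. \<lbrakk>a \<in> carrier R; b \<in> carrier R; x \<in> carrier M\<rbrakk>
          \<Longrightarrow> (a \<otimes>\<^bsub>R\<^esub> b) \<odot>\<^bsub>M\<^esub> x = a \<odot>\<^bsub>M\<^esub> (b \<odot>\<^bsub>M\<^esub> x)"
    and one: "\<And>x. x \<in> carrier M \<Longrightarrow> \<one>\<^bsub>R\<^esub> \<odot>\<^bsub>M\<^esub> x = x"
  shows "left_module R M"
proof -
  interpret R: ring R by fact
  have neg: "\<exists>y\<in>carrier M. y \<oplus>\<^bsub>M\<^esub> x = \<zero>\<^bsub>M\<^esub>" if x: "x \<in> carrier M" for x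
  proof
    have "(\<ominus>\<^bsub>R\<^esub> \<one>\<^bsub>R\<^esub>) \<odot>\<^bsub>M\<^esub> x \<oplus>\<^bsub>M\<^esub> \<one>\<^bsub>R\<^esub> \<odot>\<^bsub>M\<^esub> x = \<zero>\<^bsub>M\<^esub>"
      using l_distr[of "\<ominus>\<^bsub>R\<^esub> \<one>\<^bsub>R\<^esub>" "\<one>\<^bsub>R\<^esub>" x] null x by (simp add: R.l_neg)
    then show "(\<ominus>\<^bsub>R\<^esub> \<one>\<^bsub>R\<^esub>) \<odot>\<^bsub>M\<^esub> x \<oplus>\<^bsub>M\<^esub> x = \<zero>\<^bsub>M\<^esub>"
      using one x by simp
    show "(\<ominus>\<^bsub>R\<^esub> \<one>\<^bsub>R\<^esub>) \<odot>\<^bsub>M\<^esub> x \<in> carrier M" using assms(4) x by simp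
  qed
  have "abelian_group M"
    by (rule abelian_groupI) (use assms(2-7) neg in auto)
  then show ?thesis
    unfolding left_module_def left_module_axioms_def using assms by blast
qed

lemma lin_homI:
  assumes "\<And>x. x \<in> carrier M \<Longrightarrow> f x \<in> carrier N"
    and "\<And>x y. \<lbrakk>x \<in> carrier M; y \<in> carrier M\<rbrakk> \<Longrightarrow> f (x \<oplus>\<^bsub>M\<^esub> y) = f x \<oplus>\<^bsub>N\<^esub> f y"
    and "\<And>a x. \<lbrakk>a \<in> carrier R; x \<in> carrier M\<rbrakk> \<Longrightarrow> f (a \<odot>\<^bsub>M\<^esub> x) = a \<odot>\<^bsub>N\<^esub> f x"
  shows "f \<in> lin_hom R M N"
  using assms by (auto simp: lin_hom_def)

lemma lin_hom_closed: "\<lbrakk>f \<in> lin_hom R M N; x \<in> carrier M\<rbrakk> \<Longrightarrow> f x \<in> carrier N"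
  by (auto simp: lin_hom_def)

lemma lin_hom_add:
  "\<lbrakk>f \<in> lin_hom R M N; x \<in> carrier M; y \<in> carrier M\<rbrakk> \<Longrightarrow> f (x \<oplus>\<^bsub>M\<^esub> y) = f x \<oplus>\<^bsub>N\<^esub> f y"
  by (auto simp: lin_hom_def)

lemma lin_hom_smult:
  "\<lbrakk>f \<in> lin_hom R M N; a \<in> carrier R; x \<in> carrier M\<rbrakk> \<Longrightarrow> f (a \<odot>\<^bsub>M\<^esub> x) = a \<odot>\<^bsub>N\<^esub> f x"
  by (auto simp: lin_hom_def)

lemma lin_hom_zero:
  assumes "left_module R M" "left_module R N" "f \<in> lin_hom R M N"
  shows "f \<zero>\<^bsub>M\<^esub> = \<zero>\<^bsub>N\<^esub>"
proof -
  interpret M: left_module R M by fact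
  interpret N: left_module R N by fact
  have "f (\<zero>\<^bsub>R\<^esub> \<odot>\<^bsub>M\<^esub> \<zero>\<^bsub>M\<^esub>) = \<zero>\<^bsub>R\<^esub> \<odot>\<^bsub>N\<^esub> f \<zero>\<^bsub>M\<^esub>"
    by (intro lin_hom_smult[OF assms(3)]) auto
  then show ?thesis using lin_hom_closed[OF assms(3)] by simp
qed

lemma lin_hom_minus:
  assumes "left_module R M" "left_module R N" "f \<in> lin_hom R M N" "x \<in> carrier M"
  shows "f (\<ominus>\<^bsub>M\<^esub> x) = \<ominus>\<^bsub>N\<^esub> f x"
proof -
  interpret M: left_module R M by fact
  interpret N: left_module R N by fact
  show ?thesis
    using lin_hom_smult[OF assms(3), of "\<ominus>\<^bsub>R\<^esub> \<one>\<^bsub>R\<^esub>" x] assms(4) lin_hom_closed[OF assms(3,4)]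
    by (simp add: M.smult_minus_one N.smult_minus_one)
qed

lemma lin_hom_diff:
  assumes "left_module R M" "left_module R N" "f \<in> lin_hom R M N" "x \<in> carrier M" "y \<in> carrier M"
  shows "f (x \<ominus>\<^bsub>M\<^esub> y) = f x \<ominus>\<^bsub>N\<^esub> f y"
proof -
  interpret M: left_module R M by fact
  interpret N: left_module R N by fact
  show ?thesis
    using assms by (simp add: a_minus_def lin_hom_add lin_hom_minus)
qed

lemma lin_hom_id: "id \<in> lin_hom R M M"
  by (auto simp: lin_hom_def)

lemma lin_hom_comp:
  "\<lbrakk>f \<in> lin_hom R L M; g \<in> lin_hom R M N\<rbrakk> \<Longrightarrow> (\<lambda>x. g (f x)) \<in> lin_hom R L N"
  by (intro lin_homI) (auto simp: lin_hom_closed lin_hom_add lin_hom_smult)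

lemma lin_hom_comp': "\<lbrakk>f \<in> lin_hom R L M; g \<in> lin_hom R M N\<rbrakk> \<Longrightarrow> g \<circ> f \<in> lin_hom R L N"
  using lin_hom_comp unfolding comp_def .

lemma lin_hom_plus:
  assumes "left_module R M" "left_module R N" "f \<in> lin_hom R M N" "g \<in> lin_hom R M N"
  shows "(\<lambda>x. f x \<oplus>\<^bsub>N\<^esub> g x) \<in> lin_hom R M N"
proof -
  interpret M: left_module R M by fact
  interpret N: left_module R N by fact
  show ?thesis
    using assms(3,4)
    by (intro lin_homI)
      (auto simp: lin_hom_closed lin_hom_add lin_hom_smult N.smult_r_distr N.M.a_ac)
qed

lemma lin_hom_uminus:
  assumes "left_module R M" "left_module R N" "f \<in> lin_hom R M N"
  shows "(\<lambda>x. \<ominus>\<^bsub>N\<^esub> f x) \<in> lin_hom R M N"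
proof -
  interpret M: left_module R M by fact
  interpret N: left_module R N by fact
  show ?thesis
    using assms(3)
    by (intro lin_homI)
      (auto simp: lin_hom_closed lin_hom_add lin_hom_smult N.minus_add N.smult_minus)
qed

lemma lin_hom_minus_fun:
  assumes "left_module R M" "left_module R N" "f \<in> lin_hom R M N" "g \<in> lin_hom R M N"
  shows "(\<lambda>x. f x \<ominus>\<^bsub>N\<^esub> g x) \<in> lin_hom R M N"
  unfolding a_minus_def
  by (rule lin_hom_plus[OF assms(1-3) lin_hom_uminus[OF assms(1,2,4)]])

lemma lin_hom_const_zero:
  assumes "left_module R M" "left_module R N"
  shows "(\<lambda>x. \<zero>\<^bsub>N\<^esub>) \<in> lin_hom R M N"
proof -
  interpret N: left_module R N by fact
  show ?thesis by (intro lin_homI) auto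
qed

lemma submodule_left_module:
  assumes "left_module R N" "S \<subseteq> carrier N" "\<zero>\<^bsub>N\<^esub> \<in> S"
    and "\<And>x y. \<lbrakk>x \<in> S; y \<in> S\<rbrakk> \<Longrightarrow> x \<oplus>\<^bsub>N\<^esub> y \<in> S"
    and "\<And>a x. \<lbrakk>a \<in> carrier R; x \<in> S\<rbrakk> \<Longrightarrow> a \<odot>\<^bsub>N\<^esub> x \<in> S"
  shows "left_module R (N\<lparr>carrier := S\<rparr>)"
proof -
  interpret N: left_module R N by fact
  show ?thesis
    by (rule left_moduleI)
      (use assms N.R.ring_axioms in
        \<open>auto simp: subset_iff N.M.a_ac N.smult_l_distr N.smult_r_distr N.smult_assoc N.smult_one\<close>)
qed

lemma image_left_module:
  assumes "left_module R M" "left_module R N" "f \<in> lin_hom R M N"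
  shows "left_module R (N\<lparr>carrier := f ` carrier M\<rparr>)"
proof -
  interpret M: left_module R M by fact
  interpret N: left_module R N by fact
  show ?thesis
  proof (rule submodule_left_module)
    show "\<zero>\<^bsub>N\<^esub> \<in> f ` carrier M"
      using lin_hom_zero[OF assms] M.M.zero_closed by (metis imageI)
    show "x \<oplus>\<^bsub>N\<^esub> y \<in> f ` carrier M" if "x \<in> f ` carrier M" "y \<in> f ` carrier M" for x y
      using that lin_hom_add[OF assms(3)] M.M.a_closed by (smt (verit) image_iff)
    show "a \<odot>\<^bsub>N\<^esub> x \<in> f ` carrier M" if "a \<in> carrier R" "x \<in> f ` carrier M" for a x
      using that lin_hom_smult[OF assms(3)] M.smult_closed by (smt (verit) image_iff)
  qed (use assms(2) lin_hom_closed[OF assms(3)] in auto)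
qed

lemma mem_a_kernel: "x \<in> a_kernel M N h \<longleftrightarrow> x \<in> carrier M \<and> h x = \<zero>\<^bsub>N\<^esub>"
  by (auto simp: a_kernel_def')

lemma kernel_left_module:
  assumes "left_module R M" "left_module R N" "f \<in> lin_hom R M N"
  shows "left_module R (M\<lparr>carrier := a_kernel M N f\<rparr>)"
proof -
  interpret M: left_module R M by fact
  interpret N: left_module R N by fact
  show ?thesis
    by (rule submodule_left_module[OF assms(1)])
      (use lin_hom_zero[OF assms] in
        \<open>auto simp: mem_a_kernel lin_hom_add[OF assms(3)] lin_hom_smult[OF assms(3)] M.smult_closed\<close>)
qed

lemma lin_hom_into_submodule:
  assumes "f \<in> lin_hom R M N" "\<And>x. x \<in> carrier M \<Longrightarrow> f x \<in> S"
  shows "f \<in> lin_hom R M (N\<lparr>carrier := S\<rparr>)"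
  using assms by (auto simp: lin_hom_def)

lemma lin_hom_from_submodule:
  assumes "f \<in> lin_hom R M N" "S \<subseteq> carrier M"
  shows "f \<in> lin_hom R (M\<lparr>carrier := S\<rparr>) N"
  using assms(2)
  by (intro lin_homI)
    (auto simp: subset_iff lin_hom_closed[OF assms(1)] lin_hom_add[OF assms(1)] lin_hom_smult[OF assms(1)])

lemma lin_hom_out_of_submodule:
  assumes "f \<in> lin_hom R M (N\<lparr>carrier := S\<rparr>)" "S \<subseteq> carrier N"
  shows "f \<in> lin_hom R M N"
  using assms by (auto simp: lin_hom_def)

lemma lin_hom_cong_on:
  assumes "left_module R M" "f \<in> lin_hom R M N" "\<And>x. x \<in> carrier M \<Longrightarrow> g x = f x"
  shows "g \<in> lin_hom R M N"
proof -
  interpret M: left_module R M by fact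
  show ?thesis
    using assms(2,3) M.M.a_closed M.smult_closed by (auto simp: lin_hom_def)
qed

lemma projective_left_module: "projective_module R P \<Longrightarrow> left_module R P"
  by (simp add: projective_module_def)

lemma injective_left_module: "injective_module R P \<Longrightarrow> left_module R P"
  by (simp add: injective_module_def)

text \<open>Replacing \<open>N\<close> by the image of \<open>p\<close> makes \<open>p\<close> surjective. In this form, projectivity lifts
  through one step of an exact complex, which is how all chain maps and homotopies are built.\<close>

lemma projective_lift_exact:
  assumes P: "projective_module R P" and M: "left_module R M" and N: "left_module R N"
    and p: "p \<in> lin_hom R M N" and h: "h \<in> lin_hom R P N"
    and im: "\<And>x. x \<in> carrier P \<Longrightarrow> h x \<in> p ` carrier M"
  shows "\<exists>k \<in> lin_hom R P M. \<forall>x\<in>carrier P. p (k x) = h x"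
proof -
  let ?I = "N\<lparr>carrier := p ` carrier M\<rparr>"
  have "left_module R ?I" using image_left_module[OF M N p] .
  moreover have "p \<in> lin_hom R M ?I" by (rule lin_hom_into_submodule[OF p]) auto
  moreover have "p ` carrier M = carrier ?I" by simp
  moreover have "h \<in> lin_hom R P ?I" by (rule lin_hom_into_submodule[OF h im])
  ultimately show ?thesis
    using P M unfolding projective_module_def by blast
qed

section \<open>Direct sums and free modules inside an infinite type\<close>

definition pair_code :: "'m \<times> 'm \<Rightarrow> 'm" where
  "pair_code = (SOME e. inj e)"

definition dfst :: "'m \<Rightarrow> 'm" where "dfst w = fst (inv_into UNIV pair_code w)"
definition dsnd :: "'m \<Rightarrow> 'm" where "dsnd w = snd (inv_into UNIV pair_code w)"

lemma inj_pair_code: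
  assumes "infinite (UNIV :: 'm set)"
  shows "inj (pair_code :: 'm \<times> 'm \<Rightarrow> 'm)"
proof -
  have "|UNIV \<times> UNIV :: ('m \<times> 'm) set| \<le>o |UNIV :: 'm set|"
    using card_of_Times_same_infinite[OF assms] ordIso_imp_ordLeq by blast
  then have "\<exists>e :: 'm \<times> 'm \<Rightarrow> 'm. inj e"
    unfolding card_of_ordLeq[symmetric] by auto
  then show ?thesis unfolding pair_code_def by (rule someI_ex)
qed

lemma dfst_pair [simp]: "infinite (UNIV :: 'm set) \<Longrightarrow> dfst (pair_code (x :: 'm, y)) = x"
  by (simp add: dfst_def inj_pair_code)

lemma dsnd_pair [simp]: "infinite (UNIV :: 'm set) \<Longrightarrow> dsnd (pair_code (x :: 'm, y)) = y"
  by (simp add: dsnd_def inj_pair_code)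

text \<open>Pairs are coded by elements of \<open>'m\<close>, so that sums of modules in the universe \<open>'m\<close> stay
  in it.\<close>

definition dsum :: "('r, 'm) module \<Rightarrow> ('r, 'm) module \<Rightarrow> ('r, 'm) module" where
  "dsum M N = \<lparr>carrier = pair_code ` (carrier M \<times> carrier N), monoid.mult = undefined, one = undefined,
     ring.zero = pair_code (\<zero>\<^bsub>M\<^esub>, \<zero>\<^bsub>N\<^esub>),
     ring.add = (\<lambda>x y. pair_code (dfst x \<oplus>\<^bsub>M\<^esub> dfst y, dsnd x \<oplus>\<^bsub>N\<^esub> dsnd y)),
     module.smult = (\<lambda>a x. pair_code (a \<odot>\<^bsub>M\<^esub> dfst x, a \<odot>\<^bsub>N\<^esub> dsnd x))\<rparr>"

text \<open>The \<open>itself\<close> argument names the type of the module elements, which occurs in no other parameter.\<close>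

locale infinite_universe =
  fixes universe :: "'m itself"
  assumes infinite_universe: "infinite (UNIV :: 'm set)"
begin

lemma dsum_sel:
  fixes M N :: "('r, 'm) module"
  shows "x \<in> carrier (dsum M N) \<longleftrightarrow> (\<exists>y\<in>carrier M. \<exists>z\<in>carrier N. x = pair_code (y, z))"
    and "\<zero>\<^bsub>dsum M N\<^esub> = pair_code (\<zero>\<^bsub>M\<^esub>, \<zero>\<^bsub>N\<^esub>)"
    and "pair_code (y, z) \<oplus>\<^bsub>dsum M N\<^esub> pair_code (y', z') = pair_code (y \<oplus>\<^bsub>M\<^esub> y', z \<oplus>\<^bsub>N\<^esub> z')"
    and "a \<odot>\<^bsub>dsum M N\<^esub> pair_code (y, z) = pair_code (a \<odot>\<^bsub>M\<^esub> y, a \<odot>\<^bsub>N\<^esub> z)"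
  using infinite_universe by (auto simp: dsum_def)

lemma pair_code_eq [simp]: "pair_code (x, y) = pair_code (x', y' :: 'm) \<longleftrightarrow> x = x' \<and> y = y'"
  using inj_pair_code[OF infinite_universe] by (auto simp: inj_eq)

lemma dsum_left_module:
  fixes M N :: "('r, 'm) module"
  assumes "left_module R M" "left_module R N"
  shows "left_module R (dsum M N)"
proof -
  interpret M: left_module R M by fact
  interpret N: left_module R N by fact
  show ?thesis
    by (rule left_moduleI)
      (auto simp: dsum_sel M.R.ring_axioms M.M.a_ac N.M.a_ac M.smult_closed N.smult_closed
        M.smult_l_distr N.smult_l_distr M.smult_r_distr N.smult_r_distr
        M.smult_assoc N.smult_assoc M.smult_one N.smult_one)
qed

definition dinl :: "('r, 'm) module \<Rightarrow> 'm \<Rightarrow> 'm" where "dinl N x = pair_code (x, \<zero>\<^bsub>N\<^esub>)"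
definition dinr :: "('r, 'm) module \<Rightarrow> 'm \<Rightarrow> 'm" where "dinr M y = pair_code (\<zero>\<^bsub>M\<^esub>, y)"

lemma dsum_maps:
  fixes M N :: "('r, 'm) module"
  assumes "left_module R M" "left_module R N"
  shows "dfst \<in> lin_hom R (dsum M N) M" "dsnd \<in> lin_hom R (dsum M N) N"
    and "dinl N \<in> lin_hom R M (dsum M N)" "dinr M \<in> lin_hom R N (dsum M N)"
proof -
  interpret M: left_module R M by fact
  interpret N: left_module R N by fact
  show "dfst \<in> lin_hom R (dsum M N) M" "dsnd \<in> lin_hom R (dsum M N) N"
    "dinl N \<in> lin_hom R M (dsum M N)" "dinr M \<in> lin_hom R N (dsum M N)"
    by (auto intro!: lin_homI simp: dsum_sel infinite_universe dinl_def dinr_def)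
qed

lemma dsum_pair:
  fixes M N :: "('r, 'm) module"
  assumes "f \<in> lin_hom R L M" "g \<in> lin_hom R L N"
  shows "(\<lambda>x. pair_code (f x, g x)) \<in> lin_hom R L (dsum M N)"
  using assms by (auto intro!: lin_homI simp: dsum_sel lin_hom_closed lin_hom_add lin_hom_smult)

lemma dsum_copair:
  fixes M N L :: "('r, 'm) module"
  assumes "left_module R M" "left_module R N" "left_module R L"
    "f \<in> lin_hom R M L" "g \<in> lin_hom R N L"
  shows "(\<lambda>w. f (dfst w) \<oplus>\<^bsub>L\<^esub> g (dsnd w)) \<in> lin_hom R (dsum M N) L"
  by (intro lin_hom_plus dsum_left_module assms lin_hom_comp[OF _ assms(4)] lin_hom_comp[OF _ assms(5)]
      dsum_maps)

lemma dsum_projective: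
  fixes P Q :: "('r, 'm) module"
  assumes "projective_module R P" "projective_module R Q"
  shows "projective_module R (dsum P Q)"
  unfolding projective_module_def
proof (intro conjI allI impI)
  note PQ = assms[THEN projective_left_module]
  show "left_module R (dsum P Q)" by (intro dsum_left_module PQ)
  fix M N :: "('r, 'm) module" and p h
  assume MN: "left_module R M" "left_module R N" and p: "p \<in> lin_hom R M N"
    "p ` carrier M = carrier N" and h: "h \<in> lin_hom R (dsum P Q) N"
  interpret P: left_module R P by (rule PQ)
  interpret Q: left_module R Q by (rule PQ)
  obtain k where k: "k \<in> lin_hom R P M" "\<And>x. x \<in> carrier P \<Longrightarrow> p (k x) = h (dinl Q x)"
    using projective_lift_exact[OF assms(1) MN p(1) lin_hom_comp[OF dsum_maps(3)[OF PQ] h]] p(2)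
      lin_hom_closed[OF lin_hom_comp[OF dsum_maps(3)[OF PQ] h]] by auto
  obtain l where l: "l \<in> lin_hom R Q M" "\<And>x. x \<in> carrier Q \<Longrightarrow> p (l x) = h (dinr P x)"
    using projective_lift_exact[OF assms(2) MN p(1) lin_hom_comp[OF dsum_maps(4)[OF PQ] h]] p(2)
      lin_hom_closed[OF lin_hom_comp[OF dsum_maps(4)[OF PQ] h]] by auto
  have "p (k (dfst w) \<oplus>\<^bsub>M\<^esub> l (dsnd w)) = h w" if w: "w \<in> carrier (dsum P Q)" for w
  proof -
    obtain x y where xy: "x \<in> carrier P" "y \<in> carrier Q" "w = pair_code (x, y)"
      using w by (auto simp: dsum_sel)
    have "w = dinl Q x \<oplus>\<^bsub>dsum P Q\<^esub> dinr P y"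
      using xy by (simp add: dinl_def dinr_def dsum_sel)
    then have "h w = h (dinl Q x) \<oplus>\<^bsub>N\<^esub> h (dinr P y)"
      using lin_hom_add[OF h lin_hom_closed[OF dsum_maps(3)[OF PQ] xy(1)]
          lin_hom_closed[OF dsum_maps(4)[OF PQ] xy(2)]] by simp
    also have "\<dots> = p (k x) \<oplus>\<^bsub>N\<^esub> p (l y)" using k(2)[OF xy(1)] l(2)[OF xy(2)] by simp
    also have "\<dots> = p (k x \<oplus>\<^bsub>M\<^esub> l y)"
      by (rule lin_hom_add[OF p(1) lin_hom_closed[OF k(1) xy(1)] lin_hom_closed[OF l(1) xy(2)], symmetric])
    finally show ?thesis unfolding xy(3) by (simp add: infinite_universe)
  qed
  then show "\<exists>k\<in>lin_hom R (dsum P Q) M. \<forall>x\<in>carrier (dsum P Q). p (k x) = h x"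
    by (intro bexI[OF _ dsum_copair[OF PQ MN(1) k(1) l(1)]] ballI)
qed

text \<open>Nested pairs alone do not determine how long the list is, so the length is coded as well.\<close>

lemma ex_inj_list_code: "\<exists>e :: 'm list \<Rightarrow> 'm. inj e"
proof -
  obtain n :: "nat \<Rightarrow> 'm" where n: "inj n"
    using infinite_countable_subset[OF infinite_universe] by auto
  define t :: "'m list \<Rightarrow> 'm" where "t xs = foldr (\<lambda>x y. pair_code (x, y)) xs (n 0)" for xs
  define e :: "'m list \<Rightarrow> 'm" where "e xs = pair_code (n (length xs), t xs)" for xs
  have "xs = ys" if "length xs = length ys" "t xs = t ys" for xs ys
    using that by (induction rule: list_induct2) (auto simp: t_def)
  then have "inj e" using n by (auto intro!: injI simp: e_def inj_eq)
  then show ?thesis by blast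
qed

text \<open>A finite set is recovered from any list enumerating it.\<close>

lemma ex_inj_finite_code: "\<exists>e :: 'm set \<Rightarrow> 'm. inj_on e (Collect finite)"
proof -
  obtain e :: "'m list \<Rightarrow> 'm" where e: "inj e" using ex_inj_list_code by blast
  obtain l :: "'m set \<Rightarrow> 'm list" where l: "\<And>A. finite A \<Longrightarrow> set (l A) = A"
    using finite_list by metis
  have "inj_on (\<lambda>A. e (l A)) (Collect finite)"
    using e l by (auto intro!: inj_onI simp: inj_eq) (metis)+
  then show ?thesis by blast
qed

end

definition finsupp :: "'r ring \<Rightarrow> ('m \<Rightarrow> 'r) set" where
  "finsupp R = {c. (\<forall>x. c x \<in> carrier R) \<and> finite {x. c x \<noteq> \<zero>\<^bsub>R\<^esub>}}"

definition finsupp_code :: "'r ring \<Rightarrow> ('m \<Rightarrow> 'r) \<Rightarrow> 'm" where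
  "finsupp_code R = (SOME e. inj_on e (finsupp R))"

definition finsupp_decode :: "'r ring \<Rightarrow> 'm \<Rightarrow> 'm \<Rightarrow> 'r" where
  "finsupp_decode R = inv_into (finsupp R) (finsupp_code R)"

text \<open>The free module with basis all of \<open>'m\<close>, with a coefficient function represented by its code.
  Taking the whole type as basis lets one module cover every module in the universe.\<close>

definition free_mod :: "'r ring \<Rightarrow> ('r, 'm) module" where
  "free_mod R = \<lparr>carrier = finsupp_code R ` finsupp R, monoid.mult = undefined, one = undefined,
     ring.zero = finsupp_code R (\<lambda>_. \<zero>\<^bsub>R\<^esub>),
     ring.add = (\<lambda>x y. finsupp_code R (\<lambda>i. finsupp_decode R x i \<oplus>\<^bsub>R\<^esub> finsupp_decode R y i)),
     module.smult = (\<lambda>a x. finsupp_code R (\<lambda>i. a \<otimes>\<^bsub>R\<^esub> finsupp_decode R x i))\<rparr>"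

definition lincomb :: "'r ring \<Rightarrow> ('r, 'm) module \<Rightarrow> ('m \<Rightarrow> 'm) \<Rightarrow> ('m \<Rightarrow> 'r) \<Rightarrow> 'm" where
  "lincomb R M m c = finsum M (\<lambda>x. c x \<odot>\<^bsub>M\<^esub> m x) {x. c x \<noteq> \<zero>\<^bsub>R\<^esub>}"

text \<open>The support of a sum or multiple may be smaller than expected, since coefficients can cancel;
  comparing sums over a common finite superset of the supports avoids the case distinctions.\<close>

lemma lincomb_superset:
  assumes "left_module R M" "\<And>x. m x \<in> carrier M" "c \<in> finsupp R" "finite A" "{x. c x \<noteq> \<zero>\<^bsub>R\<^esub>} \<subseteq> A"
  shows "lincomb R M m c = finsum M (\<lambda>x. c x \<odot>\<^bsub>M\<^esub> m x) A"
proof -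
  interpret M: left_module R M by fact
  show ?thesis
    unfolding lincomb_def
    by (rule M.M.add.finprod_mono_neutral_cong_left)
      (use assms in \<open>auto simp: finsupp_def M.smult_closed\<close>)
qed

lemma finsupp_add:
  assumes "ring R" "c \<in> finsupp R" "d \<in> finsupp R"
  shows "(\<lambda>x. c x \<oplus>\<^bsub>R\<^esub> d x) \<in> finsupp R"
proof -
  interpret R: ring R by fact
  have "{x. c x \<oplus>\<^bsub>R\<^esub> d x \<noteq> \<zero>\<^bsub>R\<^esub>} \<subseteq> {x. c x \<noteq> \<zero>\<^bsub>R\<^esub>} \<union> {x. d x \<noteq> \<zero>\<^bsub>R\<^esub>}" by auto
  then show ?thesis
    using assms(2,3) by (auto simp: finsupp_def intro: finite_subset)
qed

lemma finsupp_smult: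
  assumes "ring R" "a \<in> carrier R" "c \<in> finsupp R"
  shows "(\<lambda>x. a \<otimes>\<^bsub>R\<^esub> c x) \<in> finsupp R"
proof -
  interpret R: ring R by fact
  have "{x. a \<otimes>\<^bsub>R\<^esub> c x \<noteq> \<zero>\<^bsub>R\<^esub>} \<subseteq> {x. c x \<noteq> \<zero>\<^bsub>R\<^esub>}" using assms(2) by auto
  then show ?thesis
    using assms(2,3) by (auto simp: finsupp_def intro: finite_subset)
qed

lemma finsupp_single:
  assumes "ring R" "a \<in> carrier R"
  shows "(\<lambda>y. if y = x then a else \<zero>\<^bsub>R\<^esub>) \<in> finsupp R"
proof -
  interpret R: ring R by fact
  show ?thesis using assms(2) by (auto simp: finsupp_def)
qed

lemma lincomb_closed:
  assumes "left_module R M" "\<And>x. m x \<in> carrier M" "c \<in> finsupp R"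
  shows "lincomb R M m c \<in> carrier M"
proof -
  interpret M: left_module R M by fact
  show ?thesis unfolding lincomb_def
    using assms by (intro M.M.finsum_closed) (auto simp: finsupp_def M.smult_closed)
qed

lemma lincomb_add:
  assumes "left_module R M" "\<And>x. m x \<in> carrier M" "c \<in> finsupp R" "d \<in> finsupp R"
  shows "lincomb R M m (\<lambda>x. c x \<oplus>\<^bsub>R\<^esub> d x) = lincomb R M m c \<oplus>\<^bsub>M\<^esub> lincomb R M m d"
proof -
  interpret M: left_module R M by fact
  let ?A = "{x. c x \<noteq> \<zero>\<^bsub>R\<^esub>} \<union> {x. d x \<noteq> \<zero>\<^bsub>R\<^esub>}"
  have fin: "finite ?A" using assms by (auto simp: finsupp_def)
  have carr: "\<And>x. c x \<in> carrier R" "\<And>x. d x \<in> carrier R" using assms by (auto simp: finsupp_def)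
  have "finsum M (\<lambda>x. (c x \<oplus>\<^bsub>R\<^esub> d x) \<odot>\<^bsub>M\<^esub> m x) ?A
      = finsum M (\<lambda>x. c x \<odot>\<^bsub>M\<^esub> m x \<oplus>\<^bsub>M\<^esub> d x \<odot>\<^bsub>M\<^esub> m x) ?A"
    using assms(2) carr by (intro M.M.finsum_cong') (auto simp: M.smult_l_distr M.smult_closed)
  also have "\<dots> = finsum M (\<lambda>x. c x \<odot>\<^bsub>M\<^esub> m x) ?A \<oplus>\<^bsub>M\<^esub> finsum M (\<lambda>x. d x \<odot>\<^bsub>M\<^esub> m x) ?A"
    using assms(2) carr by (intro M.M.finsum_addf) (auto simp: M.smult_closed)
  finally show ?thesis
    using lincomb_superset[OF assms(1,2) assms(3) fin] lincomb_superset[OF assms(1,2) assms(4) fin]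
      lincomb_superset[OF assms(1,2) finsupp_add[OF M.R.ring_axioms assms(3,4)] fin] by fastforce
qed

lemma smult_finsum:
  assumes "left_module R M" "finite A" "a \<in> carrier R" "\<And>x. x \<in> A \<Longrightarrow> t x \<in> carrier M"
  shows "a \<odot>\<^bsub>M\<^esub> finsum M t A = finsum M (\<lambda>x. a \<odot>\<^bsub>M\<^esub> t x) A"
proof -
  interpret M: left_module R M by fact
  show ?thesis
    using assms(2,4)
  proof (induction A)
    case (insert x A)
    then have "t \<in> A \<rightarrow> carrier M" by auto
    then show ?case using insert assms(3)
      by (simp add: M.M.finsum_insert M.smult_closed M.smult_r_distr Pi_iff)
  qed (use assms(3) in simp)
qed

lemma lincomb_smult:
  assumes "left_module R M" "\<And>x. m x \<in> carrier M" "a \<in> carrier R" "c \<in> finsupp R"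
  shows "lincomb R M m (\<lambda>x. a \<otimes>\<^bsub>R\<^esub> c x) = a \<odot>\<^bsub>M\<^esub> lincomb R M m c"
proof -
  interpret M: left_module R M by fact
  let ?A = "{x. c x \<noteq> \<zero>\<^bsub>R\<^esub>}"
  have fin: "finite ?A" using assms by (auto simp: finsupp_def)
  have carr: "\<And>x. c x \<in> carrier R" using assms by (auto simp: finsupp_def)
  have "finsum M (\<lambda>x. (a \<otimes>\<^bsub>R\<^esub> c x) \<odot>\<^bsub>M\<^esub> m x) ?A = finsum M (\<lambda>x. a \<odot>\<^bsub>M\<^esub> (c x \<odot>\<^bsub>M\<^esub> m x)) ?A"
    using assms(2,3) carr by (intro M.M.finsum_cong') (auto simp: M.smult_assoc M.smult_closed)
  also have "\<dots> = a \<odot>\<^bsub>M\<^esub> finsum M (\<lambda>x. c x \<odot>\<^bsub>M\<^esub> m x) ?A"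
    using assms(2,3) carr fin by (subst smult_finsum[OF assms(1)]) (auto simp: M.smult_closed)
  moreover have "{x. a \<otimes>\<^bsub>R\<^esub> c x \<noteq> \<zero>\<^bsub>R\<^esub>} \<subseteq> ?A" using assms(3) by auto
  ultimately show ?thesis
    using lincomb_superset[OF assms(1,2) finsupp_smult[OF M.R.ring_axioms assms(3,4)] fin]
    by (simp add: lincomb_def)
qed

lemma lincomb_single:
  assumes "left_module R M" "\<And>x. m x \<in> carrier M" "a \<in> carrier R"
  shows "lincomb R M m (\<lambda>y. if y = x then a else \<zero>\<^bsub>R\<^esub>) = a \<odot>\<^bsub>M\<^esub> m x"
proof -
  interpret M: left_module R M by fact
  have "lincomb R M m (\<lambda>y. if y = x then a else \<zero>\<^bsub>R\<^esub>)
      = finsum M (\<lambda>y. (if y = x then a else \<zero>\<^bsub>R\<^esub>) \<odot>\<^bsub>M\<^esub> m y) {x}"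
    by (rule lincomb_superset[OF assms(1,2) finsupp_single[OF M.R.ring_axioms assms(3)]]) auto
  also have "\<dots> = a \<odot>\<^bsub>M\<^esub> m x"
    using assms(2,3) by (subst M.M.finsum_insert) (auto simp: M.smult_closed)
  finally show ?thesis .
qed

locale large_universe = infinite_universe universe + R: ring R
  for universe :: "'m itself" and R :: "'r ring" (structure) +
  assumes ring_embeds: "\<exists>e :: 'r \<Rightarrow> 'm. inj_on e (carrier R)"
begin

text \<open>A finitely supported function is recovered from the finite set of pairs of an argument and its
  nonzero value.\<close>

lemma inj_finsupp_code: "inj_on (finsupp_code R :: ('m \<Rightarrow> 'r) \<Rightarrow> 'm) (finsupp R)"
proof -
  obtain s :: "'m set \<Rightarrow> 'm" where s: "inj_on s (Collect finite)" using ex_inj_finite_code by blast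
  obtain e :: "'r \<Rightarrow> 'm" where e: "inj_on e (carrier R)" using ring_embeds by blast
  define G :: "('m \<Rightarrow> 'r) \<Rightarrow> 'm set" where
    "G c = (\<lambda>x. pair_code (x, e (c x))) ` {x. c x \<noteq> \<zero>}" for c
  have mem: "pair_code (x, e a) \<in> G c \<longleftrightarrow> c x = a"
    if "c \<in> finsupp R" "a \<in> carrier R" "a \<noteq> \<zero>" for c x a
  proof -
    have "c x \<in> carrier R" using that by (auto simp: finsupp_def)
    then have "e a = e (c x) \<longleftrightarrow> a = c x" using inj_on_eq_iff[OF e] that by blast
    moreover have "pair_code (x, e a) \<in> G c \<longleftrightarrow> c x \<noteq> \<zero> \<and> e a = e (c x)" by (auto simp: G_def)
    ultimately show ?thesis using that by metis
  qed
  have inj: "c = d" if cd: "c \<in> finsupp R" "d \<in> finsupp R" "G c = G d" for c d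
  proof
    fix x
    have "c x \<in> carrier R" "d x \<in> carrier R" using cd by (auto simp: finsupp_def)
    then show "c x = d x" using mem cd by metis
  qed
  have "finite (G c)" if "c \<in> finsupp R" for c using that by (auto simp: G_def finsupp_def)
  then have "inj_on (\<lambda>c. s (G c)) (finsupp R)"
    using s inj by (auto simp: inj_on_def)
  then show ?thesis
    unfolding finsupp_code_def by (rule someI[where P = "\<lambda>e. inj_on e (finsupp R)"])
qed

lemma decode_code: "c \<in> finsupp R \<Longrightarrow> finsupp_decode R (finsupp_code R c :: 'm) = c"
  by (simp add: finsupp_decode_def inj_finsupp_code)

abbreviation "free \<equiv> (free_mod R :: ('r, 'm) module)"

lemma free_sel:
  "x \<in> carrier free \<longleftrightarrow> (\<exists>c\<in>finsupp R. x = finsupp_code R c)"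
  "\<zero>\<^bsub>free\<^esub> = finsupp_code R (\<lambda>_. \<zero>)"
  "c \<in> finsupp R \<Longrightarrow> d \<in> finsupp R \<Longrightarrow>
     finsupp_code R c \<oplus>\<^bsub>free\<^esub> finsupp_code R d = finsupp_code R (\<lambda>i. c i \<oplus> d i)"
  "c \<in> finsupp R \<Longrightarrow> a \<odot>\<^bsub>free\<^esub> finsupp_code R c = finsupp_code R (\<lambda>i. a \<otimes> c i)"
  by (auto simp: free_mod_def decode_code)

lemma zero_finsupp: "(\<lambda>_. \<zero>) \<in> finsupp R"
  by (auto simp: finsupp_def)

lemma free_left_module: "left_module R free"
proof -
  note [simp] = free_sel finsupp_add[OF R.ring_axioms] finsupp_smult[OF R.ring_axioms] zero_finsupp
  have carr: "c x \<in> carrier R" if "c \<in> finsupp R" for c and x :: 'm using that by (auto simp: finsupp_def)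
  show ?thesis
    by (rule left_moduleI)
      (auto simp: R.ring_axioms carr R.a_ac R.l_distr R.r_distr R.m_assoc)
qed

lemma lincomb_lin_hom:
  fixes M :: "('r, 'm) module"
  assumes "left_module R M" "\<And>x. m x \<in> carrier M"
  shows "(\<lambda>w. lincomb R M m (finsupp_decode R w)) \<in> lin_hom R free M"
  by (rule lin_homI)
    (auto simp: free_sel decode_code lincomb_closed[OF assms] lincomb_add[OF assms] lincomb_smult[OF assms]
      finsupp_add[OF R.ring_axioms] finsupp_smult[OF R.ring_axioms])

definition basis :: "'m \<Rightarrow> 'm" where
  "basis x = finsupp_code R (\<lambda>y. if y = x then \<one> else \<zero>)"

lemma basis_closed: "basis x \<in> carrier free"
  unfolding basis_def free_sel(1) by (rule bexI[OF refl finsupp_single[OF R.ring_axioms R.one_closed]])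

lemma lincomb_basis:
  fixes M :: "('r, 'm) module"
  assumes "left_module R M" "\<And>x. m x \<in> carrier M"
  shows "lincomb R M m (finsupp_decode R (basis x)) = m x"
proof -
  interpret M: left_module R M by fact
  show ?thesis
    using lincomb_single[OF assms R.one_closed]
    by (simp add: basis_def decode_code finsupp_single[OF R.ring_axioms R.one_closed] M.smult_one assms)
qed

text \<open>The basis generates: one point of the support is removed at a time.\<close>

lemma lin_hom_free_eq_lincomb:
  fixes M :: "('r, 'm) module"
  assumes M: "left_module R M" and h: "h \<in> lin_hom R free M" and c: "c \<in> finsupp R"
  shows "h (finsupp_code R c) = lincomb R M (\<lambda>x. h (basis x)) c"
proof -
  interpret M: left_module R M by fact
  have hb: "h (basis x) \<in> carrier M" for x using lin_hom_closed[OF h basis_closed] .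
  note single = finsupp_single[OF R.ring_axioms]
  have "h (finsupp_code R c) = lincomb R M (\<lambda>x. h (basis x)) c"
    if "finite A" "c \<in> finsupp R" "{x. c x \<noteq> \<zero>} \<subseteq> A" for A c
    using that
  proof (induction A arbitrary: c)
    case empty
    then have "c = (\<lambda>_. \<zero>)" by auto
    then show ?case using lin_hom_zero[OF free_left_module M h] by (simp add: free_sel lincomb_def)
  next
    case (insert x A)
    define d where "d = c(x := \<zero>)"
    have cx: "c x \<in> carrier R" and carr: "\<And>x. c x \<in> carrier R" using insert.prems by (auto simp: finsupp_def)
    have "{y. d y \<noteq> \<zero>} \<subseteq> {y. c y \<noteq> \<zero>}" by (auto simp: d_def)
    then have d: "d \<in> finsupp R" using insert.prems by (auto simp: finsupp_def d_def intro: finite_subset)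
    have hd: "h (finsupp_code R d) = lincomb R M (\<lambda>x. h (basis x)) d"
      using insert.prems by (intro insert.IH d) (auto simp: d_def)
    let ?s = "\<lambda>y. if y = x then c x else \<zero>"
    have "(\<lambda>y. c x \<otimes> (if y = x then \<one> else \<zero>)) = ?s" using cx by auto
    then have "finsupp_code R ?s = c x \<odot>\<^bsub>free\<^esub> basis x"
      using single[OF R.one_closed, of x] by (simp add: basis_def free_sel)
    then have hs: "h (finsupp_code R ?s) = lincomb R M (\<lambda>x. h (basis x)) ?s"
      using lincomb_single[OF M hb cx, where x = x] lin_hom_smult[OF h cx basis_closed] by simp
    have c: "(\<lambda>y. d y \<oplus> ?s y) = c" using carr by (auto simp: d_def)
    have "finsupp_code R c = finsupp_code R d \<oplus>\<^bsub>free\<^esub> finsupp_code R ?s"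
      using free_sel(3)[OF d single[OF cx, of x]] c by simp
    moreover have "lincomb R M (\<lambda>x. h (basis x)) c
        = lincomb R M (\<lambda>x. h (basis x)) d \<oplus>\<^bsub>M\<^esub> lincomb R M (\<lambda>x. h (basis x)) ?s"
      using lincomb_add[of R M "\<lambda>x. h (basis x)", OF M hb d single[OF cx, of x]] c by simp
    moreover have "finsupp_code R d \<in> carrier free" "finsupp_code R ?s \<in> carrier free"
      using d single[OF cx, of x] by (auto simp: free_sel(1))
    ultimately show ?case using hd hs lin_hom_add[OF h] by simp
  qed
  then show ?thesis using c by (auto simp: finsupp_def)
qed

lemma free_projective: "projective_module R free"
  unfolding projective_module_def
proof (intro conjI allI impI)
  show "left_module R free" by (rule free_left_module)
  fix M N :: "('r, 'm) module" and p h
  assume M: "left_module R M" and N: "left_module R N" and p: "p \<in> lin_hom R M N"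
    "p ` carrier M = carrier N" and h: "h \<in> lin_hom R free N"
  have "\<exists>y\<in>carrier M. p y = h (basis x)" for x
    using lin_hom_closed[OF h basis_closed] p(2) by (metis imageE)
  then obtain m where m: "\<And>x. m x \<in> carrier M" "\<And>x. p (m x) = h (basis x)" by metis
  define k where "k w = lincomb R M m (finsupp_decode R w)" for w
  have k: "k \<in> lin_hom R free M" unfolding k_def by (rule lincomb_lin_hom[OF M m(1)])
  have "p (k (basis x)) = h (basis x)" for x
    unfolding k_def using lincomb_basis[OF M m(1)] m(2) by simp
  then have "p (k w) = h w" if "w \<in> carrier free" for w
    using that lin_hom_free_eq_lincomb[OF N h] lin_hom_free_eq_lincomb[OF N lin_hom_comp[OF k p(1)]]
    by (auto simp: free_sel)
  then show "\<exists>k\<in>lin_hom R free M. \<forall>x\<in>carrier free. p (k x) = h x"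
    using k by blast
qed

text \<open>Sending the basis element \<open>x\<close> to \<open>x\<close> itself, or to \<open>0\<close> if \<open>x\<close> lies outside \<open>M\<close>, reaches all of
  \<open>M\<close>.\<close>

lemma free_cover:
  fixes M :: "('r, 'm) module"
  assumes M: "left_module R M"
  shows "\<exists>p \<in> lin_hom R free M. p ` carrier free = carrier M"
proof -
  interpret M: left_module R M by fact
  define m where "m x = (if x \<in> carrier M then x else \<zero>\<^bsub>M\<^esub>)" for x
  have m: "m x \<in> carrier M" for x by (simp add: m_def)
  let ?p = "\<lambda>w. lincomb R M m (finsupp_decode R w)"
  have "?p \<in> lin_hom R free M" by (rule lincomb_lin_hom[OF M m])
  moreover have "?p ` carrier free = carrier M"
  proof
    show "?p ` carrier free \<subseteq> carrier M" using calculation lin_hom_closed by auto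
    show "carrier M \<subseteq> ?p ` carrier free"
    proof
      fix x assume "x \<in> carrier M"
      then have "x = ?p (basis x)" using lincomb_basis[where m = m, OF M m, of x] by (simp add: m_def)
      then show "x \<in> ?p ` carrier free" using basis_closed by blast
    qed
  qed
  ultimately show ?thesis by blast
qed

end

section \<open>Projective resolutions\<close>

lemma resolution_facts:
  assumes "projective_resolution R M P"
  shows resolution_module: "left_module R M"
    and resolution_projective: "\<And>i. projective_module R (trm P i)"
    and resolution_trm: "\<And>i. left_module R (trm P i)"
    and resolution_dif: "\<And>i. dif P i \<in> lin_hom R (trm P (Suc i)) (trm P i)"
    and resolution_aug: "aug P \<in> lin_hom R (trm P 0) M"
    and resolution_aug_onto: "aug P ` carrier (trm P 0) = carrier M"
    and resolution_aug_dif: "\<And>x. x \<in> carrier (trm P (Suc 0)) \<Longrightarrow> aug P (dif P 0 x) = \<zero>\<^bsub>M\<^esub>"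
    and resolution_dif_dif: "\<And>i x. x \<in> carrier (trm P (Suc (Suc i)))
          \<Longrightarrow> dif P i (dif P (Suc i) x) = \<zero>\<^bsub>trm P i\<^esub>"
    and resolution_exact_aug: "\<And>x. \<lbrakk>x \<in> carrier (trm P 0); aug P x = \<zero>\<^bsub>M\<^esub>\<rbrakk>
          \<Longrightarrow> x \<in> dif P 0 ` carrier (trm P (Suc 0))"
    and resolution_exact: "\<And>i x. \<lbrakk>x \<in> carrier (trm P (Suc i)); dif P i x = \<zero>\<^bsub>trm P i\<^esub>\<rbrakk>
          \<Longrightarrow> x \<in> dif P (Suc i) ` carrier (trm P (Suc (Suc i)))"
proof -
  note P = assms[unfolded projective_resolution_def One_nat_def]
  show "left_module R M" "\<And>i. projective_module R (trm P i)"
    "\<And>i. dif P i \<in> lin_hom R (trm P (Suc i)) (trm P i)" "aug P \<in> lin_hom R (trm P 0) M"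
    "aug P ` carrier (trm P 0) = carrier M"
    using P by blast+
  then show "\<And>i. left_module R (trm P i)" by (simp add: projective_left_module)
  have 0: "dif P 0 ` carrier (trm P (Suc 0)) = a_kernel (trm P 0) M (aug P)" using P by blast
  have S: "dif P (Suc i) ` carrier (trm P (Suc (Suc i))) = a_kernel (trm P (Suc i)) (trm P i) (dif P i)" for i
    using P by blast
  show "aug P (dif P 0 x) = \<zero>\<^bsub>M\<^esub>" if "x \<in> carrier (trm P (Suc 0))" for x
    using 0 mem_a_kernel[of "dif P 0 x" "trm P 0" M "aug P"] imageI[OF that, of "dif P 0"] by simp
  show "x \<in> dif P 0 ` carrier (trm P (Suc 0))" if "x \<in> carrier (trm P 0)" "aug P x = \<zero>\<^bsub>M\<^esub>" for x
    unfolding 0 mem_a_kernel using that by simp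
  show "dif P i (dif P (Suc i) x) = \<zero>\<^bsub>trm P i\<^esub>" if "x \<in> carrier (trm P (Suc (Suc i)))" for i x
    using S[of i] mem_a_kernel[of "dif P (Suc i) x" "trm P (Suc i)" "trm P i" "dif P i"] imageI[OF that, of "dif P (Suc i)"] by simp
  show "x \<in> dif P (Suc i) ` carrier (trm P (Suc (Suc i)))"
    if "x \<in> carrier (trm P (Suc i))" "dif P i x = \<zero>\<^bsub>trm P i\<^esub>" for i x
    unfolding S mem_a_kernel using that by simp
qed

text \<open>Iterated free covers. The \<open>n\<close>-th syzygy \<open>K n\<close> is kept as a submodule of the free module, so
  that its cover is at once a map between free modules and serves as differential.\<close>

lemma (in large_universe) ex_projective_resolution:
  fixes M :: "('r, 'm) module"
  assumes M: "left_module R M"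
  shows "\<exists>P. projective_resolution R M P"
proof -
  obtain p where p: "\<And>N :: ('r, 'm) module. left_module R N \<Longrightarrow> p N \<in> lin_hom R free N"
    and onto: "\<And>N :: ('r, 'm) module. left_module R N \<Longrightarrow> p N ` carrier free = carrier N"
    using free_cover by metis
  define K where "K n = ((\<lambda>N. free\<lparr>carrier := a_kernel free N (p N)\<rparr>) ^^ n) M" for n
  have K0: "K 0 = M" and KS: "K (Suc n) = free\<lparr>carrier := a_kernel free (K n) (p (K n))\<rparr>" for n
    by (simp_all add: K_def)
  have K: "left_module R (K n)" for n
  proof (induction n)
    case (Suc n)
    show ?case unfolding KS by (rule kernel_left_module[OF free_left_module Suc p[OF Suc]])
  qed (simp add: K0 M)
  define P where "P = \<lparr>trm = \<lambda>_ :: nat. free, dif = \<lambda>i. p (K (Suc i)), aug = p M\<rparr>"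
  have sub: "carrier (K (Suc n)) \<subseteq> carrier free" for n by (auto simp: KS mem_a_kernel)
  have "p (K (Suc i)) \<in> lin_hom R free free" for i
    using lin_hom_out_of_submodule[of "p (K (Suc i))" R free "a_kernel free (K i) (p (K i))" free]
      p[OF K[of "Suc i"]] sub[of i] by (simp add: KS)
  moreover have "p (K (Suc i)) ` carrier free = a_kernel free (K i) (p (K i))" for i
    using onto[OF K[of "Suc i"]] by (simp add: KS)
  moreover have "a_kernel free (K (Suc i)) h = a_kernel free free h" for h i
    by (simp add: KS a_kernel_def')
  ultimately have "projective_resolution R M P"
    unfolding projective_resolution_def using M free_projective p[OF M] onto[OF M]
    by (simp add: P_def K0[symmetric])
  then show ?thesis by blast
qed

text \<open>Degree by degree; a map in degree \<open>n\<close> can be extended to degree \<open>n + 1\<close> as soon as it carries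
  boundaries to boundaries, so this is part of the invariant.\<close>

lemma ex_projective_lift:
  fixes M N :: "('r, 'm) module"
  assumes P: "projective_resolution R M P" and Q: "projective_resolution R N Q"
    and f: "f \<in> lin_hom R M N"
  shows "\<exists>\<phi>. projective_lift R f M P Q \<phi>"
proof -
  note [simp] = resolution_trm[OF P] resolution_trm[OF Q]
  let ?I = "\<lambda>n \<phi>. \<phi> \<in> lin_hom R (trm P n) (trm Q n) \<and>
     (\<forall>x\<in>carrier (trm P (Suc n)). \<phi> (dif P n x) \<in> dif Q n ` carrier (trm Q (Suc n))) \<and>
     (n = 0 \<longrightarrow> (\<forall>x\<in>carrier (trm P 0). aug Q (\<phi> x) = f (aug P x)))"
  let ?S = "\<lambda>n \<phi> \<phi>'. \<forall>x\<in>carrier (trm P (Suc n)). \<phi> (dif P n x) = dif Q n (\<phi>' x)"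
  have "\<exists>\<phi>. \<forall>n. ?I n (\<phi> n) \<and> ?S n (\<phi> n) (\<phi> (Suc n))"
  proof (rule dependent_nat_choice)
    have h: "(\<lambda>x. f (aug P x)) \<in> lin_hom R (trm P 0) N"
      by (rule lin_hom_comp[OF resolution_aug[OF P] f])
    obtain \<phi> where \<phi>: "\<phi> \<in> lin_hom R (trm P 0) (trm Q 0)"
      "\<And>x. x \<in> carrier (trm P 0) \<Longrightarrow> aug Q (\<phi> x) = f (aug P x)"
      using projective_lift_exact[OF resolution_projective[OF P] resolution_trm[OF Q]
          resolution_module[OF Q] resolution_aug[OF Q] h]
        lin_hom_closed[OF h] resolution_aug_onto[OF Q] by auto
    have "\<phi> (dif P 0 x) \<in> dif Q 0 ` carrier (trm Q (Suc 0))" if x: "x \<in> carrier (trm P (Suc 0))" for x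
    proof (rule resolution_exact_aug[OF Q])
      have d: "dif P 0 x \<in> carrier (trm P 0)" using lin_hom_closed[OF resolution_dif[OF P] x] .
      show "\<phi> (dif P 0 x) \<in> carrier (trm Q 0)" using lin_hom_closed[OF \<phi>(1) d] .
      show "aug Q (\<phi> (dif P 0 x)) = \<zero>\<^bsub>N\<^esub>"
        using \<phi>(2)[OF d] resolution_aug_dif[OF P x]
          lin_hom_zero[OF resolution_module[OF P] resolution_module[OF Q] f] by simp
    qed
    then show "\<exists>\<phi>. ?I 0 \<phi>" using \<phi> by blast
  next
    fix \<phi> n assume I: "?I n \<phi>"
    have h: "(\<lambda>x. \<phi> (dif P n x)) \<in> lin_hom R (trm P (Suc n)) (trm Q n)"
      by (rule lin_hom_comp[OF resolution_dif[OF P]]) (use I in blast)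
    obtain \<phi>' where \<phi>': "\<phi>' \<in> lin_hom R (trm P (Suc n)) (trm Q (Suc n))"
      "\<And>x. x \<in> carrier (trm P (Suc n)) \<Longrightarrow> dif Q n (\<phi>' x) = \<phi> (dif P n x)"
      using projective_lift_exact[OF resolution_projective[OF P] resolution_trm[OF Q]
          resolution_trm[OF Q] resolution_dif[OF Q] h] I by auto
    have "\<phi>' (dif P (Suc n) x) \<in> dif Q (Suc n) ` carrier (trm Q (Suc (Suc n)))"
      if x: "x \<in> carrier (trm P (Suc (Suc n)))" for x
    proof (rule resolution_exact[OF Q])
      have d: "dif P (Suc n) x \<in> carrier (trm P (Suc n))" using lin_hom_closed[OF resolution_dif[OF P] x] .
      show "\<phi>' (dif P (Suc n) x) \<in> carrier (trm Q (Suc n))" using lin_hom_closed[OF \<phi>'(1) d] .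
      show "dif Q n (\<phi>' (dif P (Suc n) x)) = \<zero>\<^bsub>trm Q n\<^esub>"
        using \<phi>'(2)[OF d] resolution_dif_dif[OF P x] I lin_hom_zero[of R "trm P n" "trm Q n" \<phi>] by simp
    qed
    then show "\<exists>\<phi>'. ?I (Suc n) \<phi>' \<and> ?S n \<phi> \<phi>'" using \<phi>' by (intro exI[of _ \<phi>']) auto
  qed
  then obtain \<phi> where "\<And>n. ?I n (\<phi> n)" "\<And>n. ?S n (\<phi> n) (\<phi> (Suc n))" by blast
  then have "projective_lift R f M P Q \<phi>" unfolding projective_lift_def by blast
  then show ?thesis by blast
qed

lemma (in left_module) add_diff_cancel [simp]:
  assumes "x \<in> carrier M" "y \<in> carrier M" shows "y \<oplus> (x \<ominus> y) = x"
  using assms by (simp add: M.minus_eq M.a_lcomm M.r_neg)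

lemma (in left_module) diff_eq_zero:
  assumes "x \<in> carrier M" "y \<in> carrier M" shows "x \<ominus> y = \<zero> \<longleftrightarrow> x = y"
  using assms add_diff_cancel[OF assms] by (auto simp: M.minus_eq M.r_neg)

text \<open>In each degree the homotopy lifts \<open>\<phi> - \<psi> - s d\<close>, which is a cycle because \<open>s\<close> is a homotopy one
  degree below. The equations are written without differences, ready for an additive functor.\<close>

lemma projective_lifts_homotopic:
  fixes M N :: "('r, 'm) module"
  assumes P: "projective_resolution R M P" and Q: "projective_resolution R N Q"
    and \<phi>: "projective_lift R f M P Q \<phi>" and \<psi>: "projective_lift R f M P Q \<psi>"
  shows "\<exists>s. (\<forall>i. s i \<in> lin_hom R (trm P i) (trm Q (Suc i))) \<and>
     (\<forall>x\<in>carrier (trm P 0). \<phi> 0 x = \<psi> 0 x \<oplus>\<^bsub>trm Q 0\<^esub> dif Q 0 (s 0 x)) \<and>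
     (\<forall>i. \<forall>x\<in>carrier (trm P (Suc i)). \<phi> (Suc i) x = \<psi> (Suc i) x \<oplus>\<^bsub>trm Q (Suc i)\<^esub>
         (dif Q (Suc i) (s (Suc i) x) \<oplus>\<^bsub>trm Q (Suc i)\<^esub> s i (dif P i x)))"
proof -
  have \<phi>h: "\<phi> i \<in> lin_hom R (trm P i) (trm Q i)" and \<psi>h: "\<psi> i \<in> lin_hom R (trm P i) (trm Q i)" for i
    using \<phi> \<psi> by (auto simp: projective_lift_def)
  note cl = lin_hom_closed[OF resolution_dif[OF P]] lin_hom_closed[OF \<phi>h] lin_hom_closed[OF \<psi>h]
    lin_hom_closed[OF resolution_dif[OF Q]]
  let ?I = "\<lambda>n s. s \<in> lin_hom R (trm P n) (trm Q (Suc n)) \<and>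
     (\<forall>x\<in>carrier (trm P (Suc n)). dif Q n (s (dif P n x)) =
        \<phi> n (dif P n x) \<ominus>\<^bsub>trm Q n\<^esub> \<psi> n (dif P n x)) \<and>
     (n = 0 \<longrightarrow> (\<forall>x\<in>carrier (trm P 0). dif Q 0 (s x) = \<phi> 0 x \<ominus>\<^bsub>trm Q 0\<^esub> \<psi> 0 x))"
  let ?S = "\<lambda>n s s'. \<forall>x\<in>carrier (trm P (Suc n)). dif Q (Suc n) (s' x) =
      (\<phi> (Suc n) x \<ominus>\<^bsub>trm Q (Suc n)\<^esub> \<psi> (Suc n) x) \<ominus>\<^bsub>trm Q (Suc n)\<^esub> s (dif P n x)"
  have "\<exists>s. \<forall>n. ?I n (s n) \<and> ?S n (s n) (s (Suc n))"
  proof (rule dependent_nat_choice)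
    interpret N: left_module R N by (rule resolution_module[OF Q])
    interpret Q0: left_module R "trm Q 0" by (rule resolution_trm[OF Q])
    have h: "(\<lambda>x. \<phi> 0 x \<ominus>\<^bsub>trm Q 0\<^esub> \<psi> 0 x) \<in> lin_hom R (trm P 0) (trm Q 0)"
      by (rule lin_hom_minus_fun[OF resolution_trm[OF P] resolution_trm[OF Q] \<phi>h \<psi>h])
    have "\<phi> 0 x \<ominus>\<^bsub>trm Q 0\<^esub> \<psi> 0 x \<in> dif Q 0 ` carrier (trm Q (Suc 0))" if x: "x \<in> carrier (trm P 0)" for x
    proof (rule resolution_exact_aug[OF Q])
      show "\<phi> 0 x \<ominus>\<^bsub>trm Q 0\<^esub> \<psi> 0 x \<in> carrier (trm Q 0)" using cl x by simp
      have "aug Q (\<phi> 0 x) = aug Q (\<psi> 0 x)" using \<phi> \<psi> x by (auto simp: projective_lift_def)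
      then show "aug Q (\<phi> 0 x \<ominus>\<^bsub>trm Q 0\<^esub> \<psi> 0 x) = \<zero>\<^bsub>N\<^esub>"
        using lin_hom_diff[OF resolution_trm[OF Q] resolution_module[OF Q] resolution_aug[OF Q]] cl x
          lin_hom_closed[OF resolution_aug[OF Q]]
        by (simp add: N.diff_eq_zero)
    qed
    then obtain s where "s \<in> lin_hom R (trm P 0) (trm Q (Suc 0))"
      "\<And>x. x \<in> carrier (trm P 0) \<Longrightarrow> dif Q 0 (s x) = \<phi> 0 x \<ominus>\<^bsub>trm Q 0\<^esub> \<psi> 0 x"
      using projective_lift_exact[OF resolution_projective[OF P] resolution_trm[OF Q]
          resolution_trm[OF Q] resolution_dif[OF Q] h] by blast
    then show "\<exists>s. ?I 0 s" using cl by blast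
  next
    fix s n assume I: "?I n s"
    interpret Qn: left_module R "trm Q n" by (rule resolution_trm[OF Q])
    interpret QS: left_module R "trm Q (Suc n)" by (rule resolution_trm[OF Q])
    have s: "s \<in> lin_hom R (trm P n) (trm Q (Suc n))" using I by blast
    note cl = cl lin_hom_closed[OF s]
    let ?h = "\<lambda>x. (\<phi> (Suc n) x \<ominus>\<^bsub>trm Q (Suc n)\<^esub> \<psi> (Suc n) x) \<ominus>\<^bsub>trm Q (Suc n)\<^esub> s (dif P n x)"
    have h: "?h \<in> lin_hom R (trm P (Suc n)) (trm Q (Suc n))"
      by (intro lin_hom_minus_fun resolution_trm[OF P] resolution_trm[OF Q] \<phi>h \<psi>h
          lin_hom_comp[OF resolution_dif[OF P] s])
    have "?h x \<in> dif Q (Suc n) ` carrier (trm Q (Suc (Suc n)))" if x: "x \<in> carrier (trm P (Suc n))" for x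
    proof (rule resolution_exact[OF Q])
      show "?h x \<in> carrier (trm Q (Suc n))" using cl x by simp
      have "dif Q n (\<phi> (Suc n) x) = \<phi> n (dif P n x)" "dif Q n (\<psi> (Suc n) x) = \<psi> n (dif P n x)"
        using \<phi> \<psi> x by (auto simp: projective_lift_def)
      then show "dif Q n (?h x) = \<zero>\<^bsub>trm Q n\<^esub>"
        using lin_hom_diff[OF resolution_trm[OF Q] resolution_trm[OF Q] resolution_dif[OF Q]] cl x I
        by (simp add: Qn.diff_eq_zero)
    qed
    then obtain s' where s': "s' \<in> lin_hom R (trm P (Suc n)) (trm Q (Suc (Suc n)))"
      "\<And>x. x \<in> carrier (trm P (Suc n)) \<Longrightarrow> dif Q (Suc n) (s' x) = ?h x"
      using projective_lift_exact[OF resolution_projective[OF P] resolution_trm[OF Q]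
          resolution_trm[OF Q] resolution_dif[OF Q] h] by blast
    have "dif Q (Suc n) (s' (dif P (Suc n) x)) =
        \<phi> (Suc n) (dif P (Suc n) x) \<ominus>\<^bsub>trm Q (Suc n)\<^esub> \<psi> (Suc n) (dif P (Suc n) x)"
      if x: "x \<in> carrier (trm P (Suc (Suc n)))" for x
      using s'(2)[of "dif P (Suc n) x"] cl x resolution_dif_dif[OF P x]
        lin_hom_zero[OF resolution_trm[OF P] resolution_trm[OF Q] s]
      by (simp add: QS.M.minus_eq)
    then show "\<exists>s'. ?I (Suc n) s' \<and> ?S n s s'" using s' by (intro exI[of _ s']) auto
  qed
  then obtain s where s: "\<forall>n. ?I n (s n) \<and> ?S n (s n) (s (Suc n))" by (rule exE)
  have sh: "s i \<in> lin_hom R (trm P i) (trm Q (Suc i))" for i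
    by (rule s[THEN spec, THEN conjunct1, THEN conjunct1])
  have s0: "\<forall>x\<in>carrier (trm P 0). dif Q 0 (s 0 x) = \<phi> 0 x \<ominus>\<^bsub>trm Q 0\<^esub> \<psi> 0 x"
    by (rule s[THEN spec, THEN conjunct1, THEN conjunct2, THEN conjunct2, THEN mp, OF refl])
  have sS: "?S i (s i) (s (Suc i))" for i by (rule s[THEN spec, THEN conjunct2])
  show ?thesis
  proof (intro exI[of _ s] conjI allI ballI)
    show "s i \<in> lin_hom R (trm P i) (trm Q (Suc i))" for i by (rule sh)
    show "\<phi> 0 x = \<psi> 0 x \<oplus>\<^bsub>trm Q 0\<^esub> dif Q 0 (s 0 x)" if x: "x \<in> carrier (trm P 0)" for x
    proof -
      interpret Q0: left_module R "trm Q 0" by (rule resolution_trm[OF Q])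
      show ?thesis using s0 x cl by simp
    qed
    show "\<phi> (Suc i) x = \<psi> (Suc i) x \<oplus>\<^bsub>trm Q (Suc i)\<^esub>
         (dif Q (Suc i) (s (Suc i) x) \<oplus>\<^bsub>trm Q (Suc i)\<^esub> s i (dif P i x))"
      if x: "x \<in> carrier (trm P (Suc i))" for i x
    proof -
      interpret QS: left_module R "trm Q (Suc i)" by (rule resolution_trm[OF Q])
      have "s i (dif P i x) \<in> carrier (trm Q (Suc i))" using lin_hom_closed[OF sh] cl x by blast
      then show ?thesis using sS[of i] x cl by (simp add: QS.M.a_comm[of _ "s i (dif P i x)"])
    qed
  qed
qed

section \<open>The horseshoe lemma\<close>

text \<open>The differential of a horseshoe resolution is the triangular matrix with diagonal \<open>a\<close>, \<open>c\<close> and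
  corner \<open>t\<close>. The twist equation says that consecutive matrices multiply to zero; exactness is then
  inherited from the diagonal, as a cycle can be corrected first in its \<open>C\<close>-component and then in its
  \<open>A\<close>-component.\<close>

lemma (in infinite_universe) twisted_sum_exact:
  fixes A2 A1 A0 C2 C1 C0 :: "('r, 'm) module"
  assumes lm: "left_module R A2" "left_module R A1" "left_module R A0"
      "left_module R C2" "left_module R C1" "left_module R C0"
    and a: "a2 \<in> lin_hom R A2 A1" "a1 \<in> lin_hom R A1 A0"
    and c: "c2 \<in> lin_hom R C2 C1" "c1 \<in> lin_hom R C1 C0"
    and t: "t2 \<in> lin_hom R C2 A1" "t1 \<in> lin_hom R C1 A0"
    and twist: "\<And>y. y \<in> carrier C2 \<Longrightarrow> a1 (t2 y) = \<ominus>\<^bsub>A0\<^esub> t1 (c2 y)"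
    and exA: "a2 ` carrier A2 = a_kernel A1 A0 a1"
    and exC: "c2 ` carrier C2 = a_kernel C1 C0 c1"
  shows "(\<lambda>w. pair_code (a2 (dfst w) \<oplus>\<^bsub>A1\<^esub> t2 (dsnd w), c2 (dsnd w))) ` carrier (dsum A2 C2)
       = {w \<in> carrier (dsum A1 C1). a1 (dfst w) \<oplus>\<^bsub>A0\<^esub> t1 (dsnd w) = \<zero>\<^bsub>A0\<^esub> \<and> c1 (dsnd w) = \<zero>\<^bsub>C0\<^esub>}"
    (is "?D ` _ = ?K")
proof -
  interpret A1: left_module R A1 by fact
  interpret A0: left_module R A0 by fact
  note cl = lin_hom_closed[OF a(1)] lin_hom_closed[OF a(2)] lin_hom_closed[OF c(1)]
    lin_hom_closed[OF c(2)] lin_hom_closed[OF t(1)] lin_hom_closed[OF t(2)]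
  show ?thesis
  proof (intro equalityI subsetI)
    fix w assume "w \<in> ?D ` carrier (dsum A2 C2)"
    then obtain x y where xy: "x \<in> carrier A2" "y \<in> carrier C2"
      and w: "w = pair_code (a2 x \<oplus>\<^bsub>A1\<^esub> t2 y, c2 y)"
      by (auto simp: dsum_sel infinite_universe)
    have "a1 (a2 x) = \<zero>\<^bsub>A0\<^esub>" "c1 (c2 y) = \<zero>\<^bsub>C0\<^esub>"
      using exA exC mem_a_kernel[of "a2 x" A1 A0 a1] mem_a_kernel[of "c2 y" C1 C0 c1]
        imageI[OF xy(1), of a2] imageI[OF xy(2), of c2] by simp_all
    then show "w \<in> ?K"
      using xy cl twist[OF xy(2)]
      by (simp add: w dsum_sel infinite_universe lin_hom_add[OF a(2)] A0.M.l_neg)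
  next
    fix w assume "w \<in> ?K"
    then obtain x y where xy: "x \<in> carrier A1" "y \<in> carrier C1" and w: "w = pair_code (x, y)"
      and 1: "a1 x \<oplus>\<^bsub>A0\<^esub> t1 y = \<zero>\<^bsub>A0\<^esub>" and "c1 y = \<zero>\<^bsub>C0\<^esub>"
      by (auto simp: dsum_sel infinite_universe)
    then have "y \<in> c2 ` carrier C2" unfolding exC mem_a_kernel by simp
    then obtain y' where y': "y' \<in> carrier C2" "y = c2 y'" by blast
    have "a1 (x \<ominus>\<^bsub>A1\<^esub> t2 y') = \<zero>\<^bsub>A0\<^esub>"
      using 1 xy y' cl twist[OF y'(1)]
      by (simp add: lin_hom_diff[OF lm(2,3) a(2)] A0.M.minus_eq)
    then have "x \<ominus>\<^bsub>A1\<^esub> t2 y' \<in> a2 ` carrier A2"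
      unfolding exA mem_a_kernel using xy y' cl by simp
    then obtain x' where x': "x' \<in> carrier A2" "a2 x' = x \<ominus>\<^bsub>A1\<^esub> t2 y'" by (metis imageE)
    have "w = ?D (pair_code (x', y'))"
      using x' y' xy cl by (simp add: w infinite_universe A1.M.a_comm[of "x \<ominus>\<^bsub>A1\<^esub> t2 y'"])
    then show "w \<in> ?D ` carrier (dsum A2 C2)"
      using x' y' by (auto simp: dsum_sel)
  qed
qed

lemma short_exactD:
  assumes "short_exact R A f B g C"
  shows "left_module R A" "left_module R B" "left_module R C" "f \<in> lin_hom R A B" "g \<in> lin_hom R B C"
    "inj_on f (carrier A)" "g ` carrier B = carrier C"
    "\<And>x. x \<in> carrier A \<Longrightarrow> g (f x) = \<zero>\<^bsub>C\<^esub>"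
    "\<And>y. \<lbrakk>y \<in> carrier B; g y = \<zero>\<^bsub>C\<^esub>\<rbrakk> \<Longrightarrow> y \<in> f ` carrier A"
    "f ` carrier A = a_kernel B C g"
proof -
  note s = assms[unfolded short_exact_def]
  show "left_module R A" "left_module R B" "left_module R C" "f \<in> lin_hom R A B" "g \<in> lin_hom R B C"
    "inj_on f (carrier A)" "g ` carrier B = carrier C" and k: "f ` carrier A = a_kernel B C g"
    using s by simp_all
  show "g (f x) = \<zero>\<^bsub>C\<^esub>" if "x \<in> carrier A" for x
    using k imageI[OF that, of f] mem_a_kernel[of "f x" B C g] by simp
  show "y \<in> f ` carrier A" if "y \<in> carrier B" "g y = \<zero>\<^bsub>C\<^esub>" for y
    unfolding k mem_a_kernel using that by simp
qed

lemma inj_zero: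
  assumes "left_module R A" "left_module R B" "f \<in> lin_hom R A B" "inj_on f (carrier A)"
    "x \<in> carrier A" "f x = \<zero>\<^bsub>B\<^esub>"
  shows "x = \<zero>\<^bsub>A\<^esub>"
proof -
  interpret A: left_module R A by fact
  show ?thesis
    using assms(4-6) lin_hom_zero[OF assms(1-3)] by (simp add: inj_on_def)
qed

lemma (in infinite_universe) dsum_short_exact:
  fixes M N :: "('r, 'm) module"
  assumes "left_module R M" "left_module R N"
  shows "short_exact R M (dinl N) (dsum M N) dsnd N"
proof -
  interpret M: left_module R M by fact
  interpret N: left_module R N by fact
  have "dinl N ` carrier M = a_kernel (dsum M N) N dsnd"
    by (auto simp: dinl_def mem_a_kernel dsum_sel infinite_universe)
  moreover have "dsnd ` carrier (dsum M N) = carrier N"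
  proof (intro equalityI subsetI)
    fix y assume "y \<in> carrier N"
    then have "y = dsnd (pair_code (\<zero>\<^bsub>M\<^esub>, y))" "pair_code (\<zero>\<^bsub>M\<^esub>, y) \<in> carrier (dsum M N)"
      by (auto simp: dsum_sel infinite_universe)
    then show "y \<in> dsnd ` carrier (dsum M N)" by blast
  qed (auto simp: dsum_sel infinite_universe)
  moreover have "inj_on (dinl N) (carrier M)" by (auto simp: inj_on_def dinl_def)
  ultimately show ?thesis
    unfolding short_exact_def using assms dsum_left_module[OF assms] dsum_maps[OF assms] by simp
qed

text \<open>In degree \<open>n\<close> take \<open>P' n \<oplus> P'' n\<close>. The augmentation uses a lift \<open>\<tau>\<close> of \<open>P'' 0 \<rightarrow> B''\<close> to \<open>B\<close>, and the
  corners \<open>\<theta>\<close> of the differentials are found by lifting, each correcting the failure of its predecessor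
  (at first \<open>\<tau>\<close>) to be a map of complexes.\<close>

lemma (in infinite_universe) ex_projective_horseshoe:
  fixes B' B B'' :: "('r, 'm) module"
  assumes ses: "short_exact R B' f B g B''"
    and P': "projective_resolution R B' P'" and P'': "projective_resolution R B'' P''"
  shows "\<exists>P u v. projective_horseshoe R B' f B g B'' P' u P v P''"
proof -
  note B = short_exactD[OF ses]
  note t' = resolution_trm[OF P'] and t'' = resolution_trm[OF P'']
  interpret B: left_module R B by (rule B(2))
  have fa: "(\<lambda>x. f (aug P' x)) \<in> lin_hom R (trm P' 0) B"
    by (rule lin_hom_comp[OF resolution_aug[OF P'] B(4)])
  have fa_zero: "aug P' x = \<zero>\<^bsub>B'\<^esub>" if "x \<in> carrier (trm P' 0)" "f (aug P' x) = \<zero>\<^bsub>B\<^esub>" for x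
    using inj_zero[OF B(1,2,4,6) lin_hom_closed[OF resolution_aug[OF P'] that(1)] that(2)] .
  obtain \<tau> where \<tau>: "\<tau> \<in> lin_hom R (trm P'' 0) B" "\<And>y. y \<in> carrier (trm P'' 0) \<Longrightarrow> g (\<tau> y) = aug P'' y"
    using projective_lift_exact[OF resolution_projective[OF P''] B(2,3,5) resolution_aug[OF P'']]
      lin_hom_closed[OF resolution_aug[OF P'']] B(7) by auto
  note cl = lin_hom_closed[OF resolution_dif[OF P']] lin_hom_closed[OF resolution_dif[OF P'']]
    lin_hom_closed[OF \<tau>(1)]
  let ?I = "\<lambda>n \<theta>. \<theta> \<in> lin_hom R (trm P'' (Suc n)) (trm P' n) \<and>
     (\<forall>y\<in>carrier (trm P'' (Suc (Suc n))). \<theta> (dif P'' (Suc n) y) \<in> dif P' n ` carrier (trm P' (Suc n))) \<and>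
     (n = 0 \<longrightarrow> (\<forall>y\<in>carrier (trm P'' (Suc 0)). f (aug P' (\<theta> y)) = \<ominus>\<^bsub>B\<^esub> \<tau> (dif P'' 0 y)))"
  let ?S = "\<lambda>n \<theta> \<theta>'. \<forall>y\<in>carrier (trm P'' (Suc (Suc n))). dif P' n (\<theta>' y) = \<ominus>\<^bsub>trm P' n\<^esub> \<theta> (dif P'' (Suc n) y)"
  have "\<exists>\<theta>. \<forall>n. ?I n (\<theta> n) \<and> ?S n (\<theta> n) (\<theta> (Suc n))"
  proof (rule dependent_nat_choice)
    have h: "(\<lambda>y. \<ominus>\<^bsub>B\<^esub> \<tau> (dif P'' 0 y)) \<in> lin_hom R (trm P'' (Suc 0)) B"
      by (intro lin_hom_uminus t'' B(2) lin_hom_comp[OF resolution_dif[OF P''] \<tau>(1)])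
    have "\<ominus>\<^bsub>B\<^esub> \<tau> (dif P'' 0 y) \<in> (\<lambda>x. f (aug P' x)) ` carrier (trm P' 0)"
      if y: "y \<in> carrier (trm P'' (Suc 0))" for y
    proof -
      have "g (\<ominus>\<^bsub>B\<^esub> \<tau> (dif P'' 0 y)) = \<ominus>\<^bsub>B''\<^esub> \<zero>\<^bsub>B''\<^esub>"
        using lin_hom_minus[OF B(2,3,5)] cl y \<tau>(2) resolution_aug_dif[OF P'' y] by simp
      also have "\<dots> = \<zero>\<^bsub>B''\<^esub>"
      proof -
        interpret B'': left_module R B'' by (rule B(3))
        show ?thesis by simp
      qed
      finally have "\<ominus>\<^bsub>B\<^esub> \<tau> (dif P'' 0 y) \<in> f ` carrier B'"
        using B(9)[of "\<ominus>\<^bsub>B\<^esub> \<tau> (dif P'' 0 y)"] cl y by simp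
      then show ?thesis unfolding resolution_aug_onto[OF P', symmetric] by (simp add: image_image)
    qed
    then obtain \<theta> where \<theta>: "\<theta> \<in> lin_hom R (trm P'' (Suc 0)) (trm P' 0)"
      "\<And>y. y \<in> carrier (trm P'' (Suc 0)) \<Longrightarrow> f (aug P' (\<theta> y)) = \<ominus>\<^bsub>B\<^esub> \<tau> (dif P'' 0 y)"
      using projective_lift_exact[OF resolution_projective[OF P''] t' B(2) fa h] by blast
    have "\<theta> (dif P'' (Suc 0) y) \<in> dif P' 0 ` carrier (trm P' (Suc 0))"
      if y: "y \<in> carrier (trm P'' (Suc (Suc 0)))" for y
    proof (rule resolution_exact_aug[OF P'])
      show 1: "\<theta> (dif P'' (Suc 0) y) \<in> carrier (trm P' 0)" using lin_hom_closed[OF \<theta>(1)] cl y by simp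
      show "aug P' (\<theta> (dif P'' (Suc 0) y)) = \<zero>\<^bsub>B'\<^esub>"
        using \<theta>(2)[of "dif P'' (Suc 0) y"] cl y resolution_dif_dif[OF P'' y] lin_hom_zero[OF t'' B(2) \<tau>(1)]
        by (intro fa_zero[OF 1]) simp
    qed
    then show "\<exists>\<theta>. ?I 0 \<theta>" using \<theta> by (intro exI[of _ \<theta>]) simp
  next
    fix \<theta> n assume I: "?I n \<theta>"
    then have \<theta>: "\<theta> \<in> lin_hom R (trm P'' (Suc n)) (trm P' n)" by blast
    interpret P'n: left_module R "trm P' n" by (rule t')
    interpret P'S: left_module R "trm P' (Suc n)" by (rule t')
    have h: "(\<lambda>y. \<ominus>\<^bsub>trm P' n\<^esub> \<theta> (dif P'' (Suc n) y)) \<in> lin_hom R (trm P'' (Suc (Suc n))) (trm P' n)"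
      by (intro lin_hom_uminus t'' t' lin_hom_comp[OF resolution_dif[OF P''] \<theta>])
    have "\<ominus>\<^bsub>trm P' n\<^esub> \<theta> (dif P'' (Suc n) y) \<in> dif P' n ` carrier (trm P' (Suc n))"
      if y: "y \<in> carrier (trm P'' (Suc (Suc n)))" for y
    proof -
      obtain x where x: "x \<in> carrier (trm P' (Suc n))" "\<theta> (dif P'' (Suc n) y) = dif P' n x"
        using I y by blast
      then have "\<ominus>\<^bsub>trm P' n\<^esub> \<theta> (dif P'' (Suc n) y) = dif P' n (\<ominus>\<^bsub>trm P' (Suc n)\<^esub> x)"
        using lin_hom_minus[OF t' t' resolution_dif[OF P']] by simp
      then show ?thesis using x by simp
    qed
    then obtain \<theta>' where \<theta>': "\<theta>' \<in> lin_hom R (trm P'' (Suc (Suc n))) (trm P' (Suc n))"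
      "\<And>y. y \<in> carrier (trm P'' (Suc (Suc n))) \<Longrightarrow> dif P' n (\<theta>' y) = \<ominus>\<^bsub>trm P' n\<^esub> \<theta> (dif P'' (Suc n) y)"
      using projective_lift_exact[OF resolution_projective[OF P''] t' t' resolution_dif[OF P'] h] by blast
    have "\<theta>' (dif P'' (Suc (Suc n)) y) \<in> dif P' (Suc n) ` carrier (trm P' (Suc (Suc n)))"
      if y: "y \<in> carrier (trm P'' (Suc (Suc (Suc n))))" for y
    proof (rule resolution_exact[OF P'])
      show "\<theta>' (dif P'' (Suc (Suc n)) y) \<in> carrier (trm P' (Suc n))"
        using lin_hom_closed[OF \<theta>'(1)] cl y by simp
      show "dif P' n (\<theta>' (dif P'' (Suc (Suc n)) y)) = \<zero>\<^bsub>trm P' n\<^esub>"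
        using \<theta>'(2)[of "dif P'' (Suc (Suc n)) y"] cl y resolution_dif_dif[OF P'' y] lin_hom_zero[OF t'' t' \<theta>]
        by simp
    qed
    then show "\<exists>\<theta>'. ?I (Suc n) \<theta>' \<and> ?S n \<theta> \<theta>'" using \<theta>' by (intro exI[of _ \<theta>']) simp
  qed
  then obtain \<theta> where th: "\<forall>n. ?I n (\<theta> n) \<and> ?S n (\<theta> n) (\<theta> (Suc n))" by (rule exE)
  have \<theta>: "\<theta> n \<in> lin_hom R (trm P'' (Suc n)) (trm P' n)" for n
    by (rule th[THEN spec, THEN conjunct1, THEN conjunct1])
  have \<theta>0: "\<forall>y\<in>carrier (trm P'' (Suc 0)). f (aug P' (\<theta> 0 y)) = \<ominus>\<^bsub>B\<^esub> \<tau> (dif P'' 0 y)"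
    by (rule th[THEN spec, THEN conjunct1, THEN conjunct2, THEN conjunct2, THEN mp, OF refl])
  have \<theta>S: "?S n (\<theta> n) (\<theta> (Suc n))" for n by (rule th[THEN spec, THEN conjunct2])
  define D where "D n w = pair_code (dif P' n (dfst w) \<oplus>\<^bsub>trm P' n\<^esub> \<theta> n (dsnd w), dif P'' n (dsnd w))" for n w
  define P where "P = \<lparr>trm = \<lambda>n. dsum (trm P' n) (trm P'' n), dif = D,
     aug = \<lambda>w. f (aug P' (dfst w)) \<oplus>\<^bsub>B\<^esub> \<tau> (dsnd w)\<rparr>"
  have lm: "left_module R (dsum (trm P' n) (trm P'' n))" for n by (intro dsum_left_module t' t'')
  have D: "D n \<in> lin_hom R (dsum (trm P' (Suc n)) (trm P'' (Suc n))) (dsum (trm P' n) (trm P'' n))" for n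
    unfolding D_def
    by (intro dsum_pair dsum_copair t' t'' \<theta> resolution_dif[OF P']
        lin_hom_comp[OF dsum_maps(2)[OF t' t''] resolution_dif[OF P'']])
  have aug: "(\<lambda>w. f (aug P' (dfst w)) \<oplus>\<^bsub>B\<^esub> \<tau> (dsnd w)) \<in> lin_hom R (dsum (trm P' 0) (trm P'' 0)) B"
    by (rule dsum_copair[OF t' t'' B(2) fa \<tau>(1)])
  have onto: "(\<lambda>w. f (aug P' (dfst w)) \<oplus>\<^bsub>B\<^esub> \<tau> (dsnd w)) ` carrier (dsum (trm P' 0) (trm P'' 0)) = carrier B"
  proof (intro equalityI subsetI)
    fix b assume b: "b \<in> carrier B"
    then have "g b \<in> aug P'' ` carrier (trm P'' 0)"
      using lin_hom_closed[OF B(5)] resolution_aug_onto[OF P''] by simp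
    then obtain y where y: "y \<in> carrier (trm P'' 0)" "g b = aug P'' y" by blast
    interpret B'': left_module R B'' by (rule B(3))
    have "g (b \<ominus>\<^bsub>B\<^esub> \<tau> y) = \<zero>\<^bsub>B''\<^esub>"
      using lin_hom_diff[OF B(2,3,5) b cl(3)[OF y(1)]] y \<tau>(2) lin_hom_closed[OF B(5) b]
      by (simp add: B''.diff_eq_zero)
    then have "b \<ominus>\<^bsub>B\<^esub> \<tau> y \<in> f ` carrier B'" using B(9) b cl y by simp
    then obtain x where x: "x \<in> carrier (trm P' 0)" "b \<ominus>\<^bsub>B\<^esub> \<tau> y = f (aug P' x)"
      unfolding resolution_aug_onto[OF P', symmetric] by blast
    have "f (aug P' x) \<oplus>\<^bsub>B\<^esub> \<tau> y = b"
      unfolding x(2)[symmetric] using b cl y by (simp add: B.M.a_comm[of "b \<ominus>\<^bsub>B\<^esub> \<tau> y"])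
    then show "b \<in> (\<lambda>w. f (aug P' (dfst w)) \<oplus>\<^bsub>B\<^esub> \<tau> (dsnd w)) ` carrier (dsum (trm P' 0) (trm P'' 0))"
      using x y by (intro image_eqI[of _ _ "pair_code (x, y)"]) (auto simp: dsum_sel infinite_universe)
  next
    fix b assume "b \<in> (\<lambda>w. f (aug P' (dfst w)) \<oplus>\<^bsub>B\<^esub> \<tau> (dsnd w)) ` carrier (dsum (trm P' 0) (trm P'' 0))"
    then show "b \<in> carrier B" using lin_hom_closed[OF aug] by blast
  qed
  have ex0: "D 0 ` carrier (dsum (trm P' (Suc 0)) (trm P'' (Suc 0)))
      = a_kernel (dsum (trm P' 0) (trm P'' 0)) B (\<lambda>w. f (aug P' (dfst w)) \<oplus>\<^bsub>B\<^esub> \<tau> (dsnd w))"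
  proof -
    have "dif P' 0 ` carrier (trm P' (Suc 0)) = a_kernel (trm P' 0) B (\<lambda>x. f (aug P' x))"
      using fa_zero resolution_exact_aug[OF P'] resolution_aug_dif[OF P'] lin_hom_zero[OF B(1,2,4)] cl(1)
      by (auto simp: mem_a_kernel)
    moreover have "dif P'' 0 ` carrier (trm P'' (Suc 0)) = a_kernel (trm P'' 0) B'' (aug P'')"
      using P'' by (simp add: projective_resolution_def)
    ultimately have "D 0 ` carrier (dsum (trm P' (Suc 0)) (trm P'' (Suc 0)))
      = {w \<in> carrier (dsum (trm P' 0) (trm P'' 0)). f (aug P' (dfst w)) \<oplus>\<^bsub>B\<^esub> \<tau> (dsnd w) = \<zero>\<^bsub>B\<^esub> \<and>
          aug P'' (dsnd w) = \<zero>\<^bsub>B''\<^esub>}"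
      unfolding D_def
      by (intro twisted_sum_exact[OF t' t' B(2) t'' t'' B(3) resolution_dif[OF P'] fa
            resolution_dif[OF P''] resolution_aug[OF P''] \<theta> \<tau>(1)] \<theta>0[rule_format])
    moreover have "aug P'' (dsnd w) = \<zero>\<^bsub>B''\<^esub>"
      if w: "w \<in> carrier (dsum (trm P' 0) (trm P'' 0))" "f (aug P' (dfst w)) \<oplus>\<^bsub>B\<^esub> \<tau> (dsnd w) = \<zero>\<^bsub>B\<^esub>" for w
    proof -
      interpret B'': left_module R B'' by (rule B(3))
      have c: "dfst w \<in> carrier (trm P' 0)" "dsnd w \<in> carrier (trm P'' 0)"
        using w by (auto simp: dsum_sel infinite_universe)
      have "g (f (aug P' (dfst w))) = \<zero>\<^bsub>B''\<^esub>" by (rule B(8)[OF lin_hom_closed[OF resolution_aug[OF P'] c(1)]])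
      moreover have "g (\<zero>\<^bsub>B\<^esub>) = g (f (aug P' (dfst w))) \<oplus>\<^bsub>B''\<^esub> g (\<tau> (dsnd w))"
        unfolding w(2)[symmetric] by (rule lin_hom_add[OF B(5) lin_hom_closed[OF fa c(1)] cl(3)[OF c(2)]])
      ultimately show ?thesis
        using \<tau>(2)[OF c(2)] lin_hom_zero[OF B(2,3,5)] lin_hom_closed[OF resolution_aug[OF P''] c(2)] by simp
    qed
    ultimately show ?thesis by (auto simp: a_kernel_def')
  qed
  have exS: "D (Suc n) ` carrier (dsum (trm P' (Suc (Suc n))) (trm P'' (Suc (Suc n))))
      = a_kernel (dsum (trm P' (Suc n)) (trm P'' (Suc n))) (dsum (trm P' n) (trm P'' n)) (D n)" for n
  proof -
    have "D (Suc n) ` carrier (dsum (trm P' (Suc (Suc n))) (trm P'' (Suc (Suc n))))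
      = {w \<in> carrier (dsum (trm P' (Suc n)) (trm P'' (Suc n))).
          dif P' n (dfst w) \<oplus>\<^bsub>trm P' n\<^esub> \<theta> n (dsnd w) = \<zero>\<^bsub>trm P' n\<^esub> \<and> dif P'' n (dsnd w) = \<zero>\<^bsub>trm P'' n\<^esub>}"
      unfolding D_def
      by (intro twisted_sum_exact[OF t' t' t' t'' t'' t'' resolution_dif[OF P'] resolution_dif[OF P']
            resolution_dif[OF P''] resolution_dif[OF P''] \<theta> \<theta>] \<theta>S[rule_format])
        (use P' P'' in \<open>simp_all add: projective_resolution_def\<close>)
    then show ?thesis by (auto simp: a_kernel_def' D_def dsum_sel)
  qed
  have resP: "projective_resolution R B P"
    unfolding projective_resolution_def
    using B(2) dsum_projective[OF resolution_projective[OF P'] resolution_projective[OF P'']] D aug onto ex0 exS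
    by (simp add: P_def)
  define u where "u n = dinl (trm P'' n)" for n
  define v where "v = (\<lambda>n :: nat. dsnd :: 'm \<Rightarrow> 'm)"
  have liftu: "projective_lift R f B' P' P u"
    unfolding projective_lift_def
  proof (intro conjI allI ballI)
    show "u i \<in> lin_hom R (trm P' i) (trm P i)" for i
      using dsum_maps(3)[OF t' t''] by (simp add: u_def P_def)
    show "u i (dif P' i x) = dif P i (u (Suc i) x)" if "x \<in> carrier (trm P' (Suc i))" for i x
    proof -
      interpret P'i: left_module R "trm P' i" by (rule t')
      show ?thesis
        using that cl lin_hom_zero[OF t'' t' \<theta>] lin_hom_zero[OF t'' t'' resolution_dif[OF P'']]
        by (simp add: u_def P_def dinl_def D_def infinite_universe)
    qed
    show "aug P (u 0 x) = f (aug P' x)" if "x \<in> carrier (trm P' 0)" for x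
      using that lin_hom_closed[OF fa] lin_hom_zero[OF t'' B(2) \<tau>(1)]
      by (simp add: u_def P_def dinl_def infinite_universe)
  qed
  have liftv: "projective_lift R g B P P'' v"
    unfolding projective_lift_def
  proof (intro conjI allI ballI)
    show "v i \<in> lin_hom R (trm P i) (trm P'' i)" for i
      using dsum_maps(2)[OF t' t''] by (simp add: v_def P_def)
    show "v i (dif P i x) = dif P'' i (v (Suc i) x)" if "x \<in> carrier (trm P (Suc i))" for i x
      by (simp add: v_def P_def D_def infinite_universe)
    show "aug P'' (v 0 x) = g (aug P x)" if "x \<in> carrier (trm P 0)" for x
    proof -
      interpret B'': left_module R B'' by (rule B(3))
      have c: "dfst x \<in> carrier (trm P' 0)" "dsnd x \<in> carrier (trm P'' 0)"
        using that by (auto simp: P_def dsum_sel infinite_universe)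
      show ?thesis
        using c \<tau>(2) lin_hom_add[OF B(5) lin_hom_closed[OF fa c(1)] cl(3)[OF c(2)]]
          B(8)[OF lin_hom_closed[OF resolution_aug[OF P'] c(1)]] lin_hom_closed[OF resolution_aug[OF P''] c(2)]
        by (simp add: v_def P_def)
    qed
  qed
  have "projective_horseshoe R B' f B g B'' P' u P v P''"
    unfolding projective_horseshoe_def
    using P' P'' resP liftu liftv dsum_short_exact[OF t' t''] by (simp add: P_def u_def v_def)
  then show ?thesis by blast
qed

section \<open>Abelian groups: subquotients and connecting homomorphisms\<close>

lemma comm_group_hom_one:
  "\<lbrakk>comm_group G; comm_group H; h \<in> hom G H\<rbrakk> \<Longrightarrow> h \<one>\<^bsub>G\<^esub> = \<one>\<^bsub>H\<^esub>"
  by (simp add: hom_one comm_group.axioms(2))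

lemma comm_group_hom_inv:
  assumes "comm_group G" "comm_group H" "h \<in> hom G H" "x \<in> carrier G"
  shows "h (inv\<^bsub>G\<^esub> x) = inv\<^bsub>H\<^esub> h x"
proof -
  interpret group_hom G H h
    using assms by (simp add: group_hom_def group_hom_axioms_def comm_group.axioms(2))
  show ?thesis using assms(4) by simp
qed

lemma (in comm_group) subgroup_comm_group:
  assumes "subgroup S G"
  shows "comm_group (G\<lparr>carrier := S\<rparr>)"
  by (rule group.group_comm_groupI[OF subgroup_imp_group[OF assms]])
    (use subgroup.mem_carrier[OF assms] m_comm in auto)

lemma (in comm_group) preimage_subgroup:
  assumes "comm_group H" "h \<in> hom G H" "subgroup S H"
  shows "subgroup {x \<in> carrier G. h x \<in> S} G"
proof -
  interpret h: group_hom G H h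
    using assms by (simp add: group_hom_def group_hom_axioms_def comm_group.axioms(2) is_group)
  show ?thesis
    by (rule subgroupI)
      (use subgroup.one_closed[OF assms(3)] subgroup.m_closed[OF assms(3)]
        subgroup.m_inv_closed[OF assms(3)] in \<open>auto intro: exI[of _ \<one>]\<close>)
qed

lemma (in comm_group) kernel_subgroup:
  assumes "comm_group H" "h \<in> hom G H"
  shows "subgroup (kernel G H h) G"
proof -
  interpret group_hom G H h
    using assms by (simp add: group_hom_def group_hom_axioms_def comm_group.axioms(2) is_group)
  show ?thesis by (rule subgroup_kernel)
qed

lemma (in comm_group) hom_image_subgroup:
  assumes "comm_group H" "h \<in> hom H G"
  shows "subgroup (h ` carrier H) G"
proof -
  interpret group_hom H G h
    using assms by (simp add: group_hom_def group_hom_axioms_def comm_group.axioms(2) is_group)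
  show ?thesis by (rule img_is_subgroup)
qed

lemma mem_kernel: "x \<in> kernel G H h \<longleftrightarrow> x \<in> carrier G \<and> h x = \<one>\<^bsub>H\<^esub>"
  by (auto simp: kernel_def)

text \<open>Homology groups consist of cosets, but diagrams are chased on representatives; the lemmas of this
  locale translate between the two.\<close>

locale subquotient = comm_group G for G (structure) +
  fixes Z B
  assumes Z: "subgroup Z G" and B: "subgroup B G" and BZ: "B \<subseteq> Z"
begin

abbreviation "quot \<equiv> (G\<lparr>carrier := Z\<rparr>) Mod B"

lemma Z_carrier: "z \<in> Z \<Longrightarrow> z \<in> carrier G"
  using subgroup.mem_carrier[OF Z] .

lemma quot_comm_group: "comm_group quot"
  by (rule comm_group.abelian_FactGroup[OF subgroup_comm_group[OF Z]])
    (rule subgroup_incl[OF B Z BZ])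

lemma quot_carrier: "carrier quot = (\<lambda>z. B #> z) ` Z"
  by (auto simp: carrier_FactGroup r_coset_def)

lemma quot_mult: "\<lbrakk>z \<in> Z; w \<in> Z\<rbrakk> \<Longrightarrow> (B #> z) \<otimes>\<^bsub>quot\<^esub> (B #> w) = B #> (z \<otimes> w)"
  using normal.rcos_sum[OF subgroup_imp_normal[OF B] Z_carrier Z_carrier]
  by (simp add: set_mult_def)

lemma coset_eq_iff:
  assumes "z \<in> Z" "w \<in> Z"
  shows "B #> z = B #> w \<longleftrightarrow> (\<exists>b\<in>B. z = b \<otimes> w)"
proof
  assume "B #> z = B #> w"
  then have "z \<in> B #> w" using rcos_self[OF Z_carrier[OF assms(1)] B] by simp
  then show "\<exists>b\<in>B. z = b \<otimes> w" by (auto simp: r_coset_def)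
next
  assume "\<exists>b\<in>B. z = b \<otimes> w"
  then have "z \<in> B #> w" by (auto simp: r_coset_def)
  then show "B #> z = B #> w" using repr_independence[OF _ Z_carrier[OF assms(2)] B] by simp
qed

lemma coset_one_iff:
  assumes "z \<in> Z"
  shows "B #> z = \<one>\<^bsub>quot\<^esub> \<longleftrightarrow> z \<in> B"
  using coset_join1[OF _ Z_carrier[OF assms] B] coset_join2[OF Z_carrier[OF assms] B]
    rcos_self[OF Z_carrier[OF assms] B] subgroup.subset[OF B] by auto

lemma coset_self: "z \<in> Z \<Longrightarrow> z \<in> B #> z"
  using rcos_self[OF Z_carrier B] .

lemma mem_coset:
  assumes "z \<in> Z" "w \<in> B #> z"
  shows "w \<in> Z \<and> B #> w = B #> z \<and> (\<exists>b\<in>B. w = b \<otimes> z)"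
proof -
  have "\<exists>b\<in>B. w = b \<otimes> z" using assms(2) by (auto simp: r_coset_def)
  moreover from this have "w \<in> Z" using assms(1) BZ subgroup.m_closed[OF Z] by auto
  ultimately show ?thesis using coset_eq_iff[of w z] assms(1) by simp
qed

end

lemma exact_atI:
  assumes "comm_group A" "comm_group B" "comm_group C" "f \<in> hom A B" "g \<in> hom B C"
    and "\<And>x. x \<in> carrier A \<Longrightarrow> g (f x) = \<one>\<^bsub>C\<^esub>"
    and "\<And>y. \<lbrakk>y \<in> carrier B; g y = \<one>\<^bsub>C\<^esub>\<rbrakk> \<Longrightarrow> \<exists>x\<in>carrier A. y = f x"
  shows "exact_at A f B g C"
proof -
  have "f ` carrier A \<subseteq> kernel B C g"
    using assms(6) hom_in_carrier[OF assms(4)] by (auto simp: mem_kernel)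
  moreover have "kernel B C g \<subseteq> f ` carrier A"
    unfolding mem_kernel subset_iff using assms(7) by blast
  ultimately show ?thesis unfolding exact_at_def using assms(1-5) by blast
qed

lemma hom_cong_on:
  assumes "comm_group A" "f \<in> hom A B" "\<And>x. x \<in> carrier A \<Longrightarrow> f' x = f x"
  shows "f' \<in> hom A B"
proof -
  interpret A: comm_group A by fact
  show ?thesis using assms(2,3) by (auto simp: hom_def)
qed

text \<open>The construction behind both kinds of connecting homomorphism: go from \<open>x\<close> back along \<open>\<pi>\<close>, forward
  along \<open>\<alpha>\<close>, back along the injection \<open>p\<close> and forward along \<open>\<beta>\<close>. The last hypothesis says that the
  choice of the preimage under \<open>\<pi>\<close> does not matter. For homology, \<open>\<alpha>\<close> is the differential and \<open>\<pi>\<close>,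
  \<open>\<beta>\<close> involve passing to classes; for the stabilization, \<open>\<alpha>\<close> comes from the embedding of a cosyzygy
  and \<open>\<beta>\<close> from the projection to the next one.\<close>

lemma connecting_map:
  fixes \<pi> :: "'a \<Rightarrow> 'x" and p :: "'c \<Rightarrow> 'b"
  assumes grp: "comm_group A" "comm_group I" "comm_group I'" "comm_group Q" "comm_group T"
    and homs: "\<pi> \<in> hom A Q" "\<alpha> \<in> hom A I" "p \<in> hom I' I" "\<beta> \<in> hom I' T"
    and onto: "\<pi> ` carrier A = carrier Q"
    and inj: "inj_on p (carrier I')"
    and pull: "\<And>y. y \<in> carrier A \<Longrightarrow> \<exists>z\<in>carrier I'. p z = \<alpha> y"
    and ker: "\<And>y. \<lbrakk>y \<in> carrier A; \<pi> y = \<one>\<^bsub>Q\<^esub>\<rbrakk> \<Longrightarrow> \<exists>z\<in>carrier I'. p z = \<alpha> y \<and> \<beta> z = \<one>\<^bsub>T\<^esub>"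
  defines "\<delta> \<equiv> \<lambda>x. THE w. \<exists>y\<in>carrier A. \<exists>z\<in>carrier I'. \<pi> y = x \<and> p z = \<alpha> y \<and> w = \<beta> z"
  shows connecting_map_value: "\<And>y z. \<lbrakk>y \<in> carrier A; z \<in> carrier I'; p z = \<alpha> y\<rbrakk> \<Longrightarrow> \<delta> (\<pi> y) = \<beta> z"
    and connecting_map_hom: "\<delta> \<in> hom Q T"
proof -
  interpret A: comm_group A by fact
  interpret I: comm_group I by fact
  interpret I': comm_group I' by fact
  interpret Q: comm_group Q by fact
  interpret T: comm_group T by fact
  note mult = hom_mult[OF homs(1)] hom_mult[OF homs(2)] hom_mult[OF homs(3)] hom_mult[OF homs(4)]
  note cl = hom_in_carrier[OF homs(1)] hom_in_carrier[OF homs(2)] hom_in_carrier[OF homs(3)]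
    hom_in_carrier[OF homs(4)]
  note inv = comm_group_hom_inv[OF grp(1,4) homs(1)] comm_group_hom_inv[OF grp(1,2) homs(2)]
    comm_group_hom_inv[OF grp(3,2) homs(3)] comm_group_hom_inv[OF grp(3,5) homs(4)]
  have uniq: "\<beta> z = \<beta> z'"
    if y: "y \<in> carrier A" "y' \<in> carrier A" and z: "z \<in> carrier I'" "z' \<in> carrier I'"
      and eq: "\<pi> y = \<pi> y'" "p z = \<alpha> y" "p z' = \<alpha> y'" for y y' z z'
  proof -
    have "\<pi> (y \<otimes>\<^bsub>A\<^esub> inv\<^bsub>A\<^esub> y') = \<one>\<^bsub>Q\<^esub>" using y eq cl by (simp add: mult inv)
    then obtain z0 where z0: "z0 \<in> carrier I'" "p z0 = \<alpha> (y \<otimes>\<^bsub>A\<^esub> inv\<^bsub>A\<^esub> y')" "\<beta> z0 = \<one>\<^bsub>T\<^esub>"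
      using ker[of "y \<otimes>\<^bsub>A\<^esub> inv\<^bsub>A\<^esub> y'"] y by auto
    have "p z0 = p (z \<otimes>\<^bsub>I'\<^esub> inv\<^bsub>I'\<^esub> z')"
      using y z eq z0 by (simp add: mult inv)
    then have "z0 = z \<otimes>\<^bsub>I'\<^esub> inv\<^bsub>I'\<^esub> z'" using inj z z0 by (simp add: inj_on_def)
    then have "\<beta> z \<otimes>\<^bsub>T\<^esub> inv\<^bsub>T\<^esub> \<beta> z' = \<one>\<^bsub>T\<^esub>" using z0(3) z by (simp add: mult inv)
    then show ?thesis using cl z by (metis T.inv_closed T.inv_inv T.inv_equality)
  qed
  show val: "\<delta> (\<pi> y) = \<beta> z" if "y \<in> carrier A" "z \<in> carrier I'" "p z = \<alpha> y" for y z
    unfolding \<delta>_def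
  proof (rule the_equality)
    show "\<exists>y'\<in>carrier A. \<exists>z'\<in>carrier I'. \<pi> y' = \<pi> y \<and> p z' = \<alpha> y' \<and> \<beta> z = \<beta> z'" using that by blast
    show "w = \<beta> z" if "\<exists>y'\<in>carrier A. \<exists>z'\<in>carrier I'. \<pi> y' = \<pi> y \<and> p z' = \<alpha> y' \<and> w = \<beta> z'" for w
      using that uniq \<open>y \<in> carrier A\<close> \<open>z \<in> carrier I'\<close> \<open>p z = \<alpha> y\<close> by metis
  qed
  have lift: "\<exists>y\<in>carrier A. \<exists>z\<in>carrier I'. x = \<pi> y \<and> p z = \<alpha> y" if "x \<in> carrier Q" for x
    using that pull onto by (metis imageE)
  show "\<delta> \<in> hom Q T"
  proof (rule homI)
    show "\<delta> x \<in> carrier T" if "x \<in> carrier Q" for x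
      using lift[OF that] val cl by auto
    fix x x' assume "x \<in> carrier Q" "x' \<in> carrier Q"
    then obtain y z y' z' where y: "y \<in> carrier A" "y' \<in> carrier A" and z: "z \<in> carrier I'" "z' \<in> carrier I'"
      and eq: "x = \<pi> y" "p z = \<alpha> y" "x' = \<pi> y'" "p z' = \<alpha> y'"
      using lift by meson
    have "\<delta> (\<pi> (y \<otimes>\<^bsub>A\<^esub> y')) = \<beta> (z \<otimes>\<^bsub>I'\<^esub> z')"
      using y z eq by (intro val) (simp_all add: mult)
    then show "\<delta> (x \<otimes>\<^bsub>Q\<^esub> x') = \<delta> x \<otimes>\<^bsub>T\<^esub> \<delta> x'"
      using y z eq val by (simp add: mult)
  qed
qed

section \<open>Right exact functors are additive\<close>

locale right_exact_functor = large_universe universe R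
  for universe :: "'m itself" and R :: "'r ring" +
  fixes F :: "('r, 'm, 'g) mod_functor"
  assumes functorial: "covariant_functor R F" and right_ex: "right_exact R F"
begin

abbreviation "lm \<equiv> left_module R"

lemma F_comm_group: "lm M \<Longrightarrow> comm_group (fobj F M)"
  using functorial unfolding covariant_functor_def by blast

lemma F_hom: "\<lbrakk>lm M; lm N; f \<in> lin_hom R M N\<rbrakk> \<Longrightarrow> fmap F M N f \<in> hom (fobj F M) (fobj F N)"
  using functorial unfolding covariant_functor_def by blast

lemma F_closed:
  "\<lbrakk>lm M; lm N; f \<in> lin_hom R M N; x \<in> carrier (fobj F M)\<rbrakk> \<Longrightarrow> fmap F M N f x \<in> carrier (fobj F N)"
  using hom_in_carrier[OF F_hom] .

lemma F_mult:
  "\<lbrakk>lm M; lm N; f \<in> lin_hom R M N; x \<in> carrier (fobj F M); y \<in> carrier (fobj F M)\<rbrakk>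
   \<Longrightarrow> fmap F M N f (x \<otimes>\<^bsub>fobj F M\<^esub> y) = fmap F M N f x \<otimes>\<^bsub>fobj F N\<^esub> fmap F M N f y"
  using hom_mult[OF F_hom] .

lemma F_one: "\<lbrakk>lm M; lm N; f \<in> lin_hom R M N\<rbrakk> \<Longrightarrow> fmap F M N f \<one>\<^bsub>fobj F M\<^esub> = \<one>\<^bsub>fobj F N\<^esub>"
  using comm_group_hom_one[OF F_comm_group F_comm_group F_hom] .

lemma F_inv: "\<lbrakk>lm M; lm N; f \<in> lin_hom R M N; x \<in> carrier (fobj F M)\<rbrakk>
   \<Longrightarrow> fmap F M N f (inv\<^bsub>fobj F M\<^esub> x) = inv\<^bsub>fobj F N\<^esub> fmap F M N f x"
  using comm_group_hom_inv[OF F_comm_group F_comm_group F_hom] .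

lemma F_cong:
  "\<lbrakk>lm M; lm N; f \<in> lin_hom R M N; g \<in> lin_hom R M N; \<And>x. x \<in> carrier M \<Longrightarrow> f x = g x; x \<in> carrier (fobj F M)\<rbrakk>
   \<Longrightarrow> fmap F M N f x = fmap F M N g x"
  using functorial[unfolded covariant_functor_def, THEN conjunct2, THEN conjunct2, THEN conjunct2,
      THEN conjunct2, rule_format, of M N f g x] by simp

lemma F_id:
  assumes "lm M" "\<And>x. x \<in> carrier M \<Longrightarrow> f x = x" "x \<in> carrier (fobj F M)"
  shows "fmap F M M f x = x"
proof -
  have f: "f \<in> lin_hom R M M" by (rule lin_hom_cong_on[OF assms(1) lin_hom_id]) (simp add: assms(2))
  have "fmap F M M f x = fmap F M M id x"
    by (rule F_cong[OF assms(1,1) f lin_hom_id _ assms(3)]) (simp add: assms(2))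
  also have "\<dots> = x"
    using functorial[unfolded covariant_functor_def, THEN conjunct2, THEN conjunct2, THEN conjunct1,
        rule_format, of M x] assms(1,3) by simp
  finally show ?thesis .
qed

lemma F_comp:
  assumes "lm L" "lm M" "lm N" "f \<in> lin_hom R L M" "g \<in> lin_hom R M N"
    and "\<And>x. x \<in> carrier L \<Longrightarrow> h x = g (f x)" and x: "x \<in> carrier (fobj F L)"
  shows "fmap F M N g (fmap F L M f x) = fmap F L N h x"
proof -
  have gf: "g \<circ> f \<in> lin_hom R L N" using assms by (intro lin_hom_comp')
  have h: "h \<in> lin_hom R L N" by (rule lin_hom_cong_on[OF assms(1) gf]) (simp add: assms(6))
  have "fmap F L N h x = fmap F L N (g \<circ> f) x"
    by (rule F_cong[OF assms(1,3) h gf _ x]) (simp add: assms(6))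
  also have "\<dots> = fmap F M N g (fmap F L M f x)"
    using functorial[unfolded covariant_functor_def, THEN conjunct2, THEN conjunct2, THEN conjunct2,
        THEN conjunct1, rule_format, of L M N f g x] assms(1-5) x by simp
  finally show ?thesis by simp
qed

lemma F_square:
  assumes "lm L" "lm M" "lm M'" "lm N" "f \<in> lin_hom R L M" "g \<in> lin_hom R M N"
    "f' \<in> lin_hom R L M'" "g' \<in> lin_hom R M' N"
    and "\<And>x. x \<in> carrier L \<Longrightarrow> g (f x) = g' (f' x)" and x: "x \<in> carrier (fobj F L)"
  shows "fmap F M N g (fmap F L M f x) = fmap F M' N g' (fmap F L M' f' x)"
  using F_comp[OF assms(1,2,4,5,6) _ x, of "\<lambda>x. g (f x)"]
    F_comp[OF assms(1,3,4,7,8) _ x, of "\<lambda>x. g (f x)"] assms(9) by simp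

lemma F_right_exact:
  assumes "lm A" "lm B" "lm C" "f \<in> lin_hom R A B" "g \<in> lin_hom R B C"
    "f ` carrier A = a_kernel B C g" "g ` carrier B = carrier C"
  shows "fmap F A B f ` carrier (fobj F A) = kernel (fobj F B) (fobj F C) (fmap F B C g)"
    "fmap F B C g ` carrier (fobj F B) = carrier (fobj F C)"
  using right_ex[unfolded right_exact_def, rule_format, of A B C f g] assms by simp_all

text \<open>A zero map factors through a zero module, on which \<open>F\<close> is trivial: \<open>0 \<rightarrow> 0 \<rightarrow> 0 \<rightarrow> 0\<close> is exact with
  all maps the identity, so the whole group is the kernel of the identity.\<close>

lemma F_zero:
  assumes "lm M" "lm N" "f \<in> lin_hom R M N" "\<And>x. x \<in> carrier M \<Longrightarrow> f x = \<zero>\<^bsub>N\<^esub>"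
    and x: "x \<in> carrier (fobj F M)"
  shows "fmap F M N f x = \<one>\<^bsub>fobj F N\<^esub>"
proof -
  interpret N: left_module R N by fact
  let ?O = "N\<lparr>carrier := {\<zero>\<^bsub>N\<^esub>}\<rparr>"
  have O: "lm ?O" by (rule submodule_left_module[OF assms(2)]) auto
  interpret FO: comm_group "fobj F ?O" by (rule F_comm_group[OF O])
  have i: "id \<in> lin_hom R ?O ?O" by (rule lin_hom_id)
  have im: "fmap F ?O ?O id ` carrier (fobj F ?O) = kernel (fobj F ?O) (fobj F ?O) (fmap F ?O ?O id)"
    by (rule F_right_exact(1)[OF O O O i i]) (auto simp: a_kernel_def')
  then have triv: "y = \<one>\<^bsub>fobj F ?O\<^esub>" if "y \<in> carrier (fobj F ?O)" for y
  proof -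
    note y = F_id[OF O _ that, of id]
    then have "y \<in> fmap F ?O ?O id ` carrier (fobj F ?O)" using imageI[OF that, of "fmap F ?O ?O id"] by simp
    with y show ?thesis unfolding im mem_kernel by simp
  qed
  have f: "f \<in> lin_hom R M ?O" by (rule lin_hom_into_submodule[OF assms(3)]) (simp add: assms(4))
  have j: "id \<in> lin_hom R ?O N" by (rule lin_hom_from_submodule[OF lin_hom_id]) auto
  have "fmap F M N f x = fmap F ?O N id (fmap F M ?O f x)"
    by (rule F_comp[OF assms(1) O assms(2) f j _ x, symmetric]) simp
  also have "\<dots> = \<one>\<^bsub>fobj F N\<^esub>"
    using triv[OF F_closed[OF assms(1) O f x]] F_one[OF O assms(2) j] by simp
  finally show ?thesis .
qed

text \<open>By right exactness of \<open>F\<close> on \<open>M \<rightarrow> M \<oplus> N \<rightarrow> N \<rightarrow> 0\<close>, what remains of \<open>w\<close> after splitting off its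
  \<open>N\<close>-component comes from \<open>F M\<close>, and projecting to \<open>M\<close> identifies it.\<close>

lemma F_dsum:
  fixes M N :: "('r, 'm) module"
  assumes M: "lm M" and N: "lm N" and w: "w \<in> carrier (fobj F (dsum M N))"
  shows "w = fmap F M (dsum M N) (dinl N) (fmap F (dsum M N) M dfst w) \<otimes>\<^bsub>fobj F (dsum M N)\<^esub>
             fmap F N (dsum M N) (dinr M) (fmap F (dsum M N) N dsnd w)"
proof -
  let ?D = "dsum M N"
  have D: "lm ?D" by (rule dsum_left_module[OF M N])
  note maps = dsum_maps[OF M N]
  interpret FD: comm_group "fobj F ?D" by (rule F_comm_group[OF D])
  interpret FM: comm_group "fobj F M" by (rule F_comm_group[OF M])
  interpret FN: comm_group "fobj F N" by (rule F_comm_group[OF N])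
  let ?r = "fmap F N ?D (dinr M) (fmap F ?D N dsnd w)"
  have r: "?r \<in> carrier (fobj F ?D)" using F_closed[OF N D maps(4) F_closed[OF D N maps(2) w]] .
  have 1: "fmap F ?D N dsnd ?r = fmap F ?D N dsnd w"
    using F_comp[OF N D N maps(4,2), of id] F_closed[OF D N maps(2) w] F_id[OF N, of id]
    by (simp add: dinr_def infinite_universe)
  have 2: "fmap F ?D M dfst ?r = \<one>\<^bsub>fobj F M\<^esub>"
    using F_comp[OF N D M maps(4,1) _ F_closed[OF D N maps(2) w], of "\<lambda>_. \<zero>\<^bsub>M\<^esub>"]
      F_zero[OF N M lin_hom_const_zero[OF N M] _ F_closed[OF D N maps(2) w]]
    by (simp add: dinr_def infinite_universe)
  have "w \<otimes>\<^bsub>fobj F ?D\<^esub> inv\<^bsub>fobj F ?D\<^esub> ?r \<in> kernel (fobj F ?D) (fobj F N) (fmap F ?D N dsnd)"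
    using w r 1 F_closed[OF D N maps(2)] by (simp add: mem_kernel F_mult[OF D N maps(2)] F_inv[OF D N maps(2)])
  then obtain a where a: "a \<in> carrier (fobj F M)" "w \<otimes>\<^bsub>fobj F ?D\<^esub> inv\<^bsub>fobj F ?D\<^esub> ?r = fmap F M ?D (dinl N) a"
    using F_right_exact(1)[OF M D N maps(3,2)] short_exactD[OF dsum_short_exact[OF M N]] by blast
  have "fmap F ?D M dfst (fmap F M ?D (dinl N) a) = a"
    using F_comp[OF M D M maps(3,1) _ a(1), of id] F_id[OF M, of id] a(1) by (simp add: dinl_def infinite_universe)
  then have "a = fmap F ?D M dfst w"
    using a(2)[symmetric] w r 2 F_closed[OF D M maps(1)] by (simp add: F_mult[OF D M maps(1)] F_inv[OF D M maps(1)])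
  then have "fmap F M ?D (dinl N) (fmap F ?D M dfst w) \<otimes>\<^bsub>fobj F ?D\<^esub> ?r
      = (w \<otimes>\<^bsub>fobj F ?D\<^esub> inv\<^bsub>fobj F ?D\<^esub> ?r) \<otimes>\<^bsub>fobj F ?D\<^esub> ?r" using a(2) by simp
  also have "\<dots> = w" using w r by (simp add: FD.m_assoc)
  finally show ?thesis by simp
qed

text \<open>The sum of \<open>f\<close> and \<open>g\<close> is the composite of the pairing \<open>M \<rightarrow> N \<oplus> N\<close> with the addition of \<open>N\<close>.\<close>

lemma F_add:
  assumes M: "lm M" and N: "lm N" and f: "f \<in> lin_hom R M N" and g: "g \<in> lin_hom R M N"
    and h: "\<And>x. x \<in> carrier M \<Longrightarrow> h x = f x \<oplus>\<^bsub>N\<^esub> g x" and x: "x \<in> carrier (fobj F M)"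
  shows "fmap F M N h x = fmap F M N f x \<otimes>\<^bsub>fobj F N\<^esub> fmap F M N g x"
proof -
  interpret N: left_module R N by fact
  let ?D = "dsum N N"
  let ?k = "\<lambda>x. pair_code (f x, g x)" and ?s = "\<lambda>w. id (dfst w) \<oplus>\<^bsub>N\<^esub> id (dsnd w)"
  have D: "lm ?D" by (rule dsum_left_module[OF N N])
  note maps = dsum_maps[OF N N]
  have k: "?k \<in> lin_hom R M ?D" by (rule dsum_pair[OF f g])
  have s: "?s \<in> lin_hom R ?D N" by (rule dsum_copair[OF N N N lin_hom_id lin_hom_id])
  have fx: "fmap F M N f x \<in> carrier (fobj F N)" and gx: "fmap F M N g x \<in> carrier (fobj F N)"
    using F_closed[OF M N f x] F_closed[OF M N g x] by auto
  have kx: "fmap F M ?D ?k x \<in> carrier (fobj F ?D)" by (rule F_closed[OF M D k x])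
  have "fmap F ?D N dfst (fmap F M ?D ?k x) = fmap F M N f x"
    by (rule F_comp[OF M D N k maps(1) _ x]) (simp add: infinite_universe)
  moreover have "fmap F ?D N dsnd (fmap F M ?D ?k x) = fmap F M N g x"
    by (rule F_comp[OF M D N k maps(2) _ x]) (simp add: infinite_universe)
  ultimately have "fmap F M ?D ?k x = fmap F N ?D (dinl N) (fmap F M N f x) \<otimes>\<^bsub>fobj F ?D\<^esub>
      fmap F N ?D (dinr N) (fmap F M N g x)"
    using F_dsum[OF N N kx] by simp
  moreover have "fmap F ?D N ?s (fmap F N ?D (dinl N) (fmap F M N f x)) = fmap F M N f x"
    using F_comp[OF N D N maps(3) s _ fx, of id] F_id[OF N _ fx, of id]
    by (simp add: dinl_def infinite_universe)
  moreover have "fmap F ?D N ?s (fmap F N ?D (dinr N) (fmap F M N g x)) = fmap F M N g x"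
    using F_comp[OF N D N maps(4) s _ gx, of id] F_id[OF N _ gx, of id]
    by (simp add: dinr_def infinite_universe)
  moreover have "fmap F ?D N ?s (fmap F M ?D ?k x) = fmap F M N h x"
    by (rule F_comp[OF M D N k s _ x]) (simp add: infinite_universe h)
  ultimately show ?thesis
    using F_mult[OF D N s F_closed[OF N D maps(3) fx] F_closed[OF N D maps(4) gx]] by simp
qed

text \<open>A right exact functor may destroy injectivity, but not a retraction.\<close>

lemma F_inj_of_retraction:
  assumes "lm A" "lm B" "f \<in> lin_hom R A B" "r \<in> lin_hom R B A" "\<And>x. x \<in> carrier A \<Longrightarrow> r (f x) = x"
  shows "inj_on (fmap F A B f) (carrier (fobj F A))"
proof (rule inj_on_inverseI)
  show "fmap F B A r (fmap F A B f x) = x" if "x \<in> carrier (fobj F A)" for x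
    using F_comp[OF assms(1,2,1,3,4) _ that, of id] F_id[OF assms(1) _ that, of id] assms(5) by simp
qed

end

section \<open>Homology of a functor applied to projective resolutions\<close>

text \<open>The maps of \<open>Lder_map\<close> and \<open>Lder_connecting\<close>, for arbitrary resolutions and lifts in place of the
  chosen ones.\<close>

definition homology_map ::
  "('r, 'm, 'g) mod_functor \<Rightarrow> ('r, 'm) resolution \<Rightarrow> ('r, 'm) resolution \<Rightarrow> (nat \<Rightarrow> 'm \<Rightarrow> 'm) \<Rightarrow> nat \<Rightarrow> 'g set \<Rightarrow> 'g set"
  where "homology_map F P Q \<phi> i =
    (\<lambda>c. THE Y. \<exists>z\<in>c. Y = homology_class F Q i (fmap F (trm P i) (trm Q i) (\<phi> i) z))"

definition homology_connecting ::
  "('r, 'm, 'g) mod_functor \<Rightarrow> ('r, 'm) resolution \<Rightarrow> (nat \<Rightarrow> 'm \<Rightarrow> 'm) \<Rightarrow> ('r, 'm) resolution \<Rightarrow>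
   (nat \<Rightarrow> 'm \<Rightarrow> 'm) \<Rightarrow> ('r, 'm) resolution \<Rightarrow> nat \<Rightarrow> 'g set \<Rightarrow> 'g set"
  where "homology_connecting F P' u P v P'' i =
    (\<lambda>c. THE Y. \<exists>b \<in> carrier (fobj F (trm P (Suc i))). \<exists>a \<in> cycles F P' i.
           fmap F (trm P (Suc i)) (trm P'' (Suc i)) (v (Suc i)) b \<in> c \<and>
           fmap F (trm P' i) (trm P i) (u i) a = fmap F (trm P (Suc i)) (trm P i) (dif P i) b \<and>
           Y = homology_class F P' i a)"

context right_exact_functor begin

text \<open>For a resolution \<open>P\<close>, the complex \<open>F P\<close> has the terms \<open>FC P i\<close> and the differentials \<open>FD P i\<close>;
  \<open>FL P Q \<phi> i\<close> is the chain map that \<open>F\<close> makes of a lift \<open>\<phi>\<close>.\<close>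

abbreviation "FC P i \<equiv> fobj F (trm P i)"
abbreviation "FD P i \<equiv> fmap F (trm P (Suc i)) (trm P i) (dif P i)"
abbreviation "FL P Q \<phi> i \<equiv> fmap F (trm P i) (trm Q i) (\<phi> i)"

lemma cycles_iff:
  "z \<in> cycles F P 0 \<longleftrightarrow> z \<in> carrier (FC P 0)"
  "z \<in> cycles F P (Suc i) \<longleftrightarrow> z \<in> carrier (FC P (Suc i)) \<and> FD P i z = \<one>\<^bsub>FC P i\<^esub>"
  by (auto simp: cycles_def mem_kernel)

lemma cycles_carrier: "z \<in> cycles F P i \<Longrightarrow> z \<in> carrier (FC P i)"
  by (cases i) (auto simp: cycles_iff)

context
  fixes M :: "('r, 'm) module" and P :: "('r, 'm) resolution"
  assumes P: "projective_resolution R M P"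
begin

lemma FC_comm_group: "comm_group (FC P i)"
  by (rule F_comm_group[OF resolution_trm[OF P]])

lemmas FD_hom = F_hom[OF resolution_trm[OF P] resolution_trm[OF P] resolution_dif[OF P]]
lemmas FD_closed = F_closed[OF resolution_trm[OF P] resolution_trm[OF P] resolution_dif[OF P]]
lemmas FD_mult = F_mult[OF resolution_trm[OF P] resolution_trm[OF P] resolution_dif[OF P]]
lemmas FD_inv = F_inv[OF resolution_trm[OF P] resolution_trm[OF P] resolution_dif[OF P]]

lemma FD_FD:
  assumes "x \<in> carrier (FC P (Suc (Suc i)))"
  shows "FD P i (FD P (Suc i) x) = \<one>\<^bsub>FC P i\<^esub>"
proof -
  note t = resolution_trm[OF P]
  have "FD P i (FD P (Suc i) x) = fmap F (trm P (Suc (Suc i))) (trm P i) (\<lambda>_. \<zero>\<^bsub>trm P i\<^esub>) x"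
    by (rule F_comp[OF t t t resolution_dif[OF P] resolution_dif[OF P] _ assms])
      (simp add: resolution_dif_dif[OF P])
  also have "\<dots> = \<one>\<^bsub>FC P i\<^esub>" by (rule F_zero[OF t t lin_hom_const_zero[OF t t] _ assms]) simp
  finally show ?thesis .
qed

lemma boundary_cycle: "x \<in> carrier (FC P (Suc i)) \<Longrightarrow> FD P i x \<in> cycles F P i"
  by (cases i) (auto simp: cycles_iff FD_FD FD_closed)

lemma cycles_subgroup: "subgroup (cycles F P i) (FC P i)"
proof (cases i)
  case 0
  interpret comm_group "FC P 0" by (rule FC_comm_group)
  show ?thesis using 0 subgroup_self by (simp add: cycles_def)
next
  case (Suc k)
  interpret comm_group "FC P (Suc k)" by (rule FC_comm_group)
  show ?thesis using Suc kernel_subgroup[OF FC_comm_group FD_hom] by (simp add: cycles_def)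
qed

lemma subquotient_homology: "subquotient (FC P i) (cycles F P i) (boundaries F P i)"
proof -
  interpret comm_group "FC P i" by (rule FC_comm_group)
  show ?thesis
  proof (intro subquotient.intro subquotient_axioms.intro FC_comm_group cycles_subgroup)
    show "subgroup (boundaries F P i) (FC P i)"
      unfolding boundaries_def by (rule hom_image_subgroup[OF FC_comm_group FD_hom])
    show "boundaries F P i \<subseteq> cycles F P i" by (auto simp: boundaries_def boundary_cycle)
  qed
qed

lemmas homology_comm_group = subquotient.quot_comm_group[OF subquotient_homology, folded homology_def]
lemmas homology_carrier = subquotient.quot_carrier[OF subquotient_homology, folded homology_def homology_class_def]
lemmas homology_mult = subquotient.quot_mult[OF subquotient_homology, folded homology_def homology_class_def]
lemmas homology_class_eq_iff = subquotient.coset_eq_iff[OF subquotient_homology, folded homology_class_def]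
lemmas homology_class_one_iff = subquotient.coset_one_iff[OF subquotient_homology, folded homology_def homology_class_def]
lemmas homology_class_self = subquotient.coset_self[OF subquotient_homology, folded homology_class_def]
lemmas mem_homology_class = subquotient.mem_coset[OF subquotient_homology, folded homology_class_def]

lemma homology_class_closed: "z \<in> cycles F P i \<Longrightarrow> homology_class F P i z \<in> carrier (homology F P i)"
  by (auto simp: homology_carrier)

lemma homology_class_cong:
  assumes "z \<in> cycles F P i" "x \<in> carrier (FC P (Suc i))"
  shows "homology_class F P i (FD P i x \<otimes>\<^bsub>FC P i\<^esub> z) = homology_class F P i z"
  using assms homology_class_eq_iff[of "FD P i x \<otimes>\<^bsub>FC P i\<^esub> z" i z] boundary_cycle[OF assms(2)]
    subgroup.m_closed[OF cycles_subgroup] by (auto simp: boundaries_def)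

lemma homology_class_one: "homology_class F P i \<one>\<^bsub>FC P i\<^esub> = \<one>\<^bsub>homology F P i\<^esub>"
proof -
  interpret subquotient "FC P i" "cycles F P i" "boundaries F P i" by (rule subquotient_homology)
  show ?thesis using homology_class_one_iff[of "\<one>\<^bsub>FC P i\<^esub>"] subgroup.one_closed[OF Z] subgroup.one_closed[OF B] by simp
qed

end

lemma projective_lift_lin_hom: "projective_lift R f M P Q \<phi> \<Longrightarrow> \<phi> i \<in> lin_hom R (trm P i) (trm Q i)"
  by (simp add: projective_lift_def)

context
  fixes M N :: "('r, 'm) module" and P Q :: "('r, 'm) resolution" and f :: "'m \<Rightarrow> 'm" and \<phi>
  assumes P: "projective_resolution R M P" and Q: "projective_resolution R N Q"
    and \<phi>: "projective_lift R f M P Q \<phi>"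
begin

lemmas FL_hom = F_hom[OF resolution_trm[OF P] resolution_trm[OF Q] projective_lift_lin_hom[OF \<phi>]]
lemmas FL_closed = F_closed[OF resolution_trm[OF P] resolution_trm[OF Q] projective_lift_lin_hom[OF \<phi>]]
lemmas FL_mult = F_mult[OF resolution_trm[OF P] resolution_trm[OF Q] projective_lift_lin_hom[OF \<phi>]]
lemmas FL_one = F_one[OF resolution_trm[OF P] resolution_trm[OF Q] projective_lift_lin_hom[OF \<phi>]]
lemmas FL_inv = F_inv[OF resolution_trm[OF P] resolution_trm[OF Q] projective_lift_lin_hom[OF \<phi>]]

lemma FL_FD:
  assumes "x \<in> carrier (FC P (Suc i))"
  shows "FL P Q \<phi> i (FD P i x) = FD Q i (FL P Q \<phi> (Suc i) x)"
  by (rule F_square[OF resolution_trm[OF P] resolution_trm[OF P] resolution_trm[OF Q] resolution_trm[OF Q]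
        resolution_dif[OF P] projective_lift_lin_hom[OF \<phi>] projective_lift_lin_hom[OF \<phi>] resolution_dif[OF Q]
        _ assms])
    (use \<phi> in \<open>simp add: projective_lift_def\<close>)

lemma FL_cycle:
  assumes "z \<in> cycles F P i" shows "FL P Q \<phi> i z \<in> cycles F Q i"
proof (cases i)
  case (Suc k)
  then show ?thesis using assms by (auto simp: cycles_iff FL_closed FL_FD[symmetric] FL_one)
qed (use assms in \<open>auto simp: cycles_iff FL_closed\<close>)

lemma homology_map_class:
  assumes z: "z \<in> cycles F P i"
  shows "homology_map F P Q \<phi> i (homology_class F P i z) = homology_class F Q i (FL P Q \<phi> i z)"
proof -
  have const: "homology_class F Q i (FL P Q \<phi> i w) = homology_class F Q i (FL P Q \<phi> i z)"
    if w: "w \<in> homology_class F P i z" for w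
  proof -
    obtain x where x: "x \<in> carrier (FC P (Suc i))" "w = FD P i x \<otimes>\<^bsub>FC P i\<^esub> z"
      using mem_homology_class[OF P z w] by (auto simp: boundaries_def)
    have "FL P Q \<phi> i w = FD Q i (FL P Q \<phi> (Suc i) x) \<otimes>\<^bsub>FC Q i\<^esub> FL P Q \<phi> i z"
      using x(1) cycles_carrier[OF z] by (simp add: x(2) FL_mult FL_FD FD_closed[OF P])
    then show ?thesis using homology_class_cong[OF Q FL_cycle[OF z] FL_closed[OF x(1)]] by simp
  qed
  show ?thesis
    unfolding homology_map_def
  proof (rule the_equality)
    show "\<exists>w\<in>homology_class F P i z. homology_class F Q i (FL P Q \<phi> i z) = homology_class F Q i (FL P Q \<phi> i w)"
      using homology_class_self[OF P z] by blast
  next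
    fix Y assume "\<exists>w\<in>homology_class F P i z. Y = homology_class F Q i (FL P Q \<phi> i w)"
    then show "Y = homology_class F Q i (FL P Q \<phi> i z)" using const by (elim bexE) simp
  qed
qed

lemma homology_map_hom: "homology_map F P Q \<phi> i \<in> hom (homology F P i) (homology F Q i)"
proof (rule homI)
  show "homology_map F P Q \<phi> i c \<in> carrier (homology F Q i)" if "c \<in> carrier (homology F P i)" for c
    using that by (auto simp: homology_carrier[OF P] homology_map_class homology_class_closed[OF Q] FL_cycle)
  show "homology_map F P Q \<phi> i (c \<otimes>\<^bsub>homology F P i\<^esub> d)
      = homology_map F P Q \<phi> i c \<otimes>\<^bsub>homology F Q i\<^esub> homology_map F P Q \<phi> i d"
    if "c \<in> carrier (homology F P i)" "d \<in> carrier (homology F P i)" for c d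
    using that subgroup.m_closed[OF cycles_subgroup[OF P]]
    by (auto simp: homology_carrier[OF P] homology_mult[OF P] homology_mult[OF Q] homology_map_class FL_cycle FL_mult
        cycles_carrier)
qed

end

text \<open>Additivity turns the homotopy into one between \<open>F \<phi>\<close> and \<open>F \<psi>\<close>. On a cycle the summand \<open>F s F d\<close>
  vanishes and \<open>F d F s\<close> is a boundary.\<close>

lemma homology_map_homotopic:
  assumes P: "projective_resolution R M P" and Q: "projective_resolution R N Q"
    and \<phi>: "projective_lift R f M P Q \<phi>" and \<psi>: "projective_lift R f M P Q \<psi>"
    and c: "c \<in> carrier (homology F P i)"
  shows "homology_map F P Q \<phi> i c = homology_map F P Q \<psi> i c"
proof -
  note t = resolution_trm[OF P] resolution_trm[OF Q]
  obtain s where s: "\<And>i. s i \<in> lin_hom R (trm P i) (trm Q (Suc i))"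
    and s0: "\<And>x. x \<in> carrier (trm P 0) \<Longrightarrow> \<phi> 0 x = \<psi> 0 x \<oplus>\<^bsub>trm Q 0\<^esub> dif Q 0 (s 0 x)"
    and sS: "\<And>i x. x \<in> carrier (trm P (Suc i)) \<Longrightarrow> \<phi> (Suc i) x = \<psi> (Suc i) x \<oplus>\<^bsub>trm Q (Suc i)\<^esub>
         (dif Q (Suc i) (s (Suc i) x) \<oplus>\<^bsub>trm Q (Suc i)\<^esub> s i (dif P i x))"
    using projective_lifts_homotopic[OF P Q \<phi> \<psi>] by metis
  obtain z where z: "z \<in> cycles F P i" "c = homology_class F P i z"
    using c by (auto simp: homology_carrier[OF P])
  have zc: "z \<in> carrier (FC P i)" by (rule cycles_carrier[OF z(1)])
  note \<psi>h = projective_lift_lin_hom[OF \<psi>]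
  let ?s = "fmap F (trm P i) (trm Q (Suc i)) (s i)"
  have ds: "(\<lambda>x. dif Q k (s k x)) \<in> lin_hom R (trm P k) (trm Q k)" for k
    by (rule lin_hom_comp[OF s resolution_dif[OF Q]])
  have sz: "?s z \<in> carrier (FC Q (Suc i))" by (rule F_closed[OF t s zc])
  have dsz: "fmap F (trm P i) (trm Q i) (\<lambda>x. dif Q i (s i x)) z = FD Q i (?s z)"
    by (rule F_comp[OF t t(2) s resolution_dif[OF Q] refl zc, symmetric])
  have \<psi>z: "FL P Q \<psi> i z \<in> cycles F Q i" by (rule FL_cycle[OF P Q \<psi> z(1)])
  interpret Qi: comm_group "FC Q i" by (rule FC_comm_group[OF Q])
  have "FL P Q \<phi> i z = FD Q i (?s z) \<otimes>\<^bsub>FC Q i\<^esub> FL P Q \<psi> i z"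
  proof (cases i)
    case 0
    have "FL P Q \<phi> i z = FL P Q \<psi> i z \<otimes>\<^bsub>FC Q i\<^esub> FD Q i (?s z)"
      unfolding dsz[symmetric] by (rule F_add[OF t \<psi>h ds _ zc]) (simp add: 0 s0)
    then show ?thesis using cycles_carrier[OF \<psi>z] FD_closed[OF Q sz] by (simp add: Qi.m_comm)
  next
    case (Suc k)
    have sd: "(\<lambda>x. s k (dif P k x)) \<in> lin_hom R (trm P i) (trm Q i)"
      unfolding Suc by (rule lin_hom_comp[OF resolution_dif[OF P] s])
    have "fmap F (trm P i) (trm Q i) (\<lambda>x. s k (dif P k x)) z = fmap F (trm P k) (trm Q i) (s k) (FD P k z)"
      using zc unfolding Suc by (intro F_comp[OF t(1,1,2) resolution_dif[OF P] s, symmetric]) auto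
    also have "\<dots> = \<one>\<^bsub>FC Q i\<^esub>" using z(1) F_one[OF t s, of k] unfolding Suc by (simp add: cycles_iff)
    finally have sdz: "fmap F (trm P i) (trm Q i) (\<lambda>x. s k (dif P k x)) z = \<one>\<^bsub>FC Q i\<^esub>" .
    have "FL P Q \<phi> i z = FL P Q \<psi> i z \<otimes>\<^bsub>FC Q i\<^esub>
        fmap F (trm P i) (trm Q i) (\<lambda>x. dif Q i (s i x) \<oplus>\<^bsub>trm Q i\<^esub> s k (dif P k x)) z"
      by (rule F_add[OF t \<psi>h lin_hom_plus[OF t ds sd] _ zc]) (simp add: Suc sS)
    also have "fmap F (trm P i) (trm Q i) (\<lambda>x. dif Q i (s i x) \<oplus>\<^bsub>trm Q i\<^esub> s k (dif P k x)) z
        = FD Q i (?s z) \<otimes>\<^bsub>FC Q i\<^esub> \<one>\<^bsub>FC Q i\<^esub>"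
      unfolding dsz[symmetric] sdz[symmetric] by (rule F_add[OF t ds sd refl zc])
    finally show ?thesis using cycles_carrier[OF \<psi>z] FD_closed[OF Q sz] by (simp add: Qi.m_comm)
  qed
  then show ?thesis
    using homology_class_cong[OF Q \<psi>z sz] by (simp add: z homology_map_class[OF P Q \<phi>] homology_map_class[OF P Q \<psi>])
qed

lemma projective_lift_comp:
  assumes P: "projective_resolution R L P" and \<phi>: "projective_lift R f L P Q \<phi>" and \<psi>: "projective_lift R g M Q S \<psi>"
  shows "projective_lift R (\<lambda>x. g (f x)) L P S (\<lambda>i x. \<psi> i (\<phi> i x))"
  using \<phi> \<psi> lin_hom_comp[OF projective_lift_lin_hom[OF \<phi>] projective_lift_lin_hom[OF \<psi>]]
    lin_hom_closed[OF projective_lift_lin_hom[OF \<phi>]]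
  by (auto simp: projective_lift_def)

lemma projective_lift_cong:
  assumes P: "projective_resolution R M P" and "projective_lift R f M P Q \<phi>" "\<And>x. x \<in> carrier M \<Longrightarrow> f x = g x"
  shows "projective_lift R g M P Q \<phi>"
  using assms(2,3) lin_hom_closed[OF resolution_aug[OF P]] by (auto simp: projective_lift_def)

lemma homology_map_comp:
  assumes P: "projective_resolution R L P" and Q: "projective_resolution R M Q" and S: "projective_resolution R N S"
    and \<phi>: "projective_lift R f L P Q \<phi>" and \<psi>: "projective_lift R g M Q S \<psi>"
    and \<chi>: "projective_lift R h L P S \<chi>" and h: "\<And>x. x \<in> carrier L \<Longrightarrow> h x = g (f x)"
    and c: "c \<in> carrier (homology F P i)"
  shows "homology_map F Q S \<psi> i (homology_map F P Q \<phi> i c) = homology_map F P S \<chi> i c"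
proof -
  note comp = projective_lift_cong[OF P projective_lift_comp[OF P \<phi> \<psi>], of h]
  have comp: "projective_lift R h L P S (\<lambda>i x. \<psi> i (\<phi> i x))"
    by (rule comp) (simp add: h)
  obtain z where z: "z \<in> cycles F P i" "c = homology_class F P i z"
    using c by (auto simp: homology_carrier[OF P])
  have "FL Q S \<psi> i (FL P Q \<phi> i z) = FL P S (\<lambda>i x. \<psi> i (\<phi> i x)) i z"
    by (rule F_comp[OF resolution_trm[OF P] resolution_trm[OF Q] resolution_trm[OF S]
          projective_lift_lin_hom[OF \<phi>] projective_lift_lin_hom[OF \<psi>] refl cycles_carrier[OF z(1)]])
  then have "homology_map F Q S \<psi> i (homology_map F P Q \<phi> i c) = homology_map F P S (\<lambda>i x. \<psi> i (\<phi> i x)) i c"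
    using z by (simp add: homology_map_class[OF P Q \<phi>] homology_map_class[OF Q S \<psi>]
        homology_map_class[OF P S comp] FL_cycle[OF P Q \<phi>])
  then show ?thesis using homology_map_homotopic[OF P S comp \<chi> c] by simp
qed

lemma homology_map_id:
  assumes P: "projective_resolution R M P" and \<phi>: "projective_lift R f M P P \<phi>"
    and f: "\<And>x. x \<in> carrier M \<Longrightarrow> f x = x" and c: "c \<in> carrier (homology F P i)"
  shows "homology_map F P P \<phi> i c = c"
proof -
  have i: "projective_lift R f M P P (\<lambda>_ x. x)"
    using f lin_hom_closed[OF resolution_aug[OF P]] lin_hom_id[unfolded id_def]
    by (auto simp: projective_lift_def)
  obtain z where z: "z \<in> cycles F P i" "c = homology_class F P i z"
    using c by (auto simp: homology_carrier[OF P])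
  have "FL P P (\<lambda>_ x. x) i z = z"
    by (rule F_id[OF resolution_trm[OF P] refl cycles_carrier[OF z(1)]])
  then have "homology_map F P P (\<lambda>_ x. x) i c = c" using z by (simp add: homology_map_class[OF P P i])
  then show ?thesis using homology_map_homotopic[OF P P \<phi> i c] by simp
qed

text \<open>Lifts of the identity in both directions are inverse to each other on homology, their composites
  being lifts of the identity like the identity itself.\<close>

lemma homology_map_bij:
  assumes P: "projective_resolution R M P" and Q: "projective_resolution R M Q"
    and \<phi>: "projective_lift R id M P Q \<phi>"
  shows "bij_betw (homology_map F P Q \<phi> i) (carrier (homology F P i)) (carrier (homology F Q i))"
proof -
  obtain \<psi> where \<psi>: "projective_lift R id M Q P \<psi>" using ex_projective_lift[OF Q P lin_hom_id] by blast
  have cl: "homology_map F P Q \<phi> i c \<in> carrier (homology F Q i)" if "c \<in> carrier (homology F P i)" for c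
    using hom_in_carrier[OF homology_map_hom[OF P Q \<phi>] that] .
  have cl': "homology_map F Q P \<psi> i c \<in> carrier (homology F P i)" if "c \<in> carrier (homology F Q i)" for c
    using hom_in_carrier[OF homology_map_hom[OF Q P \<psi>] that] .
  obtain i1 where i1: "projective_lift R id M P P i1" using ex_projective_lift[OF P P lin_hom_id] by blast
  obtain i2 where i2: "projective_lift R id M Q Q i2" using ex_projective_lift[OF Q Q lin_hom_id] by blast
  show ?thesis
  proof (rule bij_betw_byWitness[where f' = "homology_map F Q P \<psi> i"])
    show "\<forall>c\<in>carrier (homology F P i). homology_map F Q P \<psi> i (homology_map F P Q \<phi> i c) = c"
      using homology_map_comp[OF P Q P \<phi> \<psi> i1] homology_map_id[OF P i1] by simp
    show "\<forall>c\<in>carrier (homology F Q i). homology_map F P Q \<phi> i (homology_map F Q P \<psi> i c) = c"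
      using homology_map_comp[OF Q P Q \<psi> \<phi> i2] homology_map_id[OF Q i2] by simp
  qed (use cl cl' in auto)
qed

end

section \<open>The long exact homology sequence\<close>

text \<open>With a section \<open>t\<close> of \<open>g\<close>, the difference \<open>b - t (g b)\<close> lies in the image of \<open>f\<close>.\<close>

lemma short_exact_retraction:
  assumes ses: "short_exact R A f B g C" and C: "projective_module R C"
  shows "\<exists>r\<in>lin_hom R B A. \<forall>x\<in>carrier A. r (f x) = x"
proof -
  note s = short_exactD[OF ses]
  interpret A: left_module R A by (rule s(1))
  interpret B: left_module R B by (rule s(2))
  interpret C: left_module R C by (rule s(3))
  obtain t where t: "t \<in> lin_hom R C B" "\<And>c. c \<in> carrier C \<Longrightarrow> g (t c) = c"
    using projective_lift_exact[OF C s(2,3,5) lin_hom_id] s(7) by auto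
  define h where "h b = b \<ominus>\<^bsub>B\<^esub> t (g b)" for b
  have h: "h \<in> lin_hom R B B"
    unfolding h_def using lin_hom_minus_fun[OF s(2,2) lin_hom_id lin_hom_comp[OF s(5) t(1)]] by simp
  have im: "h b \<in> f ` carrier A" if "b \<in> carrier B" for b
  proof (rule s(9))
    show "h b \<in> carrier B" using lin_hom_closed[OF h that] .
    have gb: "g b \<in> carrier C" by (rule lin_hom_closed[OF s(5) that])
    then show "g (h b) = \<zero>\<^bsub>C\<^esub>"
      using lin_hom_diff[OF s(2,3,5) that lin_hom_closed[OF t(1) gb]] t(2)[OF gb]
      by (simp add: h_def C.diff_eq_zero)
  qed
  define r where "r b = inv_into (carrier A) f (h b)" for b
  have r: "r b \<in> carrier A" "f (r b) = h b" if "b \<in> carrier B" for b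
    using inv_into_into[OF im[OF that]] f_inv_into_f[OF im[OF that]] by (simp_all add: r_def)
  have rI: "r b = a" if "b \<in> carrier B" "a \<in> carrier A" "f a = h b" for a b
    using s(6) r[OF that(1)] that by (simp add: inj_on_def)
  have "r \<in> lin_hom R B A"
  proof (rule lin_homI)
    show "r (x \<oplus>\<^bsub>B\<^esub> y) = r x \<oplus>\<^bsub>A\<^esub> r y" if "x \<in> carrier B" "y \<in> carrier B" for x y
      using that r by (intro rI) (simp_all add: lin_hom_add[OF s(4)] lin_hom_add[OF h])
    show "r (a \<odot>\<^bsub>B\<^esub> x) = a \<odot>\<^bsub>A\<^esub> r x" if "a \<in> carrier R" "x \<in> carrier B" for a x
      using that r by (intro rI) (simp_all add: lin_hom_smult[OF s(4)] lin_hom_smult[OF h] A.smult_closed B.smult_closed)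
  qed (rule r(1))
  moreover have "r (f x) = x" if "x \<in> carrier A" for x
    using that s(8) lin_hom_zero[OF s(3,2) t(1)] lin_hom_closed[OF s(4)]
    by (intro rI) (simp_all add: h_def B.M.minus_eq)
  ultimately show ?thesis by blast
qed

context right_exact_functor begin

context
  fixes B' B B'' :: "('r, 'm) module" and P' P P'' :: "('r, 'm) resolution" and f g :: "'m \<Rightarrow> 'm" and u v
  assumes hs: "projective_horseshoe R B' f B g B'' P' u P v P''"
begin

lemma
  shows horseshoe_res: "projective_resolution R B' P'" "projective_resolution R B P" "projective_resolution R B'' P''"
    and horseshoe_lift: "projective_lift R f B' P' P u" "projective_lift R g B P P'' v"
    and horseshoe_ses: "\<And>i. short_exact R (trm P' i) (u i) (trm P i) (v i) (trm P'' i)"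
  using hs unfolding projective_horseshoe_def by blast+

lemmas P'_res = horseshoe_res(1) and P_res = horseshoe_res(2) and P''_res = horseshoe_res(3)
lemmas u_lift = horseshoe_lift(1) and v_lift = horseshoe_lift(2)

lemma Fu_inj: "inj_on (FL P' P u i) (carrier (FC P' i))"
proof -
  obtain r where "r \<in> lin_hom R (trm P i) (trm P' i)" "\<forall>x\<in>carrier (trm P' i). r (u i x) = x"
    using short_exact_retraction[OF horseshoe_ses resolution_projective[OF P''_res]] by blast
  then show ?thesis
    by (intro F_inj_of_retraction[OF resolution_trm[OF P'_res] resolution_trm[OF P_res] projective_lift_lin_hom[OF u_lift]]) auto
qed

lemma Fu_one: "\<lbrakk>x \<in> carrier (FC P' i); FL P' P u i x = \<one>\<^bsub>FC P i\<^esub>\<rbrakk> \<Longrightarrow> x = \<one>\<^bsub>FC P' i\<^esub>"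
proof -
  interpret C': comm_group "FC P' i" by (rule FC_comm_group[OF P'_res])
  show "\<lbrakk>x \<in> carrier (FC P' i); FL P' P u i x = \<one>\<^bsub>FC P i\<^esub>\<rbrakk> \<Longrightarrow> x = \<one>\<^bsub>FC P' i\<^esub>"
    using Fu_inj[of i] FL_one[OF P'_res P_res u_lift, of i] by (simp add: inj_on_def)
qed

lemma Fuv_kernel: "FL P' P u i ` carrier (FC P' i) = kernel (FC P i) (FC P'' i) (FL P P'' v i)"
  and Fv_onto: "FL P P'' v i ` carrier (FC P i) = carrier (FC P'' i)"
  using F_right_exact[OF short_exactD(1-5,10,7)[OF horseshoe_ses]] by blast+

lemma Fv_Fu: "x \<in> carrier (FC P' i) \<Longrightarrow> FL P P'' v i (FL P' P u i x) = \<one>\<^bsub>FC P'' i\<^esub>"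
  using Fuv_kernel[of i] imageI[of x "carrier (FC P' i)" "FL P' P u i"] by (simp add: mem_kernel)

lemma Fv_one_imp:
  assumes "y \<in> carrier (FC P i)" "FL P P'' v i y = \<one>\<^bsub>FC P'' i\<^esub>"
  shows "\<exists>x\<in>carrier (FC P' i). y = FL P' P u i x"
proof -
  have "y \<in> kernel (FC P i) (FC P'' i) (FL P P'' v i)" using assms by (simp add: mem_kernel)
  then show ?thesis unfolding Fuv_kernel[symmetric] by blast
qed

lemma cycle_of_Fu:
  assumes "x \<in> carrier (FC P' i)" "FL P' P u i x \<in> cycles F P i"
  shows "x \<in> cycles F P' i"
proof (cases i)
  case 0
  then show ?thesis using assms by (simp add: cycles_iff)
next
  case (Suc k)
  have x: "x \<in> carrier (FC P' (Suc k))" using assms(1) Suc by simp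
  have "FL P' P u k (FD P' k x) = \<one>\<^bsub>FC P k\<^esub>"
    using FL_FD[OF P'_res P_res u_lift x] assms(2) Suc by (simp add: cycles_iff)
  then show ?thesis using Fu_one[OF FD_closed[OF P'_res x]] x Suc by (simp add: cycles_iff)
qed

text \<open>Lift to \<open>F P\<close> the chain whose boundary is the image of \<open>b\<close>; what remains of \<open>b\<close> after removing the
  boundary of the lift is killed by \<open>F v\<close>, so it comes from \<open>F P'\<close>.\<close>

lemma correct_by_boundary:
  assumes b: "b \<in> carrier (FC P i)" and bd: "FL P P'' v i b \<in> boundaries F P'' i"
  shows "\<exists>a\<in>carrier (FC P' i). \<exists>c\<in>carrier (FC P (Suc i)). b = FD P i c \<otimes>\<^bsub>FC P i\<^esub> FL P' P u i a"
proof -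
  interpret C: comm_group "FC P i" by (rule FC_comm_group[OF P_res])
  interpret C'': comm_group "FC P'' i" by (rule FC_comm_group[OF P''_res])
  obtain c'' where c'': "c'' \<in> carrier (FC P'' (Suc i))" "FL P P'' v i b = FD P'' i c''"
    using bd by (auto simp: boundaries_def)
  then obtain c where c: "c \<in> carrier (FC P (Suc i))" "c'' = FL P P'' v (Suc i) c"
    using Fv_onto[of "Suc i"] by blast
  have dc: "FD P i c \<in> carrier (FC P i)" by (rule FD_closed[OF P_res c(1)])
  let ?y = "inv\<^bsub>FC P i\<^esub> (FD P i c) \<otimes>\<^bsub>FC P i\<^esub> b"
  have "FL P P'' v i ?y = \<one>\<^bsub>FC P'' i\<^esub>"
    using b dc FD_closed[OF P''_res FL_closed[OF P_res P''_res v_lift c(1)]] FL_FD[OF P_res P''_res v_lift c(1)] c''(2) c(2)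
    by (simp add: FL_mult[OF P_res P''_res v_lift] FL_inv[OF P_res P''_res v_lift])
  then obtain a where "a \<in> carrier (FC P' i)" "?y = FL P' P u i a"
    using Fv_one_imp[of ?y i] b dc by auto
  moreover have "b = FD P i c \<otimes>\<^bsub>FC P i\<^esub> ?y" using b dc by (simp add: C.m_assoc[symmetric])
  ultimately show ?thesis using c(1) by metis
qed

lemma homology_exact_middle:
  "exact_at (homology F P' i) (homology_map F P' P u i) (homology F P i) (homology_map F P P'' v i) (homology F P'' i)"
proof (rule exact_atI)
  show "homology_map F P P'' v i (homology_map F P' P u i c) = \<one>\<^bsub>homology F P'' i\<^esub>"
    if c: "c \<in> carrier (homology F P' i)" for c
  proof -
    obtain z where z: "z \<in> cycles F P' i" "c = homology_class F P' i z"
      using c by (auto simp: homology_carrier[OF P'_res])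
    show ?thesis
      using z by (simp add: homology_map_class[OF P'_res P_res u_lift] homology_map_class[OF P_res P''_res v_lift] FL_cycle[OF P'_res P_res u_lift]
          Fv_Fu cycles_carrier homology_class_one[OF P''_res])
  qed
  fix c assume c: "c \<in> carrier (homology F P i)" and one: "homology_map F P P'' v i c = \<one>\<^bsub>homology F P'' i\<^esub>"
  obtain z where z: "z \<in> cycles F P i" "c = homology_class F P i z"
    using c by (auto simp: homology_carrier[OF P_res])
  have "FL P P'' v i z \<in> boundaries F P'' i"
    using one z homology_class_one_iff[OF P''_res FL_cycle[OF P_res P''_res v_lift z(1)]] by (simp add: homology_map_class[OF P_res P''_res v_lift])
  then obtain a b where a: "a \<in> carrier (FC P' i)" and b: "b \<in> carrier (FC P (Suc i))"
    and zab: "z = FD P i b \<otimes>\<^bsub>FC P i\<^esub> FL P' P u i a"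
    using correct_by_boundary[OF cycles_carrier[OF z(1)]] by blast
  interpret C: comm_group "FC P i" by (rule FC_comm_group[OF P_res])
  have Fa: "FL P' P u i a \<in> carrier (FC P i)" by (rule FL_closed[OF P'_res P_res u_lift a])
  have db: "FD P i b \<in> cycles F P i" by (rule boundary_cycle[OF P_res b])
  have "FL P' P u i a = inv\<^bsub>FC P i\<^esub> (FD P i b) \<otimes>\<^bsub>FC P i\<^esub> z"
    using Fa cycles_carrier[OF db] by (simp add: zab C.m_assoc[symmetric])
  then have Fac: "FL P' P u i a \<in> cycles F P i"
    using db z(1) cycles_subgroup[OF P_res] by (simp add: subgroup.m_closed subgroup.m_inv_closed)
  then have az: "a \<in> cycles F P' i" by (rule cycle_of_Fu[OF a])
  have "c = homology_map F P' P u i (homology_class F P' i a)"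
    using homology_class_cong[OF P_res Fac b] az by (simp add: z(2) zab homology_map_class[OF P'_res P_res u_lift])
  then show "\<exists>x\<in>carrier (homology F P' i). c = homology_map F P' P u i x"
    using homology_class_closed[OF P'_res az] by blast
qed (rule homology_comm_group[OF P'_res] homology_comm_group[OF P_res] homology_comm_group[OF P''_res]
    homology_map_hom[OF P'_res P_res u_lift] homology_map_hom[OF P_res P''_res v_lift])+

text \<open>The first half of the snake: if \<open>b\<close> lies over a cycle of \<open>F P''\<close>, its differential dies in \<open>F P''\<close>
  and so comes from \<open>F P'\<close>.\<close>

lemma FD_liftable:
  assumes b: "b \<in> carrier (FC P (Suc i))" and c: "FL P P'' v (Suc i) b \<in> cycles F P'' (Suc i)"
  shows "\<exists>a\<in>cycles F P' i. FL P' P u i a = FD P i b"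
proof -
  have "FL P P'' v i (FD P i b) = \<one>\<^bsub>FC P'' i\<^esub>"
    using FL_FD[OF P_res P''_res v_lift b] c by (simp add: cycles_iff)
  then obtain a where "a \<in> carrier (FC P' i)" "FD P i b = FL P' P u i a"
    using Fv_one_imp[OF FD_closed[OF P_res b]] by blast
  then show ?thesis using cycle_of_Fu boundary_cycle[OF P_res b] by metis
qed

abbreviation "hconn \<equiv> homology_connecting F P' u P v P''"

lemma
  shows hconn_class: "\<And>b a. \<lbrakk>b \<in> carrier (FC P (Suc i)); FL P P'' v (Suc i) b \<in> cycles F P'' (Suc i);
          a \<in> cycles F P' i; FL P' P u i a = FD P i b\<rbrakk>
        \<Longrightarrow> hconn i (homology_class F P'' (Suc i) (FL P P'' v (Suc i) b)) = homology_class F P' i a"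
    and hconn_hom: "hconn i \<in> hom (homology F P'' (Suc i)) (homology F P' i)"
proof -
  interpret C: comm_group "FC P (Suc i)" by (rule FC_comm_group[OF P_res])
  interpret C': comm_group "FC P' i" by (rule FC_comm_group[OF P'_res])
  \<comment> \<open>The elements of \<open>F P\<close> lying over cycles of \<open>F P''\<close>: the chase from a homology class starts at one of them.\<close>
  define S where "S = {b \<in> carrier (FC P (Suc i)). FL P P'' v (Suc i) b \<in> cycles F P'' (Suc i)}"
  let ?A = "FC P (Suc i)\<lparr>carrier := S\<rparr>" and ?Z = "FC P' i\<lparr>carrier := cycles F P' i\<rparr>"
  let ?H'' = "homology F P'' (Suc i)" and ?H' = "homology F P' i"
  let ?pi = "\<lambda>b. homology_class F P'' (Suc i) (FL P P'' v (Suc i) b)"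
  have S: "subgroup S (FC P (Suc i))"
    unfolding S_def
    by (rule C.preimage_subgroup[OF FC_comm_group[OF P''_res] FL_hom[OF P_res P''_res v_lift] cycles_subgroup[OF P''_res]])
  have SI: "b \<in> S \<longleftrightarrow> b \<in> carrier (FC P (Suc i)) \<and> FL P P'' v (Suc i) b \<in> cycles F P'' (Suc i)" for b
    by (simp add: S_def)
  have pi: "?pi \<in> hom ?A ?H''"
    by (rule homI)
      (auto simp: SI homology_class_closed[OF P''_res] homology_mult[OF P''_res] FL_mult[OF P_res P''_res v_lift])
  have al: "FD P i \<in> hom ?A (FC P i)"
    by (rule homI) (auto simp: SI FD_closed[OF P_res] FD_mult[OF P_res])
  have p: "FL P' P u i \<in> hom ?Z (FC P i)"
    by (rule homI) (auto simp: cycles_carrier FL_closed[OF P'_res P_res u_lift] FL_mult[OF P'_res P_res u_lift])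
  have be: "homology_class F P' i \<in> hom ?Z ?H'"
    by (rule homI) (auto simp: homology_class_closed[OF P'_res] homology_mult[OF P'_res])
  have onto: "?pi ` carrier ?A = carrier ?H''"
  proof (intro equalityI subsetI)
    fix c assume "c \<in> carrier ?H''"
    then obtain z where z: "z \<in> cycles F P'' (Suc i)" "c = homology_class F P'' (Suc i) z"
      by (auto simp: homology_carrier[OF P''_res])
    then obtain b where "b \<in> carrier (FC P (Suc i))" "z = FL P P'' v (Suc i) b"
      using Fv_onto[of "Suc i"] cycles_carrier[OF z(1)] by blast
    then show "c \<in> ?pi ` carrier ?A" using z by (auto simp: SI)
  qed (auto simp: SI homology_class_closed[OF P''_res])
  have inj: "inj_on (FL P' P u i) (carrier ?Z)"
    by (rule inj_on_subset[OF Fu_inj]) (auto simp: cycles_carrier)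
  have pull: "\<exists>z\<in>carrier ?Z. FL P' P u i z = FD P i y" if "y \<in> carrier ?A" for y
    using that FD_liftable[of y i] by (simp add: SI)
  have ker: "\<exists>z\<in>carrier ?Z. FL P' P u i z = FD P i y \<and> homology_class F P' i z = \<one>\<^bsub>?H'\<^esub>"
    if y: "y \<in> carrier ?A" and one: "?pi y = \<one>\<^bsub>?H''\<^esub>" for y
  proof -
    have yS: "y \<in> carrier (FC P (Suc i))" "FL P P'' v (Suc i) y \<in> cycles F P'' (Suc i)" using y by (auto simp: SI)
    have "FL P P'' v (Suc i) y \<in> boundaries F P'' (Suc i)"
      using one homology_class_one_iff[OF P''_res yS(2)] by simp
    then obtain a c where a: "a \<in> carrier (FC P' (Suc i))" and c: "c \<in> carrier (FC P (Suc (Suc i)))"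
      and yac: "y = FD P (Suc i) c \<otimes>\<^bsub>FC P (Suc i)\<^esub> FL P' P u (Suc i) a"
      using correct_by_boundary[OF yS(1)] by blast
    interpret Ci: comm_group "FC P i" by (rule FC_comm_group[OF P_res])
    have "FD P i y = FD P i (FL P' P u (Suc i) a)"
      using FD_closed[OF P_res FL_closed[OF P'_res P_res u_lift a]]
      by (simp add: yac FD_mult[OF P_res FD_closed[OF P_res c] FL_closed[OF P'_res P_res u_lift a]] FD_FD[OF P_res c])
    then have "FL P' P u i (FD P' i a) = FD P i y" using FL_FD[OF P'_res P_res u_lift a] by simp
    moreover have "FD P' i a \<in> cycles F P' i" by (rule boundary_cycle[OF P'_res a])
    moreover have "homology_class F P' i (FD P' i a) = \<one>\<^bsub>?H'\<^esub>"
      using homology_class_one_iff[OF P'_res boundary_cycle[OF P'_res a]] a by (auto simp: boundaries_def)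
    ultimately show ?thesis by auto
  qed
  let ?d = "\<lambda>x. THE w. \<exists>y\<in>carrier ?A. \<exists>z\<in>carrier ?Z. ?pi y = x \<and> FL P' P u i z = FD P i y \<and> w = homology_class F P' i z"
  note conn = C.subgroup_comm_group[OF S] FC_comm_group[OF P_res] C'.subgroup_comm_group[OF cycles_subgroup[OF P'_res]]
    homology_comm_group[OF P''_res] homology_comm_group[OF P'_res] pi al p be onto inj pull ker
  have eq: "hconn i x = ?d x" if x: "x \<in> carrier ?H''" for x
  proof -
    obtain z where z: "z \<in> cycles F P'' (Suc i)" "x = homology_class F P'' (Suc i) z"
      using x by (auto simp: homology_carrier[OF P''_res])
    have "FL P P'' v (Suc i) b \<in> x \<longleftrightarrow> b \<in> S \<and> ?pi b = x" if "b \<in> carrier (FC P (Suc i))" for b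
      using mem_homology_class[OF P''_res z(1), of "FL P P'' v (Suc i) b"] that z(2) homology_class_self[OF P''_res]
      by (auto simp: SI)
    then have "(\<exists>b\<in>carrier (FC P (Suc i)). \<exists>a\<in>cycles F P' i. FL P P'' v (Suc i) b \<in> x \<and>
         FL P' P u i a = FD P i b \<and> Y = homology_class F P' i a) \<longleftrightarrow>
       (\<exists>y\<in>carrier ?A. \<exists>z\<in>carrier ?Z. ?pi y = x \<and> FL P' P u i z = FD P i y \<and> Y = homology_class F P' i z)" for Y
      by (auto simp: SI)
    then show ?thesis unfolding homology_connecting_def by simp
  qed
  show "hconn i \<in> hom ?H'' ?H'"
    by (rule hom_cong_on[OF homology_comm_group[OF P''_res] connecting_map_hom[OF conn] eq])
  show "hconn i (?pi b) = homology_class F P' i a"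
    if "b \<in> carrier (FC P (Suc i))" "FL P P'' v (Suc i) b \<in> cycles F P'' (Suc i)"
      "a \<in> cycles F P' i" "FL P' P u i a = FD P i b" for b a
  proof -
    have "hconn i (?pi b) = ?d (?pi b)" by (rule eq[OF homology_class_closed[OF P''_res that(2)]])
    also have "\<dots> = homology_class F P' i a" using that by (intro connecting_map_value[OF conn]) (simp_all add: SI)
    finally show ?thesis .
  qed
qed

lemma homology_exact_right:
  "exact_at (homology F P (Suc i)) (homology_map F P P'' v (Suc i)) (homology F P'' (Suc i)) (hconn i) (homology F P' i)"
proof (rule exact_atI)
  interpret C: comm_group "FC P (Suc i)" by (rule FC_comm_group[OF P_res])
  interpret C0: comm_group "FC P i" by (rule FC_comm_group[OF P_res])
  interpret C'': comm_group "FC P'' (Suc i)" by (rule FC_comm_group[OF P''_res])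
  show "hconn i (homology_map F P P'' v (Suc i) c) = \<one>\<^bsub>homology F P' i\<^esub>"
    if c: "c \<in> carrier (homology F P (Suc i))" for c
  proof -
    obtain z where z: "z \<in> cycles F P (Suc i)" "c = homology_class F P (Suc i) z"
      using c by (auto simp: homology_carrier[OF P_res])
    have "hconn i (homology_class F P'' (Suc i) (FL P P'' v (Suc i) z)) = homology_class F P' i \<one>\<^bsub>FC P' i\<^esub>"
      using z(1) subgroup.one_closed[OF cycles_subgroup[OF P'_res]] FL_one[OF P'_res P_res u_lift]
      by (intro hconn_class FL_cycle[OF P_res P''_res v_lift]) (auto simp: cycles_iff)
    then show ?thesis using z by (simp add: homology_map_class[OF P_res P''_res v_lift] homology_class_one[OF P'_res])
  qed
  fix c assume c: "c \<in> carrier (homology F P'' (Suc i))" and one: "hconn i c = \<one>\<^bsub>homology F P' i\<^esub>"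
  obtain x where x: "x \<in> cycles F P'' (Suc i)" "c = homology_class F P'' (Suc i) x"
    using c by (auto simp: homology_carrier[OF P''_res])
  obtain b where b: "b \<in> carrier (FC P (Suc i))" "x = FL P P'' v (Suc i) b"
    using Fv_onto[of "Suc i"] cycles_carrier[OF x(1)] by blast
  obtain a where a: "a \<in> cycles F P' i" "FL P' P u i a = FD P i b" using FD_liftable b x(1) by blast
  have "homology_class F P' i a = \<one>\<^bsub>homology F P' i\<^esub>"
    using hconn_class[OF b(1) _ a] x b(2) one by simp
  then obtain a1 where a1: "a1 \<in> carrier (FC P' (Suc i))" "a = FD P' i a1"
    using homology_class_one_iff[OF P'_res a(1)] by (auto simp: boundaries_def)
  note Fa1 = FL_closed[OF P'_res P_res u_lift a1(1)]
  let ?z = "b \<otimes>\<^bsub>FC P (Suc i)\<^esub> inv\<^bsub>FC P (Suc i)\<^esub> FL P' P u (Suc i) a1"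
  have "FD P i (FL P' P u (Suc i) a1) = FD P i b" using FL_FD[OF P'_res P_res u_lift a1(1)] a(2) a1(2) by simp
  then have z: "?z \<in> cycles F P (Suc i)"
    using b(1) Fa1 FD_closed[OF P_res b(1)] by (simp add: cycles_iff FD_mult[OF P_res] FD_inv[OF P_res])
  moreover have "FL P P'' v (Suc i) ?z = x"
    using b Fa1 FL_closed[OF P_res P''_res v_lift b(1)] by (simp add: FL_mult[OF P_res P''_res v_lift] FL_inv[OF P_res P''_res v_lift] Fv_Fu[OF a1(1)])
  ultimately have "c = homology_map F P P'' v (Suc i) (homology_class F P (Suc i) ?z)"
    using x by (simp add: homology_map_class[OF P_res P''_res v_lift])
  then show "\<exists>y\<in>carrier (homology F P (Suc i)). c = homology_map F P P'' v (Suc i) y"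
    using homology_class_closed[OF P_res z] by blast
qed (rule homology_comm_group[OF P'_res] homology_comm_group[OF P_res] homology_comm_group[OF P''_res]
    homology_map_hom[OF P_res P''_res v_lift] hconn_hom)+

lemma homology_exact_left:
  "exact_at (homology F P'' (Suc i)) (hconn i) (homology F P' i) (homology_map F P' P u i) (homology F P i)"
proof (rule exact_atI)
  show "homology_map F P' P u i (hconn i c) = \<one>\<^bsub>homology F P i\<^esub>"
    if c: "c \<in> carrier (homology F P'' (Suc i))" for c
  proof -
    obtain x where x: "x \<in> cycles F P'' (Suc i)" "c = homology_class F P'' (Suc i) x"
      using c by (auto simp: homology_carrier[OF P''_res])
    obtain b where b: "b \<in> carrier (FC P (Suc i))" "x = FL P P'' v (Suc i) b"
      using Fv_onto[of "Suc i"] cycles_carrier[OF x(1)] by blast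
    obtain a where a: "a \<in> cycles F P' i" "FL P' P u i a = FD P i b" using FD_liftable b x(1) by blast
    have "homology_map F P' P u i (hconn i c) = homology_class F P i (FD P i b)"
      using hconn_class[OF b(1) _ a] x b(2) a by (simp add: homology_map_class[OF P'_res P_res u_lift])
    also have "\<dots> = \<one>\<^bsub>homology F P i\<^esub>"
      using homology_class_one_iff[OF P_res boundary_cycle[OF P_res b(1)]] b(1) by (auto simp: boundaries_def)
    finally show ?thesis .
  qed
  fix c assume c: "c \<in> carrier (homology F P' i)" and one: "homology_map F P' P u i c = \<one>\<^bsub>homology F P i\<^esub>"
  obtain a where a: "a \<in> cycles F P' i" "c = homology_class F P' i a"
    using c by (auto simp: homology_carrier[OF P'_res])
  have "FL P' P u i a \<in> boundaries F P i"
    using one a homology_class_one_iff[OF P_res FL_cycle[OF P'_res P_res u_lift a(1)]] by (simp add: homology_map_class[OF P'_res P_res u_lift])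
  then obtain b where b: "b \<in> carrier (FC P (Suc i))" "FL P' P u i a = FD P i b" by (auto simp: boundaries_def)
  have bz: "FL P P'' v (Suc i) b \<in> cycles F P'' (Suc i)"
    using FL_closed[OF P_res P''_res v_lift b(1)] FL_FD[OF P_res P''_res v_lift b(1)] Fv_Fu[OF cycles_carrier[OF a(1)]] b(2)
    by (simp add: cycles_iff)
  have "c = hconn i (homology_class F P'' (Suc i) (FL P P'' v (Suc i) b))"
    using hconn_class[OF b(1) bz a(1) b(2)] a(2) by simp
  then show "\<exists>x\<in>carrier (homology F P'' (Suc i)). c = hconn i x"
    using homology_class_closed[OF P''_res bz] by blast
qed (rule homology_comm_group[OF P'_res] homology_comm_group[OF P_res] homology_comm_group[OF P''_res]
    homology_map_hom[OF P'_res P_res u_lift] hconn_hom)+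

end

end

section \<open>Left derived functors\<close>

text \<open>Exactness is checked on images and kernels; hence a group may be replaced by another one along a
  surjection (for the source), a surjection compatible with both maps (for the middle), or an
  injection (for the target).\<close>

lemma exact_at_transfer_source:
  assumes ex: "exact_at A f B g C" and A2: "comm_group A2" and f2: "f2 \<in> hom A2 B"
    and h: "h ` carrier A = carrier A2" "\<And>x. x \<in> carrier A \<Longrightarrow> f2 (h x) = f x"
  shows "exact_at A2 f2 B g C"
proof -
  have "f2 ` carrier A2 = f ` carrier A" unfolding h(1)[symmetric] using h(2) by (force simp: image_image)
  then show ?thesis using ex A2 f2 by (simp add: exact_at_def)
qed

lemma exact_at_transfer_middle:
  assumes ex: "exact_at A f B g C" and B2: "comm_group B2" and f2: "f2 \<in> hom A B2" and g2: "g2 \<in> hom B2 C"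
    and h: "h ` carrier B = carrier B2" "\<And>x. x \<in> carrier A \<Longrightarrow> f2 x = h (f x)"
      "\<And>y. y \<in> carrier B \<Longrightarrow> g2 (h y) = g y"
  shows "exact_at A f2 B2 g2 C"
proof (rule exact_atI)
  show "comm_group A" "comm_group C" using ex by (auto simp: exact_at_def)
  have im: "f ` carrier A = kernel B C g" and f: "f \<in> hom A B" using ex by (auto simp: exact_at_def)
  show "g2 (f2 x) = \<one>\<^bsub>C\<^esub>" if "x \<in> carrier A" for x
  proof -
    have "f x \<in> kernel B C g" unfolding im[symmetric] using that by (rule imageI)
    then show ?thesis using h(2,3) that by (simp add: mem_kernel)
  qed
  show "\<exists>x\<in>carrier A. y = f2 x" if y: "y \<in> carrier B2" "g2 y = \<one>\<^bsub>C\<^esub>" for y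
  proof -
    obtain b where b: "b \<in> carrier B" "y = h b" using y(1) h(1) by blast
    then have "b \<in> f ` carrier A" unfolding im mem_kernel using y(2) h(3) by simp
    then show ?thesis using b h(2) by auto
  qed
qed (fact B2 f2 g2)+

lemma exact_at_transfer_target:
  assumes ex: "exact_at A f B g C" and C2: "comm_group C2" and g2: "g2 \<in> hom B C2"
    and h: "h \<in> hom C C2" "inj_on h (carrier C)" "\<And>y. y \<in> carrier B \<Longrightarrow> g2 y = h (g y)"
  shows "exact_at A f B g2 C2"
proof -
  have C: "comm_group C" and g: "g \<in> hom B C" using ex by (auto simp: exact_at_def)
  interpret C: comm_group C by fact
  have "g2 y = \<one>\<^bsub>C2\<^esub> \<longleftrightarrow> g y = \<one>\<^bsub>C\<^esub>" if "y \<in> carrier B" for y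
    using h(3)[OF that] inj_on_eq_iff[OF h(2) hom_in_carrier[OF g that] C.one_closed]
      comm_group_hom_one[OF C C2 h(1)] by simp
  then have "kernel B C2 g2 = kernel B C g" by (auto simp: kernel_def)
  then show ?thesis using ex C2 g2 by (simp add: exact_at_def)
qed

lemma exact_at_restrict_target:
  assumes ex: "exact_at A f B g C" and S: "subgroup S C" and im: "\<And>y. y \<in> carrier B \<Longrightarrow> g y \<in> S"
  shows "exact_at A f B g (C\<lparr>carrier := S\<rparr>)"
proof -
  have "comm_group C" "g \<in> hom B C" using ex by (auto simp: exact_at_def)
  then have "comm_group (C\<lparr>carrier := S\<rparr>)" "g \<in> hom B (C\<lparr>carrier := S\<rparr>)"
    using comm_group.subgroup_comm_group[OF _ S] im by (auto simp: hom_def)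
  then show ?thesis using ex by (simp add: exact_at_def kernel_def)
qed

lemma exact_at_restrict_middle:
  assumes ex: "exact_at A f B g C" and S: "subgroup S B" and T: "subgroup T C"
    and ker: "\<And>y. \<lbrakk>y \<in> carrier B; g y = \<one>\<^bsub>C\<^esub>\<rbrakk> \<Longrightarrow> y \<in> S" and im: "\<And>y. y \<in> S \<Longrightarrow> g y \<in> T"
  shows "exact_at A f (B\<lparr>carrier := S\<rparr>) g (C\<lparr>carrier := T\<rparr>)"
proof (rule exact_atI)
  note ex = ex[unfolded exact_at_def]
  show "comm_group A" using ex by blast
  show "comm_group (B\<lparr>carrier := S\<rparr>)" "comm_group (C\<lparr>carrier := T\<rparr>)"
    using ex comm_group.subgroup_comm_group S T by blast+
  have fx: "f x \<in> carrier B \<and> g (f x) = \<one>\<^bsub>C\<^esub>" if "x \<in> carrier A" for x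
  proof -
    have "f x \<in> kernel B C g" using ex imageI[OF that, of f] by simp
    then show ?thesis by (simp add: mem_kernel)
  qed
  show "f \<in> hom A (B\<lparr>carrier := S\<rparr>)" using ex fx ker by (auto simp: hom_def)
  show "g \<in> hom (B\<lparr>carrier := S\<rparr>) (C\<lparr>carrier := T\<rparr>)"
    using ex im subgroup.mem_carrier[OF S] by (auto simp: hom_def)
  show "g (f x) = \<one>\<^bsub>C\<lparr>carrier := T\<rparr>\<^esub>" if "x \<in> carrier A" for x using fx[OF that] by simp
  show "\<exists>x\<in>carrier A. y = f x"
    if "y \<in> carrier (B\<lparr>carrier := S\<rparr>)" "g y = \<one>\<^bsub>C\<lparr>carrier := T\<rparr>\<^esub>" for y
  proof -
    have "y \<in> kernel B C g" using that subgroup.mem_carrier[OF S] by (simp add: mem_kernel)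
    then show ?thesis using ex by blast
  qed
qed

context right_exact_functor begin

abbreviation "CR \<equiv> chosen_resolution R"

lemma chosen_resolution:
  fixes M :: "('r, 'm) module"
  assumes "lm M" shows "projective_resolution R M (CR M)"
  unfolding chosen_resolution_def using ex_projective_resolution[OF assms] by (rule someI_ex)

lemma ex_Lder_map:
  fixes M N :: "('r, 'm) module"
  assumes "lm M" "lm N" "f \<in> lin_hom R M N"
  shows "\<exists>\<phi>. projective_lift R f M (CR M) (CR N) \<phi> \<and>
     (\<forall>i. Lder_map R F i M N f = homology_map F (CR M) (CR N) \<phi> i)"
proof (intro exI conjI allI)
  let ?\<phi> = "SOME \<phi>. projective_lift R f M (CR M) (CR N) \<phi>"
  show "projective_lift R f M (CR M) (CR N) ?\<phi>"
    by (rule someI_ex[OF ex_projective_lift[OF chosen_resolution[OF assms(1)] chosen_resolution[OF assms(2)] assms(3)]])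
  show "Lder_map R F i M N f = homology_map F (CR M) (CR N) ?\<phi> i" for i
    unfolding Lder_map_def homology_map_def Let_def ..
qed

lemma ex_Lder_connecting:
  fixes B' B B'' :: "('r, 'm) module"
  assumes ses: "short_exact R B' f B g B''"
  shows "\<exists>P u v. projective_horseshoe R B' f B g B'' (CR B') u P v (CR B'') \<and>
     (\<forall>i. Lder_connecting R F i B' f B g B'' = homology_connecting F (CR B') u P v (CR B'') i)"
proof -
  let ?H = "\<lambda>(P, u, v). projective_horseshoe R B' f B g B'' (CR B') u P v (CR B'')"
  obtain P u v where Puv: "(SOME x. ?H x) = (P, u, v)" by (metis prod_cases3)
  have "\<exists>x. ?H x"
    using ex_projective_horseshoe[OF ses chosen_resolution chosen_resolution] short_exactD(1,3)[OF ses] by auto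
  then have "?H (SOME x. ?H x)" by (rule someI_ex)
  then have "projective_horseshoe R B' f B g B'' (CR B') u P v (CR B'')" unfolding Puv by simp
  moreover have "Lder_connecting R F i B' f B g B'' = homology_connecting F (CR B') u P v (CR B'') i" for i
    unfolding Lder_connecting_def homology_connecting_def Let_def Puv by simp
  ultimately show ?thesis by blast
qed

text \<open>The horseshoe resolution \<open>P\<close> of \<open>B\<close> is exchanged for the chosen one along a lift \<open>h\<close> of the identity.
  Up to homotopy, \<open>\<phi>\<close> is \<open>h u\<close> and \<open>\<psi> h\<close> is \<open>v\<close>.\<close>

lemma Lder_exact:
  fixes B' B B'' :: "('r, 'm) module"
  assumes ses: "short_exact R B' f B g B''"
  shows Lder_exact_middle: "exact_at (Lder R F i B') (Lder_map R F i B' B f) (Lder R F i B)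
           (Lder_map R F i B B'' g) (Lder R F i B'')"
    and Lder_exact_right: "exact_at (Lder R F (Suc i) B) (Lder_map R F (Suc i) B B'' g)
           (Lder R F (Suc i) B'') (Lder_connecting R F i B' f B g B'') (Lder R F i B')"
    and Lder_exact_left: "exact_at (Lder R F (Suc i) B'') (Lder_connecting R F i B' f B g B'')
           (Lder R F i B') (Lder_map R F i B' B f) (Lder R F i B)"
proof -
  note s = short_exactD[OF ses]
  note C' = chosen_resolution[OF s(1)] and C = chosen_resolution[OF s(2)] and C'' = chosen_resolution[OF s(3)]
  obtain P u v where hs: "projective_horseshoe R B' f B g B'' (CR B') u P v (CR B'')"
    and conn: "\<And>i. Lder_connecting R F i B' f B g B'' = homology_connecting F (CR B') u P v (CR B'') i"
    using ex_Lder_connecting[OF ses] by blast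
  note P = horseshoe_res(2)[OF hs] and u = horseshoe_lift(1)[OF hs] and v = horseshoe_lift(2)[OF hs]
  obtain \<phi> where \<phi>: "projective_lift R f B' (CR B') (CR B) \<phi>"
    and Lf: "\<And>i. Lder_map R F i B' B f = homology_map F (CR B') (CR B) \<phi> i"
    using ex_Lder_map[OF s(1,2,4)] by blast
  obtain \<psi> where \<psi>: "projective_lift R g B (CR B) (CR B'') \<psi>"
    and Lg: "\<And>i. Lder_map R F i B B'' g = homology_map F (CR B) (CR B'') \<psi> i"
    using ex_Lder_map[OF s(2,3,5)] by blast
  obtain h where h: "projective_lift R id B P (CR B) h" using ex_projective_lift[OF P C lin_hom_id] by blast
  have hu: "homology_map F (CR B') (CR B) \<phi> i c = homology_map F P (CR B) h i (homology_map F (CR B') P u i c)"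
    if "c \<in> carrier (homology F (CR B') i)" for c i
    using homology_map_comp[OF C' P C u h \<phi> _ that] by simp
  have vh: "homology_map F (CR B) (CR B'') \<psi> i (homology_map F P (CR B) h i c) = homology_map F P (CR B'') v i c"
    if "c \<in> carrier (homology F P i)" for c i
    using homology_map_comp[OF P C C'' h \<psi> v _ that] by simp
  have onto: "homology_map F P (CR B) h i ` carrier (homology F P i) = carrier (homology F (CR B) i)"
    and inj: "inj_on (homology_map F P (CR B) h i) (carrier (homology F P i))" for i
    using homology_map_bij[OF P C h] by (auto simp: bij_betw_def)
  note defs = Lder_def Lf Lg conn
  show "exact_at (Lder R F i B') (Lder_map R F i B' B f) (Lder R F i B) (Lder_map R F i B B'' g) (Lder R F i B'')"
    unfolding defs
    by (rule exact_at_transfer_middle[OF homology_exact_middle[OF hs] homology_comm_group[OF C]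
          homology_map_hom[OF C' C \<phi>] homology_map_hom[OF C C'' \<psi>] onto hu vh])
  show "exact_at (Lder R F (Suc i) B) (Lder_map R F (Suc i) B B'' g)
           (Lder R F (Suc i) B'') (Lder_connecting R F i B' f B g B'') (Lder R F i B')"
    unfolding defs
    by (rule exact_at_transfer_source[OF homology_exact_right[OF hs] homology_comm_group[OF C]
          homology_map_hom[OF C C'' \<psi>] onto vh])
  show "exact_at (Lder R F (Suc i) B'') (Lder_connecting R F i B' f B g B'')
           (Lder R F i B') (Lder_map R F i B' B f) (Lder R F i B)"
    unfolding defs
    by (rule exact_at_transfer_target[OF homology_exact_left[OF hs] homology_comm_group[OF C]
          homology_map_hom[OF C' C \<phi>] homology_map_hom[OF P C h] inj hu])
qed

context
  fixes M :: "('r, 'm) module" assumes M: "lm M"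
begin

lemmas CR_M = chosen_resolution[OF M]
lemmas CR_trm = resolution_trm[OF CR_M]
lemmas CR_aug = resolution_aug[OF CR_M]

text \<open>Right exactness on the beginning \<open>P\<^sub>1 \<rightarrow> P\<^sub>0 \<rightarrow> M \<rightarrow> 0\<close> of the resolution identifies \<open>L\<^sub>0F(M)\<close> with \<open>F(M)\<close>.\<close>

lemma F_aug_exact:
  "FD (CR M) 0 ` carrier (FC (CR M) (Suc 0)) = kernel (FC (CR M) 0) (fobj F M) (fmap F (trm (CR M) 0) M (aug (CR M)))"
  "fmap F (trm (CR M) 0) M (aug (CR M)) ` carrier (FC (CR M) 0) = carrier (fobj F M)"
  using F_right_exact[OF CR_trm CR_trm M resolution_dif[OF CR_M] CR_aug _ resolution_aug_onto[OF CR_M]]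
    CR_M by (simp_all add: projective_resolution_def)

lemma Lder0_to_F_class:
  assumes z: "z \<in> carrier (FC (CR M) 0)"
  shows "Lder0_to_F R F M (homology_class F (CR M) 0 z) = fmap F (trm (CR M) 0) M (aug (CR M)) z"
    (is "_ = ?a z")
proof -
  interpret FM: comm_group "fobj F M" by (rule F_comm_group[OF M])
  have zc: "z \<in> cycles F (CR M) 0" using z by (simp add: cycles_iff)
  have const: "?a w = ?a z" if w: "w \<in> homology_class F (CR M) 0 z" for w
  proof -
    obtain x where x: "x \<in> carrier (FC (CR M) (Suc 0))" "w = FD (CR M) 0 x \<otimes>\<^bsub>FC (CR M) 0\<^esub> z"
      using mem_homology_class[OF CR_M zc w] by (auto simp: boundaries_def)
    have "FD (CR M) 0 x \<in> kernel (FC (CR M) 0) (fobj F M) ?a"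
      unfolding F_aug_exact(1)[symmetric] using x(1) by (rule imageI)
    then show ?thesis
      using z F_closed[OF CR_trm M CR_aug z] by (simp add: x(2) mem_kernel F_mult[OF CR_trm M CR_aug])
  qed
  show ?thesis
    unfolding Lder0_to_F_def Let_def
  proof (rule the_equality)
    show "\<exists>w\<in>homology_class F (CR M) 0 z. ?a z = ?a w"
      using homology_class_self[OF CR_M zc] by blast
    show "y = ?a z" if "\<exists>w\<in>homology_class F (CR M) 0 z. y = ?a w" for y
      using that const by (elim bexE) simp
  qed
qed

lemma Lder0_to_F_hom: "Lder0_to_F R F M \<in> hom (Lder R F 0 M) (fobj F M)"
  unfolding Lder_def
  by (rule homI)
    (auto simp: homology_carrier[OF CR_M] homology_mult[OF CR_M] cycles_iff Lder0_to_F_class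
      F_closed[OF CR_trm M CR_aug] F_mult[OF CR_trm M CR_aug] monoid.m_closed[OF comm_group.axioms(2)[THEN group.is_monoid, OF FC_comm_group[OF CR_M]]])

lemma Lder0_to_F_bij:
  "Lder0_to_F R F M ` carrier (Lder R F 0 M) = carrier (fobj F M)"
  "inj_on (Lder0_to_F R F M) (carrier (Lder R F 0 M))"
proof -
  show "Lder0_to_F R F M ` carrier (Lder R F 0 M) = carrier (fobj F M)"
    unfolding Lder_def homology_carrier[OF CR_M] F_aug_exact(2)[symmetric]
    by (simp add: image_image cycles_iff Lder0_to_F_class cong: image_cong_simp) (simp add: cycles_def Lder0_to_F_class)
  interpret group_hom "Lder R F 0 M" "fobj F M" "Lder0_to_F R F M"
    using homology_comm_group[OF CR_M] F_comm_group[OF M] Lder0_to_F_hom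
    by (simp add: group_hom_def group_hom_axioms_def comm_group.axioms(2) Lder_def)
  show "inj_on (Lder0_to_F R F M) (carrier (Lder R F 0 M))"
    unfolding inj_on_one_iff
  proof (intro allI impI)
    fix c assume c: "c \<in> carrier (Lder R F 0 M)" "Lder0_to_F R F M c = \<one>\<^bsub>fobj F M\<^esub>"
    obtain z where z: "z \<in> cycles F (CR M) 0" "c = homology_class F (CR M) 0 z"
      using c by (auto simp: Lder_def homology_carrier[OF CR_M])
    then have "z \<in> boundaries F (CR M) 0"
      using c(2) unfolding boundaries_def F_aug_exact(1) mem_kernel by (simp add: cycles_iff Lder0_to_F_class)
    then show "c = \<one>\<^bsub>Lder R F 0 M\<^esub>"
      using homology_class_one_iff[OF CR_M z(1)] z(2) by (simp add: Lder_def)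
  qed
qed

end

lemma Lder0_to_F_natural:
  fixes M N :: "('r, 'm) module"
  assumes M: "lm M" and N: "lm N" and f: "f \<in> lin_hom R M N" and c: "c \<in> carrier (Lder R F 0 M)"
  shows "Lder0_to_F R F N (Lder_map R F 0 M N f c) = fmap F M N f (Lder0_to_F R F M c)"
proof -
  note CM = chosen_resolution[OF M] and CN = chosen_resolution[OF N]
  obtain \<phi> where \<phi>: "projective_lift R f M (CR M) (CR N) \<phi>"
    and Lf: "Lder_map R F 0 M N f = homology_map F (CR M) (CR N) \<phi> 0"
    using ex_Lder_map[OF M N f] by blast
  obtain z where z: "z \<in> cycles F (CR M) 0" "c = homology_class F (CR M) 0 z"
    using c by (auto simp: Lder_def homology_carrier[OF CM])
  have zc: "z \<in> carrier (FC (CR M) 0)" using z(1) by (simp add: cycles_iff)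
  have "fmap F (trm (CR N) 0) N (aug (CR N)) (FL (CR M) (CR N) \<phi> 0 z)
      = fmap F M N f (fmap F (trm (CR M) 0) M (aug (CR M)) z)"
    by (rule F_square[OF resolution_trm[OF CM] resolution_trm[OF CN] M N projective_lift_lin_hom[OF \<phi>]
          resolution_aug[OF CN] resolution_aug[OF CM] f _ zc])
      (use \<phi> in \<open>simp add: projective_lift_def\<close>)
  then show ?thesis
    using FL_closed[OF CM CN \<phi> zc] zc
    by (simp add: Lf z(2) homology_map_class[OF CM CN \<phi> z(1)] Lder0_to_F_class[OF N] Lder0_to_F_class[OF M])
qed

text \<open>The sequence \<open>L\<^sub>1F(B) \<rightarrow> L\<^sub>1F(B'') \<rightarrow> L\<^sub>0F(B') \<rightarrow> L\<^sub>0F(B)\<close>, with \<open>L\<^sub>0F\<close> replaced by \<open>F\<close> along the natural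
  isomorphism.\<close>

lemma L1_connecting_exact:
  fixes B' B B'' :: "('r, 'm) module"
  assumes ses: "short_exact R B' f B g B''"
  shows "exact_at (Lder R F 1 B) (Lder_map R F 1 B B'' g) (Lder R F 1 B'') (L1_connecting R F B' f B g B'') (fobj F B')"
    and "exact_at (Lder R F 1 B'') (L1_connecting R F B' f B g B'') (fobj F B') (fmap F B' B f) (fobj F B)"
proof -
  note s = short_exactD[OF ses]
  note right = Lder_exact_right[OF ses, of 0, folded One_nat_def]
    and left = Lder_exact_left[OF ses, of 0, folded One_nat_def]
  have conn: "Lder_connecting R F 0 B' f B g B'' \<in> hom (Lder R F 1 B'') (Lder R F 0 B')"
    and Lf: "Lder_map R F 0 B' B f \<in> hom (Lder R F 0 B') (Lder R F 0 B)"
    using left by (simp_all add: exact_at_def)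
  have L1: "L1_connecting R F B' f B g B'' \<in> hom (Lder R F 1 B'') (fobj F B')"
    unfolding L1_connecting_def by (rule hom_compose[OF conn Lder0_to_F_hom[OF s(1)]])
  show "exact_at (Lder R F 1 B) (Lder_map R F 1 B B'' g) (Lder R F 1 B'') (L1_connecting R F B' f B g B'') (fobj F B')"
    by (rule exact_at_transfer_target[OF right F_comm_group[OF s(1)] L1 Lder0_to_F_hom[OF s(1)] Lder0_to_F_bij(2)[OF s(1)]])
      (simp add: L1_connecting_def)
  have "Lder0_to_F R F B \<circ> Lder_map R F 0 B' B f \<in> hom (Lder R F 0 B') (fobj F B)"
    by (rule hom_compose[OF Lf Lder0_to_F_hom[OF s(2)]])
  then have "exact_at (Lder R F 1 B'') (Lder_connecting R F 0 B' f B g B'') (Lder R F 0 B')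
      (Lder0_to_F R F B \<circ> Lder_map R F 0 B' B f) (fobj F B)"
    by (rule exact_at_transfer_target[OF left F_comm_group[OF s(2)] _ Lder0_to_F_hom[OF s(2)] Lder0_to_F_bij(2)[OF s(2)]])
      simp
  then show "exact_at (Lder R F 1 B'') (L1_connecting R F B' f B g B'') (fobj F B') (fmap F B' B f) (fobj F B)"
    by (rule exact_at_transfer_middle[OF _ F_comm_group[OF s(1)] L1 F_hom[OF s(1,2,4)] Lder0_to_F_bij(1)[OF s(1)]])
      (simp_all add: L1_connecting_def Lder0_to_F_natural[OF s(1,2,4)])
qed

end

section \<open>Cosyzygies\<close>

text \<open>Columns exact at the terms in the middle and below, with injective \<open>e''\<close>, and exact upper two rows make
  the lowest row exact. This passes from one cosyzygy to the next.\<close>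

lemma three_by_three:
  assumes ses: "short_exact R S' a S b S''" and sesI: "short_exact R I' p I q I''"
    and lm: "left_module R T'" "left_module R T" "left_module R T''"
    and e: "e' \<in> lin_hom R S' I'" "e \<in> lin_hom R S I" "e'' \<in> lin_hom R S'' I''"
    and d: "d' \<in> lin_hom R I' T'" "d \<in> lin_hom R I T" "d'' \<in> lin_hom R I'' T''"
    and t: "t \<in> lin_hom R T' T" "s \<in> lin_hom R T T''"
    and inj: "inj_on e'' (carrier S'')"
    and ex: "e' ` carrier S' = a_kernel I' T' d'" "e ` carrier S = a_kernel I T d" "e'' ` carrier S'' = a_kernel I'' T'' d''"
    and onto: "d' ` carrier I' = carrier T'" "d ` carrier I = carrier T" "d'' ` carrier I'' = carrier T''"
    and comm: "\<And>x. x \<in> carrier S' \<Longrightarrow> p (e' x) = e (a x)" "\<And>x. x \<in> carrier S \<Longrightarrow> q (e x) = e'' (b x)"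
      "\<And>z. z \<in> carrier I' \<Longrightarrow> t (d' z) = d (p z)" "\<And>y. y \<in> carrier I \<Longrightarrow> s (d y) = d'' (q y)"
  shows "short_exact R T' t T s T''"
proof -
  note s = short_exactD[OF ses] and i = short_exactD[OF sesI]
  interpret I: left_module R I by (rule i(2))
  interpret I'': left_module R I'' by (rule i(3))
  interpret T': left_module R T' by (rule lm)
  interpret T: left_module R T by (rule lm)
  have de: "d' (e' x) = \<zero>\<^bsub>T'\<^esub>" if "x \<in> carrier S'" for x
    using ex(1) imageI[OF that, of e'] mem_a_kernel[of "e' x" I' T' d'] by simp
  have de2: "d (e x) = \<zero>\<^bsub>T\<^esub>" if "x \<in> carrier S" for x
    using ex(2) imageI[OF that, of e] mem_a_kernel[of "e x" I T d] by simp
  have tzero: "w = \<zero>\<^bsub>T'\<^esub>" if w: "w \<in> carrier T'" "t w = \<zero>\<^bsub>T\<^esub>" for w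
  proof -
    obtain z where z: "z \<in> carrier I'" "w = d' z" using w(1) onto(1) by blast
    have pz: "p z \<in> carrier I" by (rule lin_hom_closed[OF i(4) z(1)])
    have "p z \<in> e ` carrier S" unfolding ex(2) mem_a_kernel using pz w(2) z comm(3)[OF z(1)] by simp
    then obtain y where y: "y \<in> carrier S" "p z = e y" by blast
    have "e'' (b y) = \<zero>\<^bsub>I''\<^esub>" using comm(2)[OF y(1)] i(8)[OF z(1)] y(2) by simp
    then have "b y = \<zero>\<^bsub>S''\<^esub>" by (rule inj_zero[OF s(3) i(3) e(3) inj lin_hom_closed[OF s(5) y(1)]])
    then obtain x where x: "x \<in> carrier S'" "y = a x" using s(9)[OF y(1)] by blast
    have "p z = p (e' x)" using comm(1)[OF x(1)] x(2) y(2) by simp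
    then have "z = e' x" using i(6) z(1) lin_hom_closed[OF e(1) x(1)] by (simp add: inj_on_def)
    then show ?thesis using z(2) de[OF x(1)] by simp
  qed
  have tinj: "inj_on t (carrier T')"
  proof (rule inj_onI)
    fix x y assume xy: "x \<in> carrier T'" "y \<in> carrier T'" "t x = t y"
    have "t (x \<ominus>\<^bsub>T'\<^esub> y) = \<zero>\<^bsub>T\<^esub>"
      using lin_hom_diff[OF lm(1,2) t(1) xy(1,2)] lin_hom_closed[OF t(1)] xy by (simp add: T.diff_eq_zero)
    then show "x = y" using tzero[of "x \<ominus>\<^bsub>T'\<^esub> y"] xy by (simp add: T'.diff_eq_zero)
  qed
  have sonto: "s ` carrier T = carrier T''"
  proof (intro equalityI subsetI)
    fix w assume "w \<in> carrier T''"
    then have "w \<in> d'' ` q ` carrier I" unfolding i(7) onto(3) .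
    then obtain y where y: "y \<in> carrier I" "w = d'' (q y)" by blast
    then have "w = s (d y)" using comm(4) by simp
    then show "w \<in> s ` carrier T" using lin_hom_closed[OF d(2) y(1)] by blast
  next
    fix w assume "w \<in> s ` carrier T" then show "w \<in> carrier T''" using lin_hom_closed[OF t(2)] by blast
  qed
  have "t ` carrier T' = a_kernel T T'' s"
  proof (intro equalityI subsetI)
    fix w assume "w \<in> t ` carrier T'"
    then have "w \<in> t ` d' ` carrier I'" unfolding onto(1) .
    then obtain z where z: "z \<in> carrier I'" "w = t (d' z)" by blast
    have pz: "p z \<in> carrier I" by (rule lin_hom_closed[OF i(4) z(1)])
    have "s w = \<zero>\<^bsub>T''\<^esub>"
      using comm(3)[OF z(1)] comm(4)[OF pz] i(8)[OF z(1)] lin_hom_zero[OF i(3) lm(3) d(3)] z(2) by simp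
    then show "w \<in> a_kernel T T'' s"
      unfolding mem_a_kernel using z lin_hom_closed[OF t(1) lin_hom_closed[OF d(1) z(1)]] by simp
  next
    fix w assume "w \<in> a_kernel T T'' s"
    then have w: "w \<in> carrier T" "s w = \<zero>\<^bsub>T''\<^esub>" by (simp_all add: mem_a_kernel)
    obtain y where y: "y \<in> carrier I" "w = d y" using w(1) onto(2) by blast
    have qy: "q y \<in> carrier I''" by (rule lin_hom_closed[OF i(5) y(1)])
    have "q y \<in> e'' ` carrier S''" unfolding ex(3) mem_a_kernel using qy w(2) comm(4)[OF y(1)] y(2) by simp
    then have "q y \<in> e'' ` b ` carrier S" unfolding s(7) .
    then obtain x where x: "x \<in> carrier S" "q y = e'' (b x)" by blast
    have ex: "e x \<in> carrier I" by (rule lin_hom_closed[OF e(2) x(1)])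
    have "q (y \<ominus>\<^bsub>I\<^esub> e x) = \<zero>\<^bsub>I''\<^esub>"
      using lin_hom_diff[OF i(2,3,5) y(1) ex] comm(2)[OF x(1)] x(2) qy by (simp add: I''.diff_eq_zero)
    then obtain z where z: "z \<in> carrier I'" "y \<ominus>\<^bsub>I\<^esub> e x = p z" using i(9)[of "y \<ominus>\<^bsub>I\<^esub> e x"] y(1) ex by auto
    have "t (d' z) = d y \<ominus>\<^bsub>T\<^esub> d (e x)"
      using comm(3)[OF z(1)] z(2)[symmetric] lin_hom_diff[OF i(2) lm(2) d(2) y(1) ex] by simp
    also have "\<dots> = w" using w(1) de2[OF x(1)] y(2) by (simp add: T.M.minus_eq)
    finally show "w \<in> t ` carrier T'" using lin_hom_closed[OF d(1) z(1)] by blast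
  qed
  then show ?thesis unfolding short_exact_def using lm t tinj sonto by blast
qed

lemma
  assumes J: "injective_resolution R M J"
  shows injres_module: "left_module R M"
    and injres_injective: "\<And>i. injective_module R (trm J i)"
    and injres_trm: "\<And>i. left_module R (trm J i)"
    and injres_dif: "\<And>i. dif J i \<in> lin_hom R (trm J i) (trm J (Suc i))"
    and injres_aug: "aug J \<in> lin_hom R M (trm J 0)"
  using J unfolding injective_resolution_def injective_module_def by simp+

lemma cosyzygy_simps [simp]:
  "cosyzygy M J 0 = M" "cosyzygy M J (Suc j) = (trm J (Suc j))\<lparr>carrier := dif J j ` carrier (trm J j)\<rparr>"
  "cosyzygy_emb J 0 = aug J" "cosyzygy_emb J (Suc j) = id"
  "cosyzygy_map f u 0 = f" "cosyzygy_map f u (Suc j) = u (Suc j)"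
  by (simp_all add: cosyzygy_def cosyzygy_emb_def cosyzygy_map_def)

lemma cosyzygy_facts:
  assumes J: "injective_resolution R M J"
  shows cosyzygy_module: "left_module R (cosyzygy M J j)"
    and cosyzygy_emb: "cosyzygy_emb J j \<in> lin_hom R (cosyzygy M J j) (trm J j)"
    and cosyzygy_emb_inj: "inj_on (cosyzygy_emb J j) (carrier (cosyzygy M J j))"
    and cosyzygy_emb_image: "cosyzygy_emb J j ` carrier (cosyzygy M J j) = a_kernel (trm J j) (trm J (Suc j)) (dif J j)"
    and cosyzygy_dif: "dif J j \<in> lin_hom R (trm J j) (cosyzygy M J (Suc j))"
    and cosyzygy_dif_onto: "dif J j ` carrier (trm J j) = carrier (cosyzygy M J (Suc j))"
    and cosyzygy_kernel: "cosyzygy_emb J j ` carrier (cosyzygy M J j) = a_kernel (trm J j) (cosyzygy M J (Suc j)) (dif J j)"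
    and cosyzygy_copresentation: "injective_copresentation R (cosyzygy M J j) (cosyzygy_emb J j) (trm J j) (dif J j) (trm J (Suc j))"
proof -
  note t = injres_trm[OF J] and dif = injres_dif[OF J]
  note J' = J[unfolded injective_resolution_def One_nat_def]
  have im: "dif J j ` carrier (trm J j) \<subseteq> carrier (trm J (Suc j))" for j
    using lin_hom_closed[OF dif] by blast
  show S: "left_module R (cosyzygy M J j)"
  proof (cases j)
    case (Suc k)
    then show ?thesis using image_left_module[OF t t dif] by simp
  qed (simp add: injres_module[OF J])
  show e: "cosyzygy_emb J j \<in> lin_hom R (cosyzygy M J j) (trm J j)"
  proof (cases j)
    case (Suc k)
    then show ?thesis using lin_hom_from_submodule[OF lin_hom_id im] by simp
  qed (simp add: injres_aug[OF J])
  show inj: "inj_on (cosyzygy_emb J j) (carrier (cosyzygy M J j))"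
  proof (cases j)
    case 0
    have "inj_on (aug J) (carrier M)" using J' by blast
    then show ?thesis using 0 by simp
  qed simp
  show ex: "cosyzygy_emb J j ` carrier (cosyzygy M J j) = a_kernel (trm J j) (trm J (Suc j)) (dif J j)"
  proof (cases j)
    case 0
    have "aug J ` carrier M = a_kernel (trm J 0) (trm J (Suc 0)) (dif J 0)" using J' by blast
    then show ?thesis using 0 by simp
  next
    case (Suc k)
    have "dif J k ` carrier (trm J k) = a_kernel (trm J (Suc k)) (trm J (Suc (Suc k))) (dif J (Suc k))" using J' by blast
    then show ?thesis using Suc by simp
  qed
  show "dif J j \<in> lin_hom R (trm J j) (cosyzygy M J (Suc j))"
    using lin_hom_into_submodule[OF dif] by simp
  show "dif J j ` carrier (trm J j) = carrier (cosyzygy M J (Suc j))" by simp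
  show "cosyzygy_emb J j ` carrier (cosyzygy M J j) = a_kernel (trm J j) (cosyzygy M J (Suc j)) (dif J j)"
    unfolding ex by (simp add: a_kernel_def')
  show "injective_copresentation R (cosyzygy M J j) (cosyzygy_emb J j) (trm J j) (dif J j) (trm J (Suc j))"
    unfolding injective_copresentation_def using S e inj ex dif injres_injective[OF J] by blast
qed

lemma
  assumes J: "injective_resolution R M J" and K: "injective_resolution R N K" and f: "f \<in> lin_hom R M N"
    and \<phi>: "injective_extension R f M J K \<phi>"
  shows cosyzygy_map: "cosyzygy_map f \<phi> j \<in> lin_hom R (cosyzygy M J j) (cosyzygy N K j)"
    and cosyzygy_map_emb: "x \<in> carrier (cosyzygy M J j) \<Longrightarrow>
          \<phi> j (cosyzygy_emb J j x) = cosyzygy_emb K j (cosyzygy_map f \<phi> j x)"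
    and cosyzygy_map_dif: "z \<in> carrier (trm J j) \<Longrightarrow>
          cosyzygy_map f \<phi> (Suc j) (dif J j z) = dif K j (\<phi> j z)"
    and injective_extension_lin_hom: "\<phi> j \<in> lin_hom R (trm J j) (trm K j)"
proof -
  note e = \<phi>[unfolded injective_extension_def]
  have \<phi>h: "\<phi> j \<in> lin_hom R (trm J j) (trm K j)" for j using e by blast
  have com: "\<phi> (Suc j) (dif J j x) = dif K j (\<phi> j x)" if "x \<in> carrier (trm J j)" for j x
    using e that by blast
  show "\<phi> j \<in> lin_hom R (trm J j) (trm K j)" by (rule \<phi>h)
  show "cosyzygy_map f \<phi> (Suc j) (dif J j z) = dif K j (\<phi> j z)" if "z \<in> carrier (trm J j)"
    using com[OF that] by simp
  show "\<phi> j (cosyzygy_emb J j x) = cosyzygy_emb K j (cosyzygy_map f \<phi> j x)" if "x \<in> carrier (cosyzygy M J j)"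
    using that e by (cases j) simp_all
  show "cosyzygy_map f \<phi> j \<in> lin_hom R (cosyzygy M J j) (cosyzygy N K j)"
  proof (cases j)
    case (Suc k)
    have "\<phi> (Suc k) \<in> lin_hom R (cosyzygy M J (Suc k)) (trm K (Suc k))"
      using lin_hom_from_submodule[OF \<phi>h] lin_hom_closed[OF injres_dif[OF J]] by (simp add: image_subset_iff)
    then show ?thesis
      unfolding Suc cosyzygy_simps
      by (rule lin_hom_into_submodule) (auto simp: com lin_hom_closed[OF \<phi>h])
  qed (simp add: f)
qed

lemma cosyzygy_short_exact:
  assumes ses: "short_exact R B' f B g B''" and hs: "injective_horseshoe R B' f B g B'' J' u J v J''"
  shows "short_exact R (cosyzygy B' J' j) (cosyzygy_map f u j) (cosyzygy B J j) (cosyzygy_map g v j) (cosyzygy B'' J'' j)"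
proof (induction j)
  case 0
  show ?case using ses by simp
next
  case (Suc j)
  note s = short_exactD[OF ses]
  note h = hs[unfolded injective_horseshoe_def]
  have J': "injective_resolution R B' J'" and J: "injective_resolution R B J" and J'': "injective_resolution R B'' J''"
    and u: "injective_extension R f B' J' J u" and v: "injective_extension R g B J J'' v"
    and si: "short_exact R (trm J' j) (u j) (trm J j) (v j) (trm J'' j)"
    using h by blast+
  show ?case
    by (rule three_by_three[OF Suc si cosyzygy_module[OF J'] cosyzygy_module[OF J] cosyzygy_module[OF J'']
          cosyzygy_emb[OF J'] cosyzygy_emb[OF J] cosyzygy_emb[OF J'']
          cosyzygy_dif[OF J'] cosyzygy_dif[OF J] cosyzygy_dif[OF J'']
          cosyzygy_map[OF J' J s(4) u] cosyzygy_map[OF J J'' s(5) v] cosyzygy_emb_inj[OF J'']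
          cosyzygy_kernel[OF J'] cosyzygy_kernel[OF J] cosyzygy_kernel[OF J'']
          cosyzygy_dif_onto[OF J'] cosyzygy_dif_onto[OF J] cosyzygy_dif_onto[OF J'']
          cosyzygy_map_emb[OF J' J s(4) u] cosyzygy_map_emb[OF J J'' s(5) v]
          cosyzygy_map_dif[OF J' J s(4) u] cosyzygy_map_dif[OF J J'' s(5) v]])
qed

section \<open>The injective stabilization\<close>

lemma injective_extend:
  assumes "injective_module R I" "left_module R M" "left_module R N"
    "i \<in> lin_hom R M N" "inj_on i (carrier M)" "h \<in> lin_hom R M I"
  shows "\<exists>k\<in>lin_hom R N I. \<forall>x\<in>carrier M. k (i x) = h x"
  using assms(1)[unfolded injective_module_def, THEN conjunct2, rule_format, of M N i h] assms(2-6) by simp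

context right_exact_functor begin

text \<open>The map \<open>j h\<close> extends along \<open>i\<close> to a map \<open>I \<rightarrow> K\<close>, so \<open>F (j h)\<close> factors through \<open>F i\<close>. This single fact
  shows that the injective stabilization is independent of the embedding, that it is functorial, and
  (with \<open>h\<close> the identity) that it contains the kernel of \<open>F i\<close> for every embedding \<open>i\<close>.\<close>

lemma F_embedding_kernel_mono:
  assumes lm: "lm M" "lm N" and I: "lm I" and K: "injective_module R K"
    and i: "i \<in> lin_hom R M I" "inj_on i (carrier M)"
    and h: "h \<in> lin_hom R M N" and j: "j \<in> lin_hom R N K"
    and x: "x \<in> carrier (fobj F M)" "fmap F M I i x = \<one>\<^bsub>fobj F I\<^esub>"
  shows "fmap F N K j (fmap F M N h x) = \<one>\<^bsub>fobj F K\<^esub>"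
proof -
  have K': "lm K" using K by (rule injective_left_module)
  have jh: "(\<lambda>x. j (h x)) \<in> lin_hom R M K" by (rule lin_hom_comp[OF h j])
  obtain k where k: "k \<in> lin_hom R I K" "\<And>x. x \<in> carrier M \<Longrightarrow> k (i x) = j (h x)"
    using injective_extend[OF K lm(1) I i jh] by blast
  have "fmap F N K j (fmap F M N h x) = fmap F I K k (fmap F M I i x)"
    by (rule F_square[OF lm(1,2) I K' h j i(1) k(1) _ x(1)]) (simp add: k(2))
  then show ?thesis using x(2) F_one[OF I K' k(1)] by simp
qed

context
  fixes M I0 I1 :: "('r, 'm) module" and \<iota> \<eta>
  assumes cop: "injective_copresentation R M \<iota> I0 \<eta> I1"
begin

lemma copresentation_facts:
  "lm M" "injective_module R I0" "lm I0" "\<iota> \<in> lin_hom R M I0" "inj_on \<iota> (carrier M)"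
  using cop injective_left_module unfolding injective_copresentation_def by blast+

lemma inj_stab_eq: "inj_stab R F M = (fobj F M)\<lparr>carrier := kernel (fobj F M) (fobj F I0) (fmap F M I0 \<iota>)\<rparr>"
proof -
  note c = copresentation_facts
  let ?P = "\<lambda>(\<iota>, I0, \<delta>, I1). injective_copresentation R M \<iota> I0 \<delta> I1"
  obtain \<iota>' I0' \<delta>' I1' where ch: "chosen_copresentation R M = (\<iota>', I0', \<delta>', I1')" by (metis prod_cases4)
  have "\<exists>x. ?P x" using cop by auto
  then have "?P (chosen_copresentation R M)" unfolding chosen_copresentation_def by (rule someI_ex)
  then have "injective_copresentation R M \<iota>' I0' \<delta>' I1'" by (simp add: ch)
  then have c': "injective_module R I0'" "lm I0'" "\<iota>' \<in> lin_hom R M I0'" "inj_on \<iota>' (carrier M)"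
    using injective_left_module unfolding injective_copresentation_def by blast+
  have "fmap F M I0' \<iota>' x = \<one>\<^bsub>fobj F I0'\<^esub> \<longleftrightarrow> fmap F M I0 \<iota> x = \<one>\<^bsub>fobj F I0\<^esub>" if x: "x \<in> carrier (fobj F M)" for x
  proof
    assume "fmap F M I0' \<iota>' x = \<one>\<^bsub>fobj F I0'\<^esub>"
    from F_embedding_kernel_mono[OF c(1,1) c'(2) c(2) c'(3,4) lin_hom_id c(4) x this]
    show "fmap F M I0 \<iota> x = \<one>\<^bsub>fobj F I0\<^esub>" using F_id[OF c(1) _ x, of id] by simp
  next
    assume "fmap F M I0 \<iota> x = \<one>\<^bsub>fobj F I0\<^esub>"
    from F_embedding_kernel_mono[OF c(1,1) c(3) c'(1) c(4,5) lin_hom_id c'(3) x this]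
    show "fmap F M I0' \<iota>' x = \<one>\<^bsub>fobj F I0'\<^esub>" using F_id[OF c(1) _ x, of id] by simp
  qed
  then have "kernel (fobj F M) (R0 R F M) (rho R F M) = kernel (fobj F M) (fobj F I0) (fmap F M I0 \<iota>)"
    by (auto simp: R0_def rho_def ch mem_kernel)
  then show ?thesis by (simp add: inj_stab_def)
qed

lemma inj_stab_iff: "x \<in> carrier (inj_stab R F M) \<longleftrightarrow> x \<in> carrier (fobj F M) \<and> fmap F M I0 \<iota> x = \<one>\<^bsub>fobj F I0\<^esub>"
  by (simp add: inj_stab_eq mem_kernel)

lemma inj_stab_subgroup: "subgroup (carrier (inj_stab R F M)) (fobj F M)"
proof -
  note c = copresentation_facts
  interpret comm_group "fobj F M" by (rule F_comm_group[OF c(1)])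
  show ?thesis using kernel_subgroup[OF F_comm_group[OF c(3)] F_hom[OF c(1,3,4)]] by (simp add: inj_stab_eq)
qed

lemma inj_stab_comm_group: "comm_group (inj_stab R F M)"
  using comm_group.subgroup_comm_group[OF F_comm_group[OF copresentation_facts(1)] inj_stab_subgroup]
  by (simp add: inj_stab_eq)

end

lemma inj_stab_restrict: "(fobj F M)\<lparr>carrier := carrier (inj_stab R F M)\<rparr> = inj_stab R F M"
  by (simp add: inj_stab_def)

lemma inj_stab_mult: "x \<otimes>\<^bsub>inj_stab R F M\<^esub> y = x \<otimes>\<^bsub>fobj F M\<^esub> y"
  and inj_stab_one: "\<one>\<^bsub>inj_stab R F M\<^esub> = \<one>\<^bsub>fobj F M\<^esub>"
  by (simp_all add: inj_stab_def)

lemma inj_stab_map_closed: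
  assumes M: "injective_copresentation R M \<iota> I0 \<eta> I1" and N: "injective_copresentation R N \<kappa> K0 \<epsilon> K1"
    and h: "h \<in> lin_hom R M N" and x: "x \<in> carrier (inj_stab R F M)"
  shows "fmap F M N h x \<in> carrier (inj_stab R F N)"
proof -
  note m = copresentation_facts[OF M] and n = copresentation_facts[OF N]
  show ?thesis
    using x F_closed[OF m(1) n(1) h] F_embedding_kernel_mono[OF m(1) n(1) m(3) n(2) m(4,5) h n(4)]
    by (simp add: inj_stab_iff[OF M] inj_stab_iff[OF N])
qed

lemma inj_stab_map_hom:
  assumes M: "injective_copresentation R M \<iota> I0 \<eta> I1" and N: "injective_copresentation R N \<kappa> K0 \<epsilon> K1"
    and h: "h \<in> lin_hom R M N"
  shows "fmap F M N h \<in> hom (inj_stab R F M) (inj_stab R F N)"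
  by (rule homI)
    (use inj_stab_map_closed[OF M N h] F_mult[OF copresentation_facts(1)[OF M] copresentation_facts(1)[OF N] h]
      in \<open>simp_all add: inj_stab_mult inj_stab_iff[OF M]\<close>)

text \<open>The image of \<open>L\<^sub>1F(B'')\<close> is the kernel of \<open>F(B') \<rightarrow> F(B)\<close>, and \<open>B' \<rightarrow> B\<close> is an embedding; so nothing is
  lost when \<open>F(B')\<close> is cut down to the stabilization.\<close>

lemma L1_stab_exact:
  fixes B' B B'' :: "('r, 'm) module"
  assumes ses: "short_exact R B' f B g B''"
    and B': "injective_copresentation R B' \<iota>' I' \<eta>' K'" and B: "injective_copresentation R B \<iota> I \<eta> K"
  shows "exact_at (Lder R F 1 B) (Lder_map R F 1 B B'' g) (Lder R F 1 B'') (L1_connecting R F B' f B g B'') (inj_stab R F B')"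
    and "exact_at (Lder R F 1 B'') (L1_connecting R F B' f B g B'') (inj_stab R F B') (fmap F B' B f) (inj_stab R F B)"
proof -
  note s = short_exactD[OF ses] and b' = copresentation_facts[OF B'] and b = copresentation_facts[OF B]
  note ex = L1_connecting_exact[OF ses]
  have ker: "y \<in> carrier (inj_stab R F B')" if y: "y \<in> carrier (fobj F B')" "fmap F B' B f y = \<one>\<^bsub>fobj F B\<^esub>" for y
    using F_embedding_kernel_mono[OF s(1,1,2) b'(2) s(4,6) lin_hom_id b'(4) y] F_id[OF s(1) _ y(1), of id] y(1)
    by (simp add: inj_stab_iff[OF B'])
  have im: "L1_connecting R F B' f B g B'' x \<in> carrier (inj_stab R F B')" if x: "x \<in> carrier (Lder R F 1 B'')" for x
  proof -
    have "L1_connecting R F B' f B g B'' x \<in> kernel (fobj F B') (fobj F B) (fmap F B' B f)"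
      using ex(2) imageI[OF x, of "L1_connecting R F B' f B g B''"] by (simp add: exact_at_def)
    then show ?thesis using ker by (simp add: mem_kernel)
  qed
  show "exact_at (Lder R F 1 B) (Lder_map R F 1 B B'' g) (Lder R F 1 B'') (L1_connecting R F B' f B g B'') (inj_stab R F B')"
    using exact_at_restrict_target[OF ex(1) inj_stab_subgroup[OF B'] im] by (simp add: inj_stab_restrict)
  show "exact_at (Lder R F 1 B'') (L1_connecting R F B' f B g B'') (inj_stab R F B') (fmap F B' B f) (inj_stab R F B)"
    using exact_at_restrict_middle[OF ex(2) inj_stab_subgroup[OF B'] inj_stab_subgroup[OF B] ker
        inj_stab_map_closed[OF B' B s(4)]] by (simp add: inj_stab_restrict)
qed

section \<open>The snake for the injective stabilization\<close>

context
  fixes B' B B'' :: "('r, 'm) module" and J' J J'' :: "('r, 'm) resolution" and f g :: "'m \<Rightarrow> 'm" and u v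
    and j :: nat
  assumes ses: "short_exact R B' f B g B''" and hs: "injective_horseshoe R B' f B g B'' J' u J v J''"
begin

text \<open>After applying \<open>F\<close>, the \<open>j\<close>-th diagram has the horizontal maps \<open>Fa\<close>, \<open>Fb\<close> between cosyzygies and
  \<open>Fp\<close>, \<open>Fq\<close> between injective modules, the vertical embeddings \<open>Fe'\<close>, \<open>Fe\<close>, \<open>Fe''\<close>, and the vertical
  projections \<open>Fd'\<close>, \<open>Fd\<close> to the next cosyzygies.\<close>

abbreviation "S' \<equiv> cosyzygy B' J'"
abbreviation "S \<equiv> cosyzygy B J"
abbreviation "S'' \<equiv> cosyzygy B'' J''"
abbreviation "Fa k \<equiv> fmap F (S' k) (S k) (cosyzygy_map f u k)"
abbreviation "Fb k \<equiv> fmap F (S k) (S'' k) (cosyzygy_map g v k)"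
abbreviation "Fe' \<equiv> fmap F (S' j) (trm J' j) (cosyzygy_emb J' j)"
abbreviation "Fe \<equiv> fmap F (S j) (trm J j) (cosyzygy_emb J j)"
abbreviation "Fe'' \<equiv> fmap F (S'' j) (trm J'' j) (cosyzygy_emb J'' j)"
abbreviation "Fp \<equiv> fmap F (trm J' j) (trm J j) (u j)"
abbreviation "Fq \<equiv> fmap F (trm J j) (trm J'' j) (v j)"
abbreviation "Fd' \<equiv> fmap F (trm J' j) (S' (Suc j)) (dif J' j)"
abbreviation "Fd \<equiv> fmap F (trm J j) (S (Suc j)) (dif J j)"

lemma
  shows J'_res: "injective_resolution R B' J'" and J_res: "injective_resolution R B J" and J''_res: "injective_resolution R B'' J''"
    and u_ext: "injective_extension R f B' J' J u" and v_ext: "injective_extension R g B J J'' v"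
    and sesI: "\<And>k. short_exact R (trm J' k) (u k) (trm J k) (v k) (trm J'' k)"
  using hs unfolding injective_horseshoe_def by blast+

lemmas f_hom = short_exactD(4)[OF ses] and g_hom = short_exactD(5)[OF ses]
lemmas cop' = cosyzygy_copresentation[OF J'_res] and cop = cosyzygy_copresentation[OF J_res]
  and cop'' = cosyzygy_copresentation[OF J''_res]
lemmas sesS = cosyzygy_short_exact[OF ses hs]
lemmas modS' = cosyzygy_module[OF J'_res] and modS = cosyzygy_module[OF J_res] and modS'' = cosyzygy_module[OF J''_res]
lemmas modJ' = injres_trm[OF J'_res] and modJ = injres_trm[OF J_res] and modJ'' = injres_trm[OF J''_res]
lemmas a_hom = cosyzygy_map[OF J'_res J_res f_hom u_ext] and b_hom = cosyzygy_map[OF J_res J''_res g_hom v_ext]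
lemmas u_hom = injective_extension_lin_hom[OF J'_res J_res f_hom u_ext] and v_hom = injective_extension_lin_hom[OF J_res J''_res g_hom v_ext]
lemmas e'_hom = cosyzygy_emb[OF J'_res] and e_hom = cosyzygy_emb[OF J_res] and e''_hom = cosyzygy_emb[OF J''_res]
lemmas d'_hom = cosyzygy_dif[OF J'_res] and d_hom = cosyzygy_dif[OF J_res]

text \<open>\<open>I'\<close> is injective, so \<open>I' \<rightarrow> I\<close> has a retraction, which \<open>F\<close> preserves.\<close>

lemma Fp_inj: "inj_on (fmap F (trm J' k) (trm J k) (u k)) (carrier (fobj F (trm J' k)))"
proof -
  obtain r where "r \<in> lin_hom R (trm J k) (trm J' k)" "\<forall>x\<in>carrier (trm J' k). r (u k x) = id x"
    using injective_extend[OF injres_injective[OF J'_res] modJ' modJ u_hom short_exactD(6)[OF sesI] lin_hom_id] by blast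
  then show ?thesis by (intro F_inj_of_retraction[OF modJ' modJ u_hom]) auto
qed

lemma Fp_one: "\<lbrakk>x \<in> carrier (fobj F (trm J' k)); fmap F (trm J' k) (trm J k) (u k) x = \<one>\<^bsub>fobj F (trm J k)\<^esub>\<rbrakk>
    \<Longrightarrow> x = \<one>\<^bsub>fobj F (trm J' k)\<^esub>"
proof -
  interpret G: comm_group "fobj F (trm J' k)" by (rule F_comm_group[OF modJ'])
  show "\<lbrakk>x \<in> carrier (fobj F (trm J' k)); fmap F (trm J' k) (trm J k) (u k) x = \<one>\<^bsub>fobj F (trm J k)\<^esub>\<rbrakk>
    \<Longrightarrow> x = \<one>\<^bsub>fobj F (trm J' k)\<^esub>"
    using Fp_inj[of k] F_one[OF modJ' modJ u_hom, of k] by (simp add: inj_on_def)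
qed

lemma Fab: "Fa k ` carrier (fobj F (S' k)) = kernel (fobj F (S k)) (fobj F (S'' k)) (Fb k)"
    "Fb k ` carrier (fobj F (S k)) = carrier (fobj F (S'' k))"
  using F_right_exact[OF short_exactD(1-5,10,7)[OF sesS]] by blast+

lemma Fpq: "Fp ` carrier (fobj F (trm J' j)) = kernel (fobj F (trm J j)) (fobj F (trm J'' j)) Fq"
  using F_right_exact(1)[OF short_exactD(1-5,10,7)[OF sesI]] .

lemma Fed': "Fe' ` carrier (fobj F (S' j)) = kernel (fobj F (trm J' j)) (fobj F (S' (Suc j))) Fd'"
    "Fd' ` carrier (fobj F (trm J' j)) = carrier (fobj F (S' (Suc j)))"
  using F_right_exact[OF modS' modJ' modS' e'_hom d'_hom cosyzygy_kernel[OF J'_res] cosyzygy_dif_onto[OF J'_res]] .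

lemma Fed: "Fe ` carrier (fobj F (S j)) = kernel (fobj F (trm J j)) (fobj F (S (Suc j))) Fd"
  using F_right_exact(1)[OF modS modJ modS e_hom d_hom cosyzygy_kernel[OF J_res] cosyzygy_dif_onto[OF J_res]] .

lemma Fpe: "x \<in> carrier (fobj F (S' k)) \<Longrightarrow>
    fmap F (trm J' k) (trm J k) (u k) (fmap F (S' k) (trm J' k) (cosyzygy_emb J' k) x)
    = fmap F (S k) (trm J k) (cosyzygy_emb J k) (Fa k x)"
  by (rule F_square[OF modS' modJ' modS modJ e'_hom u_hom a_hom e_hom cosyzygy_map_emb[OF J'_res J_res f_hom u_ext]])

lemma Fqe: "x \<in> carrier (fobj F (S j)) \<Longrightarrow> Fq (Fe x) = Fe'' (Fb j x)"
  by (rule F_square[OF modS modJ modS'' modJ'' e_hom v_hom b_hom e''_hom cosyzygy_map_emb[OF J_res J''_res g_hom v_ext]])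

lemma Fad: "z \<in> carrier (fobj F (trm J' j)) \<Longrightarrow> Fa (Suc j) (Fd' z) = Fd (Fp z)"
  by (rule F_square[OF modJ' modS' modJ modS d'_hom a_hom u_hom d_hom cosyzygy_map_dif[OF J'_res J_res f_hom u_ext]])

lemma Fde: "x \<in> carrier (fobj F (S j)) \<Longrightarrow> Fd (Fe x) = \<one>\<^bsub>fobj F (S (Suc j))\<^esub>"
  using Fed imageI[of x "carrier (fobj F (S j))" Fe] by (simp add: mem_kernel)

lemmas Fa_closed = F_closed[OF modS' modS a_hom] and Fb_closed = F_closed[OF modS modS'' b_hom]
  and Fe'_closed = F_closed[OF modS' modJ' e'_hom] and Fe_closed = F_closed[OF modS modJ e_hom]
  and Fp_closed = F_closed[OF modJ' modJ u_hom]

text \<open>\<open>S' \<rightarrow> I' \<rightarrow> I\<close> factors through \<open>S' \<rightarrow> S\<close>, and \<open>F(I') \<rightarrow> F(I)\<close> is injective.\<close>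

lemma kernel_Fa_stab:
  assumes w: "w \<in> carrier (fobj F (S' k))" "Fa k w = \<one>\<^bsub>fobj F (S k)\<^esub>"
  shows "w \<in> carrier (inj_stab R F (S' k))"
  using Fp_one[OF Fe'_closed[OF w(1)]] Fpe[OF w(1)] w F_one[OF modS modJ e_hom] by (simp add: inj_stab_iff[OF cop'])

lemma stab_exact_middle:
  "exact_at (inj_stab R F (S' k)) (Fa k) (inj_stab R F (S k)) (Fb k) (inj_stab R F (S'' k))"
proof (rule exact_atI)
  show "Fb k (Fa k x) = \<one>\<^bsub>inj_stab R F (S'' k)\<^esub>" if "x \<in> carrier (inj_stab R F (S' k))" for x
    using that Fab(1)[of k] imageI[of x "carrier (fobj F (S' k))" "Fa k"]
    by (simp add: inj_stab_iff[OF cop'] inj_stab_one mem_kernel)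
  fix y assume y: "y \<in> carrier (inj_stab R F (S k))" "Fb k y = \<one>\<^bsub>inj_stab R F (S'' k)\<^esub>"
  then have "y \<in> kernel (fobj F (S k)) (fobj F (S'' k)) (Fb k)"
    by (simp add: mem_kernel inj_stab_iff[OF cop] inj_stab_one)
  then obtain x where x: "x \<in> carrier (fobj F (S' k))" "y = Fa k x" unfolding Fab(1)[symmetric] by blast
  then have "x \<in> carrier (inj_stab R F (S' k))"
    using y(1) Fp_one[OF Fe'_closed[OF x(1)]] Fpe[OF x(1)] by (simp add: inj_stab_iff[OF cop'] inj_stab_iff[OF cop])
  then show "\<exists>x\<in>carrier (inj_stab R F (S' k)). y = Fa k x" using x(2) by blast
qed (rule inj_stab_comm_group[OF cop'] inj_stab_comm_group[OF cop] inj_stab_comm_group[OF cop'']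
    inj_stab_map_hom[OF cop' cop a_hom] inj_stab_map_hom[OF cop cop'' b_hom])+

abbreviation "stab_conn \<equiv> stab_connecting F B' B g B'' J' u J v J'' j"

lemma Fe_liftable:
  assumes y: "y \<in> carrier (fobj F (S j))" "Fb j y \<in> carrier (inj_stab R F (S'' j))"
  shows "\<exists>z\<in>carrier (fobj F (trm J' j)). Fp z = Fe y"
proof -
  have "Fe y \<in> kernel (fobj F (trm J j)) (fobj F (trm J'' j)) Fq"
    using Fqe[OF y(1)] y Fe_closed[OF y(1)] by (simp add: mem_kernel inj_stab_iff[OF cop''])
  then show ?thesis unfolding Fpq[symmetric] by auto
qed

lemma
  shows stab_conn_value: "\<And>y z. \<lbrakk>y \<in> carrier (fobj F (S j)); Fb j y \<in> carrier (inj_stab R F (S'' j));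
          z \<in> carrier (fobj F (trm J' j)); Fp z = Fe y\<rbrakk> \<Longrightarrow> stab_conn (Fb j y) = Fd' z"
    and stab_conn_hom_F: "stab_conn \<in> hom (inj_stab R F (S'' j)) (fobj F (S' (Suc j)))"
proof -
  interpret G: comm_group "fobj F (S j)" by (rule F_comm_group[OF modS])
  define K where "K = {y \<in> carrier (fobj F (S j)). Fb j y \<in> carrier (inj_stab R F (S'' j))}"
  let ?A = "fobj F (S j)\<lparr>carrier := K\<rparr>" and ?Z = "fobj F (trm J' j)" and ?Q = "inj_stab R F (S'' j)"
  have KI: "y \<in> K \<longleftrightarrow> y \<in> carrier (fobj F (S j)) \<and> Fb j y \<in> carrier ?Q" for y by (simp add: K_def)
  have K: "subgroup K (fobj F (S j))"
    unfolding K_def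
    by (rule G.preimage_subgroup[OF F_comm_group[OF modS''] F_hom[OF modS modS'' b_hom] inj_stab_subgroup[OF cop'']])
  have pi: "Fb j \<in> hom ?A ?Q"
    by (rule homI) (auto simp: KI inj_stab_mult F_mult[OF modS modS'' b_hom])
  have al: "Fe \<in> hom ?A (fobj F (trm J j))"
    by (rule homI) (auto simp: KI Fe_closed F_mult[OF modS modJ e_hom])
  have onto: "Fb j ` carrier ?A = carrier ?Q"
  proof (intro equalityI subsetI)
    fix x assume x: "x \<in> carrier ?Q"
    then have "x \<in> Fb j ` carrier (fobj F (S j))" unfolding Fab(2) by (simp add: inj_stab_iff[OF cop''])
    then show "x \<in> Fb j ` carrier ?A" using x by (auto simp: KI)
  qed (auto simp: KI)
  have pull: "\<exists>z\<in>carrier ?Z. Fp z = Fe y" if "y \<in> carrier ?A" for y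
    using that Fe_liftable[of y] by (simp add: KI)
  have ker: "\<exists>z\<in>carrier ?Z. Fp z = Fe y \<and> Fd' z = \<one>\<^bsub>fobj F (S' (Suc j))\<^esub>"
    if y: "y \<in> carrier ?A" and one: "Fb j y = \<one>\<^bsub>?Q\<^esub>" for y
  proof -
    have "y \<in> kernel (fobj F (S j)) (fobj F (S'' j)) (Fb j)" using y one by (simp add: KI mem_kernel inj_stab_one)
    then obtain x where x: "x \<in> carrier (fobj F (S' j))" "y = Fa j x" unfolding Fab(1)[symmetric] by blast
    have "Fe' x \<in> kernel (fobj F (trm J' j)) (fobj F (S' (Suc j))) Fd'"
      unfolding Fed'(1)[symmetric] using x(1) by (rule imageI)
    then show ?thesis using Fpe[OF x(1)] x(2) by (intro bexI[of _ "Fe' x"]) (simp_all add: mem_kernel)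
  qed
  let ?d = "\<lambda>x. THE w. \<exists>y\<in>carrier ?A. \<exists>z\<in>carrier ?Z. Fb j y = x \<and> Fp z = Fe y \<and> w = Fd' z"
  note conn = G.subgroup_comm_group[OF K] F_comm_group[OF modJ] F_comm_group[OF modJ'] inj_stab_comm_group[OF cop'']
    F_comm_group[OF modS'] pi al F_hom[OF modJ' modJ u_hom] F_hom[OF modJ' modS' d'_hom] onto Fp_inj pull ker
  have eq: "stab_conn x = ?d x" if x: "x \<in> carrier ?Q" for x
  proof -
    have "(\<exists>y\<in>carrier (fobj F (S j)). \<exists>z\<in>carrier ?Z. Fb j y = x \<and> Fp z = Fe y \<and> w = Fd' z) \<longleftrightarrow>
      (\<exists>y\<in>carrier ?A. \<exists>z\<in>carrier ?Z. Fb j y = x \<and> Fp z = Fe y \<and> w = Fd' z)" for w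
      using x by (auto simp: KI simp del: cosyzygy_simps)
    then show ?thesis unfolding stab_connecting_def Let_def by (simp del: cosyzygy_simps)
  qed
  show "stab_conn \<in> hom ?Q (fobj F (S' (Suc j)))"
    by (rule hom_cong_on[OF inj_stab_comm_group[OF cop''] connecting_map_hom[OF conn] eq])
  show "stab_conn (Fb j y) = Fd' z"
    if "y \<in> carrier (fobj F (S j))" "Fb j y \<in> carrier ?Q" "z \<in> carrier ?Z" "Fp z = Fe y" for y z
  proof -
    have "stab_conn (Fb j y) = ?d (Fb j y)" by (rule eq[OF that(2)])
    also have "\<dots> = Fd' z" by (rule connecting_map_value[OF conn]) (use that in \<open>simp_all add: KI\<close>)
    finally show ?thesis .
  qed
qed

lemma stab_conn_lift:
  assumes "x \<in> carrier (inj_stab R F (S'' j))"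
  shows "\<exists>y\<in>carrier (fobj F (S j)). \<exists>z\<in>carrier (fobj F (trm J' j)). x = Fb j y \<and> Fp z = Fe y \<and> stab_conn x = Fd' z"
proof -
  have "x \<in> Fb j ` carrier (fobj F (S j))" unfolding Fab(2) using assms by (simp add: inj_stab_iff[OF cop''])
  then obtain y where y: "y \<in> carrier (fobj F (S j))" "x = Fb j y" by blast
  then obtain z where "z \<in> carrier (fobj F (trm J' j))" "Fp z = Fe y" using Fe_liftable assms by blast
  then show ?thesis using stab_conn_value y assms by blast
qed

lemma Fa_stab_conn:
  assumes "x \<in> carrier (inj_stab R F (S'' j))"
  shows "Fa (Suc j) (stab_conn x) = \<one>\<^bsub>fobj F (S (Suc j))\<^esub>"
  using stab_conn_lift[OF assms] Fad Fde by fastforce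

text \<open>Exactness at \<open>F(I)\<close> shows that the composite with \<open>F(\<Sigma>S') \<rightarrow> F(\<Sigma>S)\<close> is trivial; so the values lie in
  the stabilization.\<close>

lemma stab_conn_hom: "stab_conn \<in> hom (inj_stab R F (S'' j)) (inj_stab R F (S' (Suc j)))"
proof (rule homI)
  show "stab_conn x \<in> carrier (inj_stab R F (S' (Suc j)))" if "x \<in> carrier (inj_stab R F (S'' j))" for x
    using hom_in_carrier[OF stab_conn_hom_F that] Fa_stab_conn[OF that] by (rule kernel_Fa_stab)
  show "stab_conn (x \<otimes>\<^bsub>inj_stab R F (S'' j)\<^esub> y) = stab_conn x \<otimes>\<^bsub>inj_stab R F (S' (Suc j))\<^esub> stab_conn y"
    if "x \<in> carrier (inj_stab R F (S'' j))" "y \<in> carrier (inj_stab R F (S'' j))" for x y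
    unfolding inj_stab_mult[of "S' (Suc j)"] by (rule hom_mult[OF stab_conn_hom_F that])
qed

lemma stab_exact_right:
  "exact_at (inj_stab R F (S j)) (Fb j) (inj_stab R F (S'' j)) stab_conn (inj_stab R F (S' (Suc j)))"
proof (rule exact_atI)
  interpret G: comm_group "fobj F (S j)" by (rule F_comm_group[OF modS])
  interpret GI: comm_group "fobj F (trm J j)" by (rule F_comm_group[OF modJ])
  interpret GI': comm_group "fobj F (trm J' j)" by (rule F_comm_group[OF modJ'])
  interpret G'': comm_group "fobj F (S'' j)" by (rule F_comm_group[OF modS''])
  show "stab_conn (Fb j y) = \<one>\<^bsub>inj_stab R F (S' (Suc j))\<^esub>" if y: "y \<in> carrier (inj_stab R F (S j))" for y
  proof -
    have y': "y \<in> carrier (fobj F (S j))" "Fe y = \<one>\<^bsub>fobj F (trm J j)\<^esub>" using y by (simp_all add: inj_stab_iff[OF cop])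
    have "stab_conn (Fb j y) = Fd' \<one>\<^bsub>fobj F (trm J' j)\<^esub>"
      using y' F_one[OF modJ' modJ u_hom]
      by (intro stab_conn_value[OF y'(1) inj_stab_map_closed[OF cop cop'' b_hom y] GI'.one_closed]) simp
    then show ?thesis using F_one[OF modJ' modS' d'_hom] by (simp add: inj_stab_one del: cosyzygy_simps)
  qed
  fix x assume x: "x \<in> carrier (inj_stab R F (S'' j))" and one: "stab_conn x = \<one>\<^bsub>inj_stab R F (S' (Suc j))\<^esub>"
  obtain y z where y: "y \<in> carrier (fobj F (S j))" "x = Fb j y"
    and z: "z \<in> carrier (fobj F (trm J' j))" "Fp z = Fe y" "stab_conn x = Fd' z"
    using stab_conn_lift[OF x] by blast
  have "z \<in> kernel (fobj F (trm J' j)) (fobj F (S' (Suc j))) Fd'"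
    using z(1,3) one by (simp add: mem_kernel inj_stab_one del: cosyzygy_simps)
  then obtain x' where x': "x' \<in> carrier (fobj F (S' j))" "z = Fe' x'" unfolding Fed'(1)[symmetric] by blast
  note ax = Fa_closed[OF x'(1)]
  let ?y = "y \<otimes>\<^bsub>fobj F (S j)\<^esub> inv\<^bsub>fobj F (S j)\<^esub> Fa j x'"
  have "Fe (Fa j x') = Fe y" using Fpe[OF x'(1)] x'(2) z(2) by simp
  then have "Fe ?y = \<one>\<^bsub>fobj F (trm J j)\<^esub>"
    using y(1) ax Fe_closed[OF y(1)] by (simp add: F_mult[OF modS modJ e_hom] F_inv[OF modS modJ e_hom])
  then have "?y \<in> carrier (inj_stab R F (S j))" using y(1) ax by (simp add: inj_stab_iff[OF cop])
  moreover have "Fb j (Fa j x') = \<one>\<^bsub>fobj F (S'' j)\<^esub>"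
    using Fab(1)[of j] imageI[OF x'(1), of "Fa j"] by (simp add: mem_kernel)
  then have "Fb j ?y = x"
    using y ax Fb_closed[OF y(1)] by (simp add: F_mult[OF modS modS'' b_hom] F_inv[OF modS modS'' b_hom])
  ultimately show "\<exists>y\<in>carrier (inj_stab R F (S j)). x = Fb j y" by blast
qed (rule inj_stab_comm_group[OF cop'] inj_stab_comm_group[OF cop] inj_stab_comm_group[OF cop'']
    stab_conn_hom inj_stab_map_hom[OF cop cop'' b_hom])+

lemma stab_exact_left:
  "exact_at (inj_stab R F (S'' j)) stab_conn (inj_stab R F (S' (Suc j))) (Fa (Suc j)) (inj_stab R F (S (Suc j)))"
proof (rule exact_atI)
  show "Fa (Suc j) (stab_conn x) = \<one>\<^bsub>inj_stab R F (S (Suc j))\<^esub>" if "x \<in> carrier (inj_stab R F (S'' j))" for x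
    unfolding inj_stab_one by (rule Fa_stab_conn[OF that])
  fix w assume w: "w \<in> carrier (inj_stab R F (S' (Suc j)))" "Fa (Suc j) w = \<one>\<^bsub>inj_stab R F (S (Suc j))\<^esub>"
  then have "w \<in> Fd' ` carrier (fobj F (trm J' j))"
    unfolding Fed'(2) by (simp add: inj_stab_iff[OF cop'] del: cosyzygy_simps)
  then obtain z where z: "z \<in> carrier (fobj F (trm J' j))" "w = Fd' z" by blast
  have "Fp z \<in> kernel (fobj F (trm J j)) (fobj F (S (Suc j))) Fd"
    using Fad[OF z(1)] w(2) z(2) Fp_closed[OF z(1)] by (simp add: mem_kernel inj_stab_one del: cosyzygy_simps)
  then obtain y where y: "y \<in> carrier (fobj F (S j))" "Fp z = Fe y" unfolding Fed[symmetric] by blast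
  have "Fp z \<in> kernel (fobj F (trm J j)) (fobj F (trm J'' j)) Fq"
    unfolding Fpq[symmetric] using z(1) by (rule imageI)
  then have by': "Fb j y \<in> carrier (inj_stab R F (S'' j))"
    using Fqe[OF y(1)] y(2) Fb_closed[OF y(1)] by (simp add: mem_kernel inj_stab_iff[OF cop''])
  have "w = stab_conn (Fb j y)" using stab_conn_value[OF y(1) by' z(1) y(2)] z(2) by simp
  then show "\<exists>x\<in>carrier (inj_stab R F (S'' j)). w = stab_conn x" using by' by blast
qed (rule inj_stab_comm_group[OF cop'] inj_stab_comm_group[OF cop] inj_stab_comm_group[OF cop'']
    stab_conn_hom inj_stab_map_hom[OF cop' cop a_hom])+

end

end

section \<open>The sequence infinite in both directions\<close>

theorem proposition8p5:
  fixes \<Lambda> R :: "'r ring"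
    and F :: "('r, 'm, 'g) mod_functor"
    and B' B B'' :: "('r, 'm) module"
    and f g :: "'m \<Rightarrow> 'm"
    and J' J J'' :: "('r, 'm) resolution"
    and u v :: "nat \<Rightarrow> 'm \<Rightarrow> 'm"
  assumes "ring \<Lambda>"
    and left_or_right: "R = \<Lambda> \<or> R = opposite_ring \<Lambda>"
    and large_type: "infinite (UNIV :: 'm set)" "\<exists>e :: 'r \<Rightarrow> 'm. inj_on e (carrier \<Lambda>)"
    and "covariant_functor R F" and "right_exact R F"
    and "short_exact R B' f B g B''"
    and "injective_horseshoe R B' f B g B'' J' u J v J''"
  defines "S' \<equiv> cosyzygy B' J'" and "S \<equiv> cosyzygy B J" and "S'' \<equiv> cosyzygy B'' J''"
  defines "Ff \<equiv> \<lambda>j. fmap F (S' j) (S j) (cosyzygy_map f u j)"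
    and "Fg \<equiv> \<lambda>j. fmap F (S j) (S'' j) (cosyzygy_map g v j)"
    and "\<delta> \<equiv> stab_connecting F B' B g B'' J' u J v J''"
  shows
    "(\<forall>i\<ge>1. exact_at (Lder R F i B') (Lder_map R F i B' B f)
                      (Lder R F i B) (Lder_map R F i B B'' g)
                      (Lder R F i B'')) \<and>
     (\<forall>i\<ge>1. exact_at (Lder R F (Suc i) B) (Lder_map R F (Suc i) B B'' g)
                      (Lder R F (Suc i) B'') (Lder_connecting R F i B' f B g B'')
                      (Lder R F i B')) \<and>
     (\<forall>i\<ge>1. exact_at (Lder R F (Suc i) B'') (Lder_connecting R F i B' f B g B'')
                      (Lder R F i B') (Lder_map R F i B' B f)
                      (Lder R F i B)) \<and>
     exact_at (Lder R F 1 B) (Lder_map R F 1 B B'' g)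
              (Lder R F 1 B'') (L1_connecting R F B' f B g B'')
              (inj_stab R F B') \<and>
     exact_at (Lder R F 1 B'') (L1_connecting R F B' f B g B'')
              (inj_stab R F B') (fmap F B' B f)
              (inj_stab R F B) \<and>
     (\<forall>j. exact_at (inj_stab R F (S' j)) (Ff j) (inj_stab R F (S j)) (Fg j) (inj_stab R F (S'' j))) \<and>
     (\<forall>j. exact_at (inj_stab R F (S j)) (Fg j)
                   (inj_stab R F (S'' j)) (\<delta> j)
                   (inj_stab R F (S' (Suc j)))) \<and>
     (\<forall>j. exact_at (inj_stab R F (S'' j)) (\<delta> j)
                   (inj_stab R F (S' (Suc j))) (Ff (Suc j))
                   (inj_stab R F (S (Suc j))))"
proof -
  note ses = assms(7) and hs = assms(8)
  interpret B': left_module R B' by (rule short_exactD(1)[OF ses])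
  have "carrier R = carrier \<Lambda>" using left_or_right by (auto simp: opposite_ring_def)
  then interpret right_exact_functor "TYPE('m)" R F
    using assms(3-6) by unfold_locales simp_all
  have J': "injective_resolution R B' J'" and J: "injective_resolution R B J"
    using hs unfolding injective_horseshoe_def by blast+
  note L1 = L1_stab_exact[OF ses cosyzygy_copresentation[OF J', of 0, unfolded cosyzygy_simps]
      cosyzygy_copresentation[OF J, of 0, unfolded cosyzygy_simps]]
  show ?thesis
    unfolding S'_def S_def S''_def Ff_def Fg_def \<delta>_def
    by (intro conjI allI impI Lder_exact_middle[OF ses] Lder_exact_right[OF ses] Lder_exact_left[OF ses] L1
        stab_exact_middle[OF ses hs] stab_exact_right[OF ses hs] stab_exact_left[OF ses hs])
qed

end
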